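(* Assume that $g$ satisfies hypothesis (H) stated in the context and, in addition, hypothesis (H$'$): $\frac{\rho_1}{k_1}\ne\frac{\rho_2}{k_2}$, and $g$ is twice differentiable with $|g''(s)|\le c_2\,g(s)$ for all $s$, for some $c_2>0$. Then the Timoshenko system with memory and fully Dirichlet boundary conditions, i.e. $U_t=\mathcal A_1U$ in $\mathcal H_1$, is not uniformly (exponentially) stable in the energy space $\mathcal H_1$: there do not exist constants $M\ge1$ and $\epsilon>0$ such that $\|e^{t\mathcal A_1}U^0\|_{\mathcal H_1}\le Me^{-\epsilon t}\|U^0\|_{\mathcal H_1}$ for all $t\ge0$ and all $U^0\in\mathcal H_1$.
   Context: Let $\rho_1,\rho_2,k_1,k_2$ be positive constants. Hypothesis (H): $g:(0,\infty)\to(0,\infty)$ is a non-increasing differentiable function such that $\lim_{s\to0}g(s)$ exists (finite), there is $c>0$ with $g'(s)\le -c\,g(s)$ for all $s$, and $\widetilde k_2:=k_2-\int_0^{+\infty}g(s)\,ds>0$. The system is, on $(0,1)$: $\rho_1\varphi_{tt}-k_1(\varphi_x+\psi)_x=0$, $\rho_2\psi_{tt}-\widetilde k_2\psi_{xx}+k_1(\varphi_x+\psi)-\int_0^{+\infty}g(s)\eta_{xx}ds=0$, $\eta_t+\eta_s-\psi_t=0$, with $\varphi,\psi,\eta$ vanishing at $x=0,1$ and $\eta|_{s=0}=0$, where $\eta(x,t,s)=\psi(x,t)-\psi(x,t-s)$. All spaces are complex; $\|\cdot\|$ is the norm of $L^2(0,1)$. $L^2_g(\mathbb R_+,H^1_0)$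 is the Hilbert space of (classes of) functions $\eta:(0,\infty)\to H^1_0(0,1)$ with $\|\eta\|_g^2=\int_0^1\int_0^{+\infty}g(s)|\eta_x(x,s)|^2\,ds\,dx<\infty$. The energy space is $\mathcal H_1=(H^1_0(0,1))^2\times(L^2(0,1))^2\times L^2_g(\mathbb R_+,H^1_0)$ with norm, for $U=(v^1,\dots,v^5)$, $\|U\|_{\mathcal H_1}^2=\rho_1\|v^3\|^2+\rho_2\|v^4\|^2+k_1\|v^1_x+v^2\|^2+\widetilde k_2\|v^2_x\|^2+\|v^5\|_g^2$. The operator $\mathcal A_1$ has domain $$D(\mathcal A_1)=\Big\{U\in\mathcal H_1:\ v^1\in H^2(0,1),\ v^3,v^4\in H^1_0(0,1),\ v^5_s\in L^2_g(\mathbb R_+,H^1_0),\ \widetilde k_2v^2+\int_0^{+\infty}g(s)v^5ds\in H^2(0,1)\cap H^1_0(0,1),\ v^5(x,0)=0\Big\}$$ and $$\mathcal A_1U=\begin{pmatrix}v^3\\ v^4\\ \rho_1^{-1}k_1(v^1_x+v^2)_x\\ \rho_2^{-1}\big((\widetilde k_2v^2+\int_0^{+\infty}g(s)v^5ds)_{xx}-k_1(v^1_x+v^2)\big)\\ v^4-v^5_s\end{pmatrix}.$$ Under (H), $\mathcal A_1$ generates a $C_0$-semigroup of contractions $e^{t\mathcal A_1}$ on $\mathcal H_1$. *)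

theory Defs
  imports "HOL-Analysis.Analysis" "HOL-Library.Function_Algebras"
begin

text \<open>
  Elements of the Lebesgue and Sobolev spaces below are represented by Borel measurable functions
  rather than by classes modulo null sets. All notions are invariant under changes on null sets,
  and two representatives denote the same element exactly when the norm of their difference is 0.
\<close>

abbreviation lborel_on :: "real set \<Rightarrow> real measure" where
  "lborel_on S \<equiv> restrict_space lborel S"

abbreviation I01 :: "real set" where "I01 \<equiv> {0<..<1}"

abbreviation Rpos :: "real set" where "Rpos \<equiv> {0<..}"


section \<open>Lebesgue and Sobolev spaces on the unit interval\<close>

definition L2 :: "(real \<Rightarrow> complex) set" where
  "L2 = {f. f \<in> borel_measurable (lborel_on I01) \<and> integrable (lborel_on I01) (\<lambda>x. (cmod (f x))\<^sup>2)}"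

definition L2_norm :: "(real \<Rightarrow> complex) \<Rightarrow> real" where
  "L2_norm f = sqrt (LINT x|lborel_on I01. (cmod (f x))\<^sup>2)"

text \<open>Test functions of class \<open>C\<^sup>1\<close> with compact support; in one dimension these and the smooth
  ones lead to the same Sobolev spaces.\<close>

definition test_functions :: "real set \<Rightarrow> (real \<Rightarrow> complex) set" where
  "test_functions S = {\<phi>. \<phi> C1_differentiable_on UNIV \<and>
     (\<exists>K. compact K \<and> K \<subseteq> S \<and> (\<forall>x. x \<notin> K \<longrightarrow> \<phi> x = 0))}"

definition has_weak_deriv :: "real set \<Rightarrow> (real \<Rightarrow> complex) \<Rightarrow> (real \<Rightarrow> complex) \<Rightarrow> bool" where
  "has_weak_deriv S f f' \<longleftrightarrow> (\<forall>\<phi>\<in>test_functions S.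
     (LINT x|lborel_on S. f x * vector_derivative \<phi> (at x)) = - (LINT x|lborel_on S. f' x * \<phi> x))"

definition H1 :: "(real \<Rightarrow> complex) set" where
  "H1 = {f \<in> L2. \<exists>f'\<in>L2. has_weak_deriv I01 f f'}"

text \<open>A representative of the weak derivative, which is unique up to a null set.\<close>

definition weak_deriv :: "(real \<Rightarrow> complex) \<Rightarrow> real \<Rightarrow> complex" where
  "weak_deriv f = (SOME f'. f' \<in> L2 \<and> has_weak_deriv I01 f f')"

definition H2 :: "(real \<Rightarrow> complex) set" where
  "H2 = {f \<in> H1. weak_deriv f \<in> H1}"

text \<open>The closure of the test functions in \<open>H1\<close>.\<close>

definition H10 :: "(real \<Rightarrow> complex) set" where
  "H10 = {f \<in> H1. \<forall>\<epsilon>>0. \<exists>\<phi>\<in>test_functions I01.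
     L2_norm (\<lambda>x. f x - \<phi> x) < \<epsilon> \<and> L2_norm (\<lambda>x. weak_deriv f x - vector_derivative \<phi> (at x)) < \<epsilon>}"


section \<open>The weighted history space\<close>

text \<open>A function \<open>\<eta>\<close> from \<open>(0,\<infinity>)\<close> to \<open>H10\<close> is written as \<open>\<eta> x s\<close>, with the space variable first, and is
  represented by a jointly measurable function.\<close>

definition has_x_deriv :: "(real \<Rightarrow> real \<Rightarrow> complex) \<Rightarrow> (real \<Rightarrow> real \<Rightarrow> complex) \<Rightarrow> bool" where
  "has_x_deriv \<eta> \<eta>' \<longleftrightarrow>
     case_prod \<eta>' \<in> borel_measurable (lborel_on I01 \<Otimes>\<^sub>M lborel_on Rpos) \<and>
     (AE s in lborel_on Rpos. (\<lambda>x. \<eta>' x s) \<in> L2 \<and> has_weak_deriv I01 (\<lambda>x. \<eta> x s) (\<lambda>x. \<eta>' x s))"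

definition x_deriv :: "(real \<Rightarrow> real \<Rightarrow> complex) \<Rightarrow> real \<Rightarrow> real \<Rightarrow> complex" where
  "x_deriv \<eta> = (SOME \<eta>'. has_x_deriv \<eta> \<eta>')"

definition L2g :: "(real \<Rightarrow> real) \<Rightarrow> (real \<Rightarrow> real \<Rightarrow> complex) set" where
  "L2g g = {\<eta>. case_prod \<eta> \<in> borel_measurable (lborel_on I01 \<Otimes>\<^sub>M lborel_on Rpos) \<and>
     (AE s in lborel_on Rpos. (\<lambda>x. \<eta> x s) \<in> H10) \<and>
     (\<exists>\<eta>'. has_x_deriv \<eta> \<eta>') \<and>
     integrable (lborel_on I01 \<Otimes>\<^sub>M lborel_on Rpos) (\<lambda>(x, s). g s * (cmod (x_deriv \<eta> x s))\<^sup>2)}"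

definition L2g_norm :: "(real \<Rightarrow> real) \<Rightarrow> (real \<Rightarrow> real \<Rightarrow> complex) \<Rightarrow> real" where
  "L2g_norm g \<eta> = sqrt (LINT x|lborel_on I01. LINT s|lborel_on Rpos. g s * (cmod (x_deriv \<eta> x s))\<^sup>2)"

definition has_s_deriv :: "(real \<Rightarrow> real) \<Rightarrow> (real \<Rightarrow> real \<Rightarrow> complex) \<Rightarrow> (real \<Rightarrow> real \<Rightarrow> complex) \<Rightarrow> bool" where
  "has_s_deriv g \<eta> \<eta>' \<longleftrightarrow> \<eta>' \<in> L2g g \<and> (AE x in lborel_on I01. has_weak_deriv Rpos (\<eta> x) (\<eta>' x))"

definition s_deriv :: "(real \<Rightarrow> real) \<Rightarrow> (real \<Rightarrow> real \<Rightarrow> complex) \<Rightarrow> real \<Rightarrow> real \<Rightarrow> complex" where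
  "s_deriv g \<eta> = (SOME \<eta>'. has_s_deriv g \<eta> \<eta>')"

text \<open>The condition \<open>\<eta>(x,0) = 0\<close> in the sense of traces: the \<open>H10\<close>-norm of \<open>\<eta>(\<cdot>,s)\<close> has
  essential limit 0 as \<open>s\<close> tends to 0.\<close>

definition zero_trace :: "(real \<Rightarrow> real \<Rightarrow> complex) \<Rightarrow> bool" where
  "zero_trace \<eta> \<longleftrightarrow> (\<forall>\<epsilon>>0. \<exists>\<delta>>0. AE s in lborel_on Rpos. s < \<delta> \<longrightarrow> L2_norm (\<lambda>x. x_deriv \<eta> x s) < \<epsilon>)"


section \<open>The memory kernel\<close>

definition reduced_k2 :: "real \<Rightarrow> (real \<Rightarrow> real) \<Rightarrow> real" where
  "reduced_k2 k2 g = k2 - (LINT s|lborel_on Rpos. g s)"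

definition hypothesis_H :: "real \<Rightarrow> (real \<Rightarrow> real) \<Rightarrow> bool" where
  "hypothesis_H k2 g \<longleftrightarrow>
     (\<forall>s>0. g s > 0) \<and>
     antimono_on Rpos g \<and>
     (\<forall>s>0. g differentiable (at s)) \<and>
     (\<exists>L. (g \<longlongrightarrow> L) (at_right 0)) \<and>
     (\<exists>c>0. \<forall>s>0. deriv g s \<le> - c * g s) \<and>
     reduced_k2 k2 g > 0"

definition hypothesis_H' :: "real \<Rightarrow> real \<Rightarrow> real \<Rightarrow> real \<Rightarrow> (real \<Rightarrow> real) \<Rightarrow> bool" where
  "hypothesis_H' \<rho>1 \<rho>2 k1 k2 g \<longleftrightarrow>
     \<rho>1 / k1 \<noteq> \<rho>2 / k2 \<and>
     (\<forall>s>0. g differentiable (at s)) \<and> (\<forall>s>0. deriv g differentiable (at s)) \<and>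
     (\<exists>c2>0. \<forall>s>0. \<bar>deriv (deriv g) s\<bar> \<le> c2 * g s)"


section \<open>The energy space and the operator\<close>

type_synonym state =
  "(real \<Rightarrow> complex) \<times> (real \<Rightarrow> complex) \<times> (real \<Rightarrow> complex) \<times> (real \<Rightarrow> complex) \<times> (real \<Rightarrow> real \<Rightarrow> complex)"

text \<open>Addition and subtraction of states are the library's componentwise and pointwise ones.\<close>

fun scale_state :: "complex \<Rightarrow> state \<Rightarrow> state" where
  "scale_state c (v1, v2, v3, v4, v5) =
     (\<lambda>x. c * v1 x, \<lambda>x. c * v2 x, \<lambda>x. c * v3 x, \<lambda>x. c * v4 x, \<lambda>x s. c * v5 x s)"

definition energy_space :: "(real \<Rightarrow> real) \<Rightarrow> state set" where
  "energy_space g = H10 \<times> H10 \<times> L2 \<times> L2 \<times> L2g g"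

fun energy_norm :: "real \<Rightarrow> real \<Rightarrow> real \<Rightarrow> real \<Rightarrow> (real \<Rightarrow> real) \<Rightarrow> state \<Rightarrow> real" where
  "energy_norm \<rho>1 \<rho>2 k1 k2 g (v1, v2, v3, v4, v5) =
     sqrt (\<rho>1 * (L2_norm v3)\<^sup>2 + \<rho>2 * (L2_norm v4)\<^sup>2
       + k1 * (L2_norm (\<lambda>x. weak_deriv v1 x + v2 x))\<^sup>2
       + reduced_k2 k2 g * (L2_norm (weak_deriv v2))\<^sup>2
       + (L2g_norm g v5)\<^sup>2)"

definition total_stress ::
  "real \<Rightarrow> (real \<Rightarrow> real) \<Rightarrow> (real \<Rightarrow> complex) \<Rightarrow> (real \<Rightarrow> real \<Rightarrow> complex) \<Rightarrow> real \<Rightarrow> complex" where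
  "total_stress k2 g v2 v5 =
     (\<lambda>x. of_real (reduced_k2 k2 g) * v2 x + (LINT s|lborel_on Rpos. of_real (g s) * v5 x s))"

definition domain_A1 :: "real \<Rightarrow> (real \<Rightarrow> real) \<Rightarrow> state set" where
  "domain_A1 k2 g = {(v1, v2, v3, v4, v5) \<in> energy_space g.
     v1 \<in> H2 \<and> v3 \<in> H10 \<and> v4 \<in> H10 \<and>
     (\<exists>\<eta>'. has_s_deriv g v5 \<eta>') \<and>
     total_stress k2 g v2 v5 \<in> H2 \<inter> H10 \<and>
     zero_trace v5}"

fun A1 :: "real \<Rightarrow> real \<Rightarrow> real \<Rightarrow> real \<Rightarrow> (real \<Rightarrow> real) \<Rightarrow> state \<Rightarrow> state" where
  "A1 \<rho>1 \<rho>2 k1 k2 g (v1, v2, v3, v4, v5) =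
     (v3,
      v4,
      \<lambda>x. of_real (k1 / \<rho>1) * weak_deriv (\<lambda>y. weak_deriv v1 y + v2 y) x,
      \<lambda>x. of_real (1 / \<rho>2) *
        (weak_deriv (weak_deriv (total_stress k2 g v2 v5)) x - of_real k1 * (weak_deriv v1 x + v2 x)),
      \<lambda>x s. v4 x - s_deriv g v5 x s)"


section \<open>Semigroups\<close>

text \<open>Here \<open>X\<close> is a space of representatives with scaling \<open>sc\<close> and (semi)norm \<open>N\<close>; elements \<open>U\<close> and \<open>V\<close> are
  identified when \<open>N (U - V) = 0\<close>. By linearity and boundedness \<open>T t\<close> respects this identification.\<close>

definition C0_semigroup ::
  "(complex \<Rightarrow> 'a::ab_group_add \<Rightarrow> 'a) \<Rightarrow> 'a set \<Rightarrow> ('a \<Rightarrow> real) \<Rightarrow> (real \<Rightarrow> 'a \<Rightarrow> 'a) \<Rightarrow> bool" where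
  "C0_semigroup sc X N T \<longleftrightarrow>
     (\<forall>t\<ge>0. \<forall>U\<in>X. T t U \<in> X) \<and>
     (\<forall>t\<ge>0. \<forall>U\<in>X. \<forall>V\<in>X. N (T t (U + V) - (T t U + T t V)) = 0) \<and>
     (\<forall>t\<ge>0. \<forall>c. \<forall>U\<in>X. N (T t (sc c U) - sc c (T t U)) = 0) \<and>
     (\<forall>t\<ge>0. \<exists>C. \<forall>U\<in>X. N (T t U) \<le> C * N U) \<and>
     (\<forall>U\<in>X. N (T 0 U - U) = 0) \<and>
     (\<forall>t\<ge>0. \<forall>s\<ge>0. \<forall>U\<in>X. N (T (t + s) U - T t (T s U)) = 0) \<and>
     (\<forall>U\<in>X. ((\<lambda>t. N (T t U - U)) \<longlongrightarrow> 0) (at_right 0))"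

text \<open>The operator \<open>A\<close> with domain \<open>D\<close> is the infinitesimal generator of \<open>T\<close>, including equality of
  domains.\<close>

definition generates_semigroup ::
  "(complex \<Rightarrow> 'a::ab_group_add \<Rightarrow> 'a) \<Rightarrow> 'a set \<Rightarrow> ('a \<Rightarrow> real) \<Rightarrow> 'a set \<Rightarrow> ('a \<Rightarrow> 'a)
     \<Rightarrow> (real \<Rightarrow> 'a \<Rightarrow> 'a) \<Rightarrow> bool" where
  "generates_semigroup sc X N D A T \<longleftrightarrow>
     C0_semigroup sc X N T \<and>
     (\<forall>U\<in>X. \<forall>V\<in>X.
        ((\<lambda>h. N (sc (of_real (1 / h)) (T h U - U) - V)) \<longlongrightarrow> 0) (at_right 0)
        \<longleftrightarrow> U \<in> D \<and> N (V - A U) = 0)"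

definition uniformly_stable :: "'a set \<Rightarrow> ('a \<Rightarrow> real) \<Rightarrow> (real \<Rightarrow> 'a \<Rightarrow> 'a) \<Rightarrow> bool" where
  "uniformly_stable X N T \<longleftrightarrow>
     (\<exists>M\<ge>1. \<exists>\<epsilon>>0. \<forall>t\<ge>0. \<forall>U\<in>X. N (T t U) \<le> M * exp (- \<epsilon> * t) * N U)"

end

theory Submission
  imports Defs
begin

text \<open>If the semigroup were uniformly stable, every \<open>U\<close> in the domain of the generator \<open>A\<close> would satisfy
  \<open>\<parallel>U\<parallel> \<le> C \<parallel>\<i> \<omega> U - A U\<parallel>\<close> with \<open>C\<close> independent of the real number \<open>\<omega>\<close>. This fails along a sequence of
  quasimodes. Let \<open>\<nu> = 2 pi n\<close> and \<open>\<rho>1 \<omega>\<^sup>2 = k1 \<nu>\<^sup>2\<close>, so that \<open>\<phi> = sin (\<nu> x) / \<nu>\<close> solves the first equation without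
  coupling. Since \<open>\<rho>1 / k1 \<noteq> \<rho>2 / k2\<close>, the coupling term \<open>k1 \<phi>' = k1 cos (\<nu> x)\<close> in the second equation is
  compensated by \<open>a cos (\<nu> x)\<close> with \<open>a\<close> of order \<open>1 / n\<^sup>2\<close>. To satisfy the Dirichlet conditions take
  \<open>\<psi> = a (cos (\<nu> x) - cos (\<tau> x))\<close>, where \<open>\<tau>\<close> is the multiple of \<open>2 pi\<close> nearest to the frequency
  \<open>\<omega> sqrt (\<rho>2 / k2)\<close> that is resonant for the second equation; the extra mode costs \<open>O(1 / n)\<close>. With the
  history \<open>\<psi> (1 - exp (- \<i> \<omega> s))\<close> the memory contributes \<open>\<psi>''\<close> times the Fourier transform of \<open>g\<close> at
  \<open>\<omega>\<close>, which is \<open>O(1 / \<omega>)\<close> because \<open>g\<close> is bounded and decreasing. The residual is therefore \<open>O(1 / n)\<close>,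
  while the energy of the quasimode stays bounded below.\<close>

section \<open>Cutoff functions and test functions\<close>

text \<open>The Dirichlet conditions shape the construction: the coupling term in the second
  equation is a cosine, which does not vanish at the ends. All spatial frequencies are therefore
  multiples of 2 pi, so that every cosine equals 1 at both ends and differences of cosines vanish
  there. Rounding the resonant frequency to such a multiple moves it by at most pi, hence its square
  by O(n), and the amplitude a = O(1 / n^2) turns this into O(1 / n). For the same reason
  \<open>\<psi>'\<close>, the residual of the first equation, is O(1 / n). But
  \<open>\<psi>''\<close> is only O(1), so the memory term has to gain its decay from the kernel.
  The resonance involves k2 and not the reduced stiffness because the non-oscillating part of the
  history gives the integral of g back. A second obstacle is one of representation:
  \<open>weak_deriv\<close>, \<open>x_deriv\<close> and \<open>s_deriv\<close> are arbitrary
  choices, and the energy norm is only a seminorm on functions. The operator can be evaluated on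
  explicit functions only up to null sets, through uniqueness of weak derivatives in x and in
  s.\<close>

definition C1_deriv :: "(real \<Rightarrow> 'a::real_normed_vector) \<Rightarrow> (real \<Rightarrow> 'a) \<Rightarrow> bool" where
  "C1_deriv f f' \<longleftrightarrow> (\<forall>x. (f has_vector_derivative f' x) (at x)) \<and> continuous_on UNIV f'"

lemma C1_derivD:
  assumes "C1_deriv f f'"
  shows "(f has_vector_derivative f' x) (at x within S)" "continuous_on S f'" "continuous_on S f"
proof -
  have d: "(f has_vector_derivative f' x) (at x)" for x
    using assms by (simp add: C1_deriv_def)
  show "(f has_vector_derivative f' x) (at x within S)"
    using d by (rule has_vector_derivative_at_within)
  show "continuous_on S f'"
    using assms continuous_on_subset unfolding C1_deriv_def by blast
  show "continuous_on S f"
    using d by (intro continuous_at_imp_continuous_on ballI has_vector_derivative_continuous)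
qed

lemma C1_deriv_mult:
  fixes f h :: "real \<Rightarrow> 'a::real_normed_algebra"
  assumes "C1_deriv f f'" "C1_deriv h h'"
  shows "C1_deriv (\<lambda>x. f x * h x) (\<lambda>x. f x * h' x + f' x * h x)"
  using assms unfolding C1_deriv_def
  by (auto intro!: has_vector_derivative_mult continuous_intros C1_derivD(2,3)[OF assms(1)] C1_derivD(2,3)[OF assms(2)])

lemma C1_deriv_of_real:
  assumes "C1_deriv f f'"
  shows "C1_deriv (\<lambda>x. complex_of_real (f x)) (\<lambda>x. complex_of_real (f' x))"
  using assms unfolding C1_deriv_def
  by (auto intro!: has_vector_derivative_of_real continuous_intros
       simp: has_real_derivative_iff_has_vector_derivative)

lemma C1_deriv_affine:
  fixes f :: "real \<Rightarrow> real"
  assumes "C1_deriv f f'"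
  shows "C1_deriv (\<lambda>x. f (m * x + c)) (\<lambda>x. m * f' (m * x + c))"
proof -
  have "((\<lambda>x. f (m * x + c)) has_vector_derivative m * f' (m * x + c)) (at x)" for x
  proof -
    have "(f has_real_derivative f' (m * x + c)) (at (m * x + c))"
      using assms by (simp add: C1_deriv_def has_real_derivative_iff_has_vector_derivative)
    then have "((\<lambda>x. f (m * x + c)) has_real_derivative f' (m * x + c) * m) (at x)"
      by (rule DERIV_chain2) (auto intro!: derivative_eq_intros)
    then show ?thesis by (simp add: has_real_derivative_iff_has_vector_derivative mult.commute)
  qed
  moreover have "continuous_on UNIV (\<lambda>x. m * f' (m * x + c))"
    by (intro continuous_intros continuous_on_compose2[OF C1_derivD(2)[OF assms, of UNIV]]) auto
  ultimately show ?thesis unfolding C1_deriv_def by auto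
qed

text \<open>Squaring removes the kink of the positive part. Test functions are only C1 here, so this
  replaces the usual flat function exp(-1/t).\<close>

lemma DERIV_max_0_power2: "((\<lambda>t::real. (max 0 t)\<^sup>2) has_real_derivative 2 * max 0 t) (at t)"
proof -
  consider "t > 0" | "t < 0" | "t = 0" by linarith
  then show ?thesis
  proof cases
    case 1
    have "((\<lambda>t::real. t\<^sup>2) has_real_derivative 2 * t) (at t)"
      by (auto intro!: derivative_eq_intros)
    then have "((\<lambda>t::real. (max 0 t)\<^sup>2) has_real_derivative 2 * t) (at t)"
      by (rule has_field_derivative_transform_within_open[where S="{0<..}"]) (use 1 in auto)
    with 1 show ?thesis by simp
  next
    case 2
    have "((\<lambda>t::real. 0) has_real_derivative 0) (at t)" by simp
    then have "((\<lambda>t::real. (max 0 t)\<^sup>2) has_real_derivative 0) (at t)"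
      by (rule has_field_derivative_transform_within_open[where S="{..<0}"]) (use 2 in auto)
    with 2 show ?thesis by simp
  next
    case 3
    have "((\<lambda>h::real. max 0 h) \<longlongrightarrow> max 0 0) (at 0)" by (intro tendsto_intros)
    then have lim: "((\<lambda>h::real. max 0 h) \<longlongrightarrow> 0) (at 0)" by simp
    have "\<forall>\<^sub>F h::real in at 0. max 0 h = (max 0 h)\<^sup>2 / h"
      by (auto simp: eventually_at_filter max_def power2_eq_square)
    with lim have "((\<lambda>h::real. (max 0 h)\<^sup>2 / h) \<longlongrightarrow> 0) (at 0)"
      by (rule Lim_transform_eventually)
    then show ?thesis using 3 by (simp add: DERIV_def)
  qed
qed

text \<open>The normalised quotient q(t) / (q(t) + q(1 - t)): the numerator vanishes for t at most
  0, the other summand for t at least 1, and the denominator is positive because t and 1 - t are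
  never both nonpositive. Compactness of the transition interval bounds the derivative.\<close>

lemma smooth_step_exists:
  obtains \<theta> \<theta>' :: "real \<Rightarrow> real" and B where
    "C1_deriv \<theta> \<theta>'" "\<And>t. t \<le> 0 \<Longrightarrow> \<theta> t = 0" "\<And>t. t \<ge> 1 \<Longrightarrow> \<theta> t = 1" "\<And>t. 0 \<le> \<theta> t" "\<And>t. \<theta> t \<le> 1"
    "\<And>t. t \<notin> {0..1} \<Longrightarrow> \<theta>' t = 0" "\<And>t. \<bar>\<theta>' t\<bar> \<le> B"
proof -
  define q where "q t = (max 0 t)\<^sup>2" for t :: real
  define p where "p t = q t + q (1 - t)" for t
  define \<theta> where "\<theta> t = q t / p t" for t
  define \<theta>' where "\<theta>' t = (2 * max 0 t * p t - q t * (2 * max 0 t - 2 * max 0 (1 - t))) / (p t * p t)" for t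
  have q: "(q has_real_derivative 2 * max 0 t) (at t)" for t
    unfolding q_def by (rule DERIV_max_0_power2)
  have q1: "((\<lambda>t. q (1 - t)) has_real_derivative 2 * max 0 (1 - t) * (- 1)) (at t)" for t
    by (rule DERIV_chain2[OF q]) (auto intro!: derivative_eq_intros)
  have ppos: "p t > 0" for t
    by (cases "t > 0") (auto simp: p_def q_def intro: add_pos_nonneg add_nonneg_pos)
  have p: "(p has_real_derivative 2 * max 0 t - 2 * max 0 (1 - t)) (at t)" for t
    unfolding p_def by (rule derivative_eq_intros q q1 refl)+ simp
  have d: "(\<theta> has_real_derivative \<theta>' t) (at t)" for t
    unfolding \<theta>_def \<theta>'_def by (rule DERIV_divide[OF q p]) (use ppos[of t] in auto)
  have c: "continuous_on UNIV \<theta>'"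
    unfolding \<theta>'_def p_def q_def
    using ppos unfolding p_def q_def
    by (intro continuous_intros) (metis less_irrefl mult_eq_0_iff)
  have C1: "C1_deriv \<theta> \<theta>'"
    using c d by (simp add: C1_deriv_def has_real_derivative_iff_has_vector_derivative)
  have out: "\<theta>' t = 0" if "t \<notin> {0..1}" for t
    using that by (auto simp: \<theta>'_def p_def q_def power2_eq_square)
  obtain B where B: "\<And>t. t \<in> {0..1} \<Longrightarrow> norm (\<theta>' t) \<le> B"
    using compact_continuous_image[OF continuous_on_subset[OF c subset_UNIV] compact_Icc[of 0 1]]
    by (metis bounded_iff compact_imp_bounded imageI)
  have "B \<ge> 0" using B[of 0] by force
  show ?thesis
  proof (rule that[of \<theta> \<theta>' B])
    show "\<bar>\<theta>' t\<bar> \<le> B" for t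
      using B[of t] out[of t] \<open>B \<ge> 0\<close> by (cases "t \<in> {0..1}") auto
    show "\<theta> t = 1" if "t \<ge> 1" for t
      using that ppos[of t] by (auto simp: \<theta>_def p_def q_def)
    show "\<theta> t \<le> 1" for t
      using ppos[of t] by (auto simp: \<theta>_def p_def q_def)
    show "0 \<le> \<theta> t" for t
      using ppos[of t] by (auto simp: \<theta>_def q_def)
  qed (use C1 out in \<open>auto simp: \<theta>_def q_def\<close>)
qed

text \<open>A rising and a falling step are multiplied. Their slopes grow like n, but only within
  distance 2 / (n + 1) of the respective endpoint, so slope times distance to the boundary stays
  bounded. This last estimate is what allows a function vanishing at the endpoints to be cut off in
  H1.\<close>

lemma cutoff_exists:
  fixes a b :: real
  assumes "a < b"
  obtains \<xi> \<xi>' :: "nat \<Rightarrow> real \<Rightarrow> real" and B where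
    "\<And>n. C1_deriv (\<xi> n) (\<xi>' n)"
    "\<And>n x. 0 \<le> \<xi> n x" "\<And>n x. \<xi> n x \<le> 1"
    "\<And>n x. x \<notin> {a + 1 / Suc n .. b - 1 / Suc n} \<Longrightarrow> \<xi> n x = 0"
    "\<And>x. x \<in> {a<..<b} \<Longrightarrow> \<forall>\<^sub>F n in sequentially. \<xi> n x = 1 \<and> \<xi>' n x = 0"
    "\<And>n x. x \<in> {a<..<b} \<Longrightarrow> \<bar>\<xi>' n x\<bar> * min (x - a) (b - x) \<le> B"
proof -
  obtain \<theta> \<theta>' :: "real \<Rightarrow> real" and B where \<theta>: "C1_deriv \<theta> \<theta>'" and
    \<theta>0: "\<And>t. t \<le> 0 \<Longrightarrow> \<theta> t = 0" and \<theta>1: "\<And>t. t \<ge> 1 \<Longrightarrow> \<theta> t = 1" and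
    ge: "\<And>t. 0 \<le> \<theta> t" and le: "\<And>t. \<theta> t \<le> 1" and
    out: "\<And>t. t \<notin> {0..1} \<Longrightarrow> \<theta>' t = 0" and B: "\<And>t. \<bar>\<theta>' t\<bar> \<le> B"
    using smooth_step_exists by blast
  have B0: "B \<ge> 0" using B[of 0] by linarith
  \<comment> \<open>The offset -1 delays each transition: it begins at distance 1 / (n + 1) from the
    endpoint and ends at distance 2 / (n + 1). The support thus stays in a compact subset of the
    open interval.\<close>
  define u where "u n x = real (Suc n) * x + (- real (Suc n) * a - 1)" for n x
  define v where "v n x = (- real (Suc n)) * x + (real (Suc n) * b - 1)" for n x
  define \<xi> where "\<xi> n x = \<theta> (u n x) * \<theta> (v n x)" for n x
  define \<xi>' where "\<xi>' n x = \<theta> (u n x) * ((- real (Suc n)) * \<theta>' (v n x)) + (real (Suc n) * \<theta>' (u n x)) * \<theta> (v n x)" for n x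
  have uv: "u n x = Suc n * (x - a) - 1" "v n x = Suc n * (b - x) - 1" for n x
    by (auto simp: u_def v_def algebra_simps)
  have 1: "C1_deriv (\<xi> n) (\<xi>' n)" for n
    unfolding \<xi>_def \<xi>'_def u_def v_def by (rule C1_deriv_mult[OF C1_deriv_affine[OF \<theta>] C1_deriv_affine[OF \<theta>]])
  have 2: "\<xi> n x = 0" if "x \<notin> {a + 1 / Suc n .. b - 1 / Suc n}" for n x
  proof -
    have "x - a \<le> 1 / Suc n \<or> b - x \<le> 1 / Suc n" using that by auto
    then have "u n x \<le> 0 \<or> v n x \<le> 0" unfolding uv by (auto simp: field_simps)
    then show ?thesis unfolding \<xi>_def using \<theta>0 by auto
  qed
  have 3: "\<forall>\<^sub>F n in sequentially. \<xi> n x = 1 \<and> \<xi>' n x = 0" if "x \<in> {a<..<b}" for x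
  proof -
    obtain m where m: "real m > 2 / (x - a)" using reals_Archimedean2 by blast
    obtain k where k: "real k > 2 / (b - x)" using reals_Archimedean2 by blast
    have "\<xi> n x = 1 \<and> \<xi>' n x = 0" if n: "n \<ge> max m k" for n
    proof -
      have "real (Suc n) > 2 / (x - a)" "real (Suc n) > 2 / (b - x)"
        using m k n by auto
      then have "u n x > 1" "v n x > 1"
        using \<open>x \<in> {a<..<b}\<close> by (auto simp: uv field_simps)
      then show ?thesis by (auto simp: \<xi>_def \<xi>'_def \<theta>1 out)
    qed
    then show ?thesis unfolding eventually_sequentially by blast
  qed
  \<comment> \<open>\<open>\<theta>'\<close> is nonzero only where \<open>Suc n * y\<close> is
    between 1 and 2, so the large factor \<open>Suc n\<close> times y is at most 2.\<close>
  have aux: "real (Suc n) * \<bar>\<theta>' (Suc n * y - 1)\<bar> * y \<le> 2 * B" if "y > 0" for n and y :: real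
  proof (cases "Suc n * y - 1 \<in> {0..1}")
    case True
    then have "\<bar>\<theta>' (Suc n * y - 1)\<bar> * (Suc n * y) \<le> B * 2"
      using B B0 that by (intro mult_mono) auto
    then show ?thesis by (simp add: mult_ac)
  qed (use out B0 in auto)
  have 4: "\<bar>\<xi>' n x\<bar> * min (x - a) (b - x) \<le> 4 * B" if x: "x \<in> {a<..<b}" for n x
  proof -
    have "\<bar>\<xi>' n x\<bar> \<le> Suc n * \<bar>\<theta>' (v n x)\<bar> + Suc n * \<bar>\<theta>' (u n x)\<bar>"
    proof -
      have "\<bar>\<theta> (u n x) * ((- real (Suc n)) * \<theta>' (v n x))\<bar> \<le> 1 * (Suc n * \<bar>\<theta>' (v n x)\<bar>)"
        unfolding abs_mult using ge[of "u n x"] le[of "u n x"] by (intro mult_mono) auto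
      moreover have "\<bar>(real (Suc n) * \<theta>' (u n x)) * \<theta> (v n x)\<bar> \<le> (Suc n * \<bar>\<theta>' (u n x)\<bar>) * 1"
        unfolding abs_mult using ge[of "v n x"] le[of "v n x"] by (intro mult_mono) auto
      ultimately show ?thesis unfolding \<xi>'_def by linarith
    qed
    then have "\<bar>\<xi>' n x\<bar> * min (x - a) (b - x) \<le> (Suc n * \<bar>\<theta>' (v n x)\<bar> + Suc n * \<bar>\<theta>' (u n x)\<bar>) * min (x - a) (b - x)"
      by (rule mult_right_mono) (use x in auto)
    also have "\<dots> \<le> Suc n * \<bar>\<theta>' (v n x)\<bar> * (b - x) + Suc n * \<bar>\<theta>' (u n x)\<bar> * (x - a)"
      unfolding distrib_right by (intro add_mono mult_left_mono) auto
    also have "\<dots> \<le> 2 * B + 2 * B"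
      unfolding uv using x by (intro add_mono aux) auto
    finally show ?thesis by simp
  qed
  show ?thesis
  proof (rule that[of \<xi> \<xi>' "4 * B"])
    show "\<xi> n x \<le> 1" for n x
      unfolding \<xi>_def using ge le by (simp add: mult_le_one)
    show "0 \<le> \<xi> n x" for n x
      unfolding \<xi>_def using ge by simp
  qed (use 1 2 3 4 in auto)
qed

section \<open>Test functions and integration by parts\<close>

lemma test_functionI:
  assumes "C1_deriv \<phi> \<phi>'" "compact K" "K \<subseteq> S" "\<And>x. x \<notin> K \<Longrightarrow> \<phi> x = 0"
  shows "\<phi> \<in> test_functions S"
  using assms unfolding test_functions_def C1_deriv_def C1_differentiable_on_def by auto

lemma test_functionE:
  assumes "\<phi> \<in> test_functions S"
  obtains \<phi>' K where "C1_deriv \<phi> \<phi>'" "compact K" "K \<subseteq> S" "\<And>x. x \<notin> K \<Longrightarrow> \<phi> x = 0"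
    "\<And>x. x \<notin> K \<Longrightarrow> \<phi>' x = 0" "\<And>x. vector_derivative \<phi> (at x) = \<phi>' x"
proof -
  from assms obtain D K where D: "\<And>x. (\<phi> has_vector_derivative D x) (at x)" "continuous_on UNIV D"
    and K: "compact K" "K \<subseteq> S" "\<And>x. x \<notin> K \<Longrightarrow> \<phi> x = 0"
    unfolding test_functions_def C1_differentiable_on_def by blast
  have z: "D x = 0" if "x \<notin> K" for x
  proof -
    have "((\<lambda>x. 0) has_vector_derivative 0) (at x)" by simp
    then have "(\<phi> has_vector_derivative 0) (at x)"
      by (rule has_vector_derivative_transform_within_open[where S="- K"])
        (simp_all add: that K open_Compl compact_imp_closed[OF K(1)])
    then show ?thesis by (rule vector_derivative_unique_at[OF D(1)])
  qed
  show ?thesis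
    by (rule that[of D K]) (simp_all add: C1_deriv_def D K z vector_derivative_at[OF D(1)])
qed

lemma integral_lborel_on_compact_support:
  fixes u :: "real \<Rightarrow> complex"
  assumes "S \<in> sets borel" "K \<subseteq> S" "K \<subseteq> {a..b}" "\<And>x. x \<notin> K \<Longrightarrow> u x = 0" "continuous_on {a..b} u"
  shows "integrable (lborel_on S) u" "(LINT x|lborel_on S. u x) = (LINT x|lborel. indicator {a..b} x *\<^sub>R u x)"
proof -
  have eq: "(\<lambda>x. indicator S x *\<^sub>R u x) = (\<lambda>x. indicator {a..b} x *\<^sub>R u x)"
    using assms(2-4) by (force simp: indicator_def fun_eq_iff)
  show "integrable (lborel_on S) u"
    using assms(1) borel_integrable_compact[OF _ assms(5)] by (simp add: integrable_restrict_space eq)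
  show "(LINT x|lborel_on S. u x) = (LINT x|lborel. indicator {a..b} x *\<^sub>R u x)"
    using assms(1) by (simp add: integral_restrict_space eq)
qed

text \<open>Integration by parts: the derivative of the product is integrated over an interval whose
  endpoints lie outside the support K. As K lies in S, a general Borel set S is allowed, which
  covers both \<open>I01\<close> and \<open>Rpos\<close>.\<close>

lemma has_weak_deriv_C1:
  assumes S: "S \<in> sets borel" and f: "C1_deriv f f'"
  shows "has_weak_deriv S f f'"
  unfolding has_weak_deriv_def
proof
  fix \<phi> assume "\<phi> \<in> test_functions S"
  then obtain \<phi>' K where \<phi>: "C1_deriv \<phi> \<phi>'" and K: "compact K" "K \<subseteq> S" "\<And>x. x \<notin> K \<Longrightarrow> \<phi> x = 0"
    "\<And>x. x \<notin> K \<Longrightarrow> \<phi>' x = 0" and vd: "\<And>x. vector_derivative \<phi> (at x) = \<phi>' x"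
    by (rule test_functionE) blast
  obtain R where R: "R > 0" "\<And>x. x \<in> K \<Longrightarrow> norm x < R"
    using compact_imp_bounded[OF K(1)] bounded_pos_less by metis
  then have KR: "K \<subseteq> {-R..R}" and Rn: "R \<notin> K" "-R \<notin> K" by force+
  note ct = C1_derivD(2,3)[OF f] C1_derivD(2,3)[OF \<phi>]
  have 1: "integrable (lborel_on S) (\<lambda>x. f x * \<phi>' x)"
    by (rule integral_lborel_on_compact_support[OF S K(2) KR]) (use K ct in \<open>auto intro!: continuous_intros\<close>)
  have 2: "integrable (lborel_on S) (\<lambda>x. f' x * \<phi> x)"
    by (rule integral_lborel_on_compact_support[OF S K(2) KR]) (use K ct in \<open>auto intro!: continuous_intros\<close>)
  have "(LINT x|lborel_on S. f x * \<phi>' x + f' x * \<phi> x) = (LINT x|lborel. indicator {-R..R} x *\<^sub>R (f x * \<phi>' x + f' x * \<phi> x))"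
    by (rule integral_lborel_on_compact_support[OF S K(2) KR]) (use K ct in \<open>auto intro!: continuous_intros\<close>)
  also have "\<dots> = f R * \<phi> R - f (-R) * \<phi> (-R)"
    using R(1) by (intro integral_FTC_atLeastAtMost C1_derivD[OF C1_deriv_mult[OF f \<phi>]]) auto
  also have "\<dots> = 0" using K(3) Rn by simp
  finally have "(LINT x|lborel_on S. f x * \<phi>' x) + (LINT x|lborel_on S. f' x * \<phi> x) = 0"
    using 1 2 by simp
  then show "(LINT x|lborel_on S. f x * vector_derivative \<phi> (at x)) = - (LINT x|lborel_on S. f' x * \<phi> x)"
    unfolding vd by (simp add: eq_neg_iff_add_eq_0)
qed

section \<open>Uniqueness of weak derivatives\<close>

text \<open>Dynkin's argument: open intervals are an intersection-stable generator of the Borel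
  sets, and equality of integrals passes to complements and countable disjoint unions. Equal
  integrals over all Borel sets force equality almost everywhere.\<close>

lemma AE_eq_if_interval_integrals_eq:
  fixes u v :: "real \<Rightarrow> complex"
  assumes u: "integrable lborel u" and v: "integrable lborel v"
    and eq: "\<And>a b. a < b \<Longrightarrow> (LINT x:{a<..<b}|lborel. u x) = (LINT x:{a<..<b}|lborel. v x)"
  shows "AE x in lborel. u x = v x"
proof (rule sigma_finite_measure.density_unique_banach[OF sigma_finite_lborel u v])
  fix A :: "real set" assume "A \<in> sets lborel"
  then have A: "A \<in> sigma_sets UNIV (range (\<lambda>(a, b). box a b))"
    unfolding sets_lborel borel_eq_box by (simp del: box_real)
  have iu: "set_integrable lborel X u" if "X \<in> sets borel" for X
    using u that unfolding set_integrable_def by (intro integrable_mult_indicator) auto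
  have iv: "set_integrable lborel X v" if "X \<in> sets borel" for X
    using v that unfolding set_integrable_def by (intro integrable_mult_indicator) auto
  have borel: "X \<in> sets borel" if "X \<in> sigma_sets UNIV (range (\<lambda>(a, b). box a b))" for X :: "real set"
    using that unfolding borel_eq_box by (simp del: box_real)
  have lim: "(\<lambda>n. LINT x:{-real n<..<real n}|lborel. w x) \<longlonglongrightarrow> (LINT x:UNIV|lborel. w x)"
    if "integrable lborel w" for w :: "real \<Rightarrow> complex"
  proof -
    have "(\<Union>n. {-real n<..<real n}) = UNIV"
    proof -
      have "\<exists>n. x \<in> {-real n<..<real n}" for x
        using reals_Archimedean2[of "\<bar>x\<bar>"] by (auto simp: abs_less_iff) (metis minus_less_iff)
      then show ?thesis by blast
    qed
    moreover have "(\<lambda>n. LINT x:{-real n<..<real n}|lborel. w x) \<longlonglongrightarrow> (LINT x:(\<Union>n. {-real n<..<real n})|lborel. w x)"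
      by (rule set_integral_cont_up)
        (use that calculation in \<open>auto simp: incseq_def set_integrable_def\<close>)
    ultimately show ?thesis by simp
  qed
  \<comment> \<open>The complement step subtracts from the integral over the whole line, which is
    not a bounded interval and is reached as a limit over (-n, n).\<close>
  have UNIV: "(LINT x:UNIV|lborel. u x) = (LINT x:UNIV|lborel. v x)"
  proof (rule LIMSEQ_unique[OF lim[OF u]])
    have "(LINT x:{-real n<..<real n}|lborel. u x) = (LINT x:{-real n<..<real n}|lborel. v x)" for n
      using eq[of "- real n" "real n"] by (cases "n = 0") (auto simp: set_lebesgue_integral_def)
    then show "(\<lambda>n. LINT x:{-real n<..<real n}|lborel. u x) \<longlonglongrightarrow> (LINT x:UNIV|lborel. v x)"
      using lim[OF v] by simp
  qed
  have "Int_stable (range (\<lambda>(a, b). box a (b::real)))"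
    by (auto simp: Int_stable_def box_Int_box simp del: box_real)
  then show "(LINT x:A|lborel. u x) = (LINT x:A|lborel. v x)"
    using Pow_UNIV[THEN equalityD2, THEN subset_trans[OF subset_UNIV]] A
  proof (induct rule: sigma_sets_induct_disjoint)
    case (basic X)
    then obtain a b where X: "X = {a<..<b}" by auto
    then show ?case using eq by (cases "a < b") (auto simp: set_lebesgue_integral_def)
  next
    case empty
    then show ?case by (simp add: set_lebesgue_integral_def)
  next
    case (compl X)
    have X: "X \<in> sets borel" using borel compl(1) .
    have "(LINT x:X \<union> (UNIV - X)|lborel. w x) = (LINT x:X|lborel. w x) + (LINT x:UNIV - X|lborel. w x)"
      if "integrable lborel w" for w :: "real \<Rightarrow> complex"
      by (rule set_integral_Un)
        (use that X in \<open>auto simp: set_integrable_def intro!: integrable_mult_indicator\<close>)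
    from this[OF u] this[OF v] UNIV compl(2) show ?case by (simp add: Compl_eq_Diff_UNIV[symmetric])
  next
    case (union A)
    have "A i \<in> sets borel" for i using borel[OF subsetD[OF union(2) rangeI]] .
    then have Ab: "A i \<in> sets lborel" "(\<Union>i. A i) \<in> sets borel" for i by auto
    have "(LINT x:(\<Union>i. A i)|lborel. u x) = (\<Sum>i. (LINT x:(A i)|lborel. u x))"
      using union(1) Ab by (intro lebesgue_integral_countable_add iu) (auto simp: disjoint_family_on_def)
    moreover have "(LINT x:(\<Union>i. A i)|lborel. v x) = (\<Sum>i. (LINT x:(A i)|lborel. v x))"
      using union(1) Ab by (intro lebesgue_integral_countable_add iv) (auto simp: disjoint_family_on_def)
    ultimately show ?case using union(3) by simp
  qed
qed

text \<open>The two weak-derivative identities share their left-hand side, so u and v pair equally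
  with every test function. The cutoffs converge pointwise to the indicator of the open interval,
  and integrability on the closed one supplies the dominating function.\<close>

lemma weak_deriv_interval_integral_eq:
  assumes S: "open S" and fu: "has_weak_deriv S f u" and fv: "has_weak_deriv S f v"
    and ab: "a < b" "{a..b} \<subseteq> S"
    and u: "set_integrable lborel {a..b} u" and v: "set_integrable lborel {a..b} v"
  shows "(LINT x:{a<..<b}|lborel. u x) = (LINT x:{a<..<b}|lborel. v x)"
proof -
  obtain \<xi> \<xi>' :: "nat \<Rightarrow> real \<Rightarrow> real" and B where
    C1: "\<And>n. C1_deriv (\<xi> n) (\<xi>' n)" and
    ge: "\<And>n x. 0 \<le> \<xi> n x" and le: "\<And>n x. \<xi> n x \<le> 1" and
    out: "\<And>n x. x \<notin> {a + 1 / Suc n .. b - 1 / Suc n} \<Longrightarrow> \<xi> n x = 0" and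
    ev: "\<And>x. x \<in> {a<..<b} \<Longrightarrow> \<forall>\<^sub>F n in sequentially. \<xi> n x = 1 \<and> \<xi>' n x = 0"
    by (rule cutoff_exists[OF ab(1)]) blast
  have sub: "{a + 1 / Suc n .. b - 1 / Suc n} \<subseteq> {a<..<b}" for n :: nat
  proof -
    have "0 < 1 / real (Suc n)" by simp
    then show ?thesis unfolding subset_iff atLeastAtMost_iff greaterThanLessThan_iff by linarith
  qed
  have Sb: "S \<in> sets borel" using S by simp
  have test: "(\<lambda>x. complex_of_real (\<xi> n x)) \<in> test_functions S" for n
    by (rule test_functionI[OF C1_deriv_of_real[OF C1], of "{a + 1 / Suc n .. b - 1 / Suc n}"])
      (use sub[of n] ab(2) out in \<open>auto simp: subset_iff\<close>)
  have lim: "(\<lambda>n. LINT x|lborel_on S. w x * complex_of_real (\<xi> n x)) \<longlonglongrightarrow> (LINT x:{a<..<b}|lborel. w x)"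
    if w: "set_integrable lborel {a..b} w" for w
  proof -
    have z: "\<xi> n x = 0" if "x \<notin> {a<..<b}" for n x
      using out[of x n] sub[of n] that by blast
    have eq: "(LINT x|lborel_on S. w x * complex_of_real (\<xi> n x)) =
      (LINT x|lborel. (indicator {a..b} x *\<^sub>R w x) * complex_of_real (\<xi> n x))" for n
      using Sb ab(2) z[of _ n]
      by (auto simp: integral_restrict_space subset_iff intro!: Bochner_Integration.integral_cong split: split_indicator)
    have m[measurable]: "\<xi> n \<in> borel_measurable lborel" for n
      using C1_derivD(3)[OF C1, of UNIV n] by (simp add: borel_measurable_continuous_onI)
    have wm[measurable]: "(\<lambda>x. indicator {a..b} x *\<^sub>R w x) \<in> borel_measurable lborel"
      using w unfolding set_integrable_def by auto
    show ?thesis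
      unfolding eq set_lebesgue_integral_def
    proof (rule integral_dominated_convergence[where w="\<lambda>x. norm (indicator {a..b} x *\<^sub>R w x)"])
      have "(\<lambda>x. indicator {a<..<b} x *\<^sub>R (indicator {a..b} x *\<^sub>R w x)) \<in> borel_measurable lborel"
        by measurable
      also have "(\<lambda>x. indicator {a<..<b} x *\<^sub>R (indicator {a..b} x *\<^sub>R w x)) = (\<lambda>x. indicator {a<..<b} x *\<^sub>R w x)"
        by (auto simp: indicator_def)
      finally show "(\<lambda>x. indicator {a<..<b} x *\<^sub>R w x) \<in> borel_measurable lborel" .
      show "integrable lborel (\<lambda>x. norm (indicator {a..b} x *\<^sub>R w x))"
        using w unfolding set_integrable_def by (rule integrable_norm)
      show "AE x in lborel. norm (indicator {a..b} x *\<^sub>R w x * complex_of_real (\<xi> n x)) \<le> norm (indicator {a..b} x *\<^sub>R w x)" for n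
        using ge le by (auto simp: norm_mult intro!: mult_left_le split: split_indicator)
      show "AE x in lborel. (\<lambda>n. indicator {a..b} x *\<^sub>R w x * complex_of_real (\<xi> n x)) \<longlonglongrightarrow> indicator {a<..<b} x *\<^sub>R w x"
      proof (rule AE_I2)
        fix x
        show "(\<lambda>n. indicator {a..b} x *\<^sub>R w x * complex_of_real (\<xi> n x)) \<longlonglongrightarrow> indicator {a<..<b} x *\<^sub>R w x"
        proof (cases "x \<in> {a<..<b}")
          case True
          have "\<forall>\<^sub>F n in sequentially. indicator {a..b} x *\<^sub>R w x * complex_of_real (\<xi> n x) = indicator {a<..<b} x *\<^sub>R w x"
            using ev[OF True] by eventually_elim (use True in auto)
          then show ?thesis by (rule tendsto_eventually)
        next
          case False
          then show ?thesis using z by simp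
        qed
      qed
    qed measurable
  qed
  have "(LINT x|lborel_on S. u x * complex_of_real (\<xi> n x)) = (LINT x|lborel_on S. v x * complex_of_real (\<xi> n x))" for n
    using bspec[OF fu[unfolded has_weak_deriv_def] test[of n]]
      bspec[OF fv[unfolded has_weak_deriv_def] test[of n]] by simp
  then show ?thesis
    using LIMSEQ_unique[OF lim[OF u]] lim[OF v] by simp
qed

text \<open>An open set is covered by the countably many rational intervals whose closure lies in
  it, so the local exceptional sets unite to a null set. Local integrability is the right condition
  because elements of the weighted history space may fail to be integrable on the whole
  half-line.\<close>

lemma weak_deriv_unique_AE:
  assumes S: "open S" and fu: "has_weak_deriv S f u" and fv: "has_weak_deriv S f v"
    and u: "\<And>a b. {a..b} \<subseteq> S \<Longrightarrow> set_integrable lborel {a..b} u"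
    and v: "\<And>a b. {a..b} \<subseteq> S \<Longrightarrow> set_integrable lborel {a..b} v"
  shows "AE x in lborel_on S. u x = v x"
proof -
  have loc: "AE x in lborel. x \<in> {a<..<b} \<longrightarrow> u x = v x" if ab: "{a..b} \<subseteq> S" for a b
  proof -
    have i: "integrable lborel (\<lambda>x. indicator {a<..<b} x *\<^sub>R w x)" if "set_integrable lborel {a..b} w" for w :: "real \<Rightarrow> complex"
      using set_integrable_subset[OF that, of "{a<..<b}"] greaterThanLessThan_subseteq_atLeastAtMost_iff
      unfolding set_integrable_def by force
    have "AE x in lborel. indicator {a<..<b} x *\<^sub>R u x = indicator {a<..<b} x *\<^sub>R v x"
    proof (rule AE_eq_if_interval_integrals_eq[OF i[OF u[OF ab]] i[OF v[OF ab]]])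
      fix c d :: real
      let ?c = "max a c" and ?d = "min b d"
      have red: "(LINT x:{c<..<d}|lborel. indicator {a<..<b} x *\<^sub>R w x) = (LINT x:{?c<..<?d}|lborel. w x)" for w :: "real \<Rightarrow> complex"
        unfolding set_lebesgue_integral_def
        by (intro Bochner_Integration.integral_cong) (auto split: split_indicator)
      have "(LINT x:{?c<..<?d}|lborel. u x) = (LINT x:{?c<..<?d}|lborel. v x)"
      proof (cases "?c < ?d")
        case True
        have "{?c..?d} \<subseteq> S" using ab by auto
        then show ?thesis
          by (intro weak_deriv_interval_integral_eq[OF S fu fv True] u v)
      next
        case False
        then have "{?c<..<?d} = {}" by (intro greaterThanLessThan_empty) linarith
        then show ?thesis by (simp add: set_lebesgue_integral_def)
      qed
      then show "(LINT x:{c<..<d}|lborel. indicator {a<..<b} x *\<^sub>R u x) = (LINT x:{c<..<d}|lborel. indicator {a<..<b} x *\<^sub>R v x)"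
        unfolding red .
    qed
    then show ?thesis by eventually_elim (auto split: split_indicator_asm)
  qed
  define I where "I = {p \<in> \<rat> \<times> \<rat>. {fst p..snd p} \<subseteq> S}"
  have "countable I"
    unfolding I_def using countable_rat by (auto intro: countable_subset[of _ "\<rat> \<times> \<rat>"])
  moreover have "\<forall>p\<in>I. AE x in lborel. x \<in> {fst p<..<snd p} \<longrightarrow> u x = v x"
  proof
    fix p assume "p \<in> I"
    then have "{fst p..snd p} \<subseteq> S" by (simp add: I_def)
    then show "AE x in lborel. x \<in> {fst p<..<snd p} \<longrightarrow> u x = v x" by (rule loc)
  qed
  ultimately have "AE x in lborel. \<forall>p\<in>I. x \<in> {fst p<..<snd p} \<longrightarrow> u x = v x"
    by (rule iffD2[OF AE_ball_countable])
  moreover have "\<exists>p\<in>I. x \<in> {fst p<..<snd p}" if xS: "x \<in> S" for x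
  proof -
    obtain e where e: "e > 0" "ball x e \<subseteq> S" using S xS by (rule openE)
    obtain a where a: "a \<in> \<rat>" "x - e < a" "a < x" using Rats_dense_in_real[of "x - e" x] e by auto
    obtain b where b: "b \<in> \<rat>" "x < b" "b < x + e" using Rats_dense_in_real[of x "x + e"] e by auto
    have "{a..b} \<subseteq> ball x e" using a b by (auto simp: dist_real_def)
    then have "(a, b) \<in> I" using a b e unfolding I_def by auto
    then show ?thesis using a b by force
  qed
  ultimately have "AE x in lborel. x \<in> S \<longrightarrow> u x = v x"
    by (auto elim!: eventually_mono)
  then show ?thesis
    using S by (subst AE_restrict_space_iff) auto
qed

section \<open>Square-integrable functions and weak derivatives on the unit interval\<close>

text \<open>Minimising the right-hand side over \<open>\<theta>\<close>, at A / (A + B), gives (A +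
  B)^2. Unlike the triangle inequality, the quadratic form of the estimate is linear in the squared
  norms, so estimates for several components with the same \<open>\<theta>\<close> can simply be
  added. It thus serves for L2 and for the five-term energy norm alike.\<close>

lemma triangle_of_quadratic:
  fixes A B C :: real
  assumes AB: "A \<ge> 0" "B \<ge> 0"
    and q: "\<And>\<theta>. 0 < \<theta> \<Longrightarrow> \<theta> < 1 \<Longrightarrow> C\<^sup>2 \<le> A\<^sup>2 / \<theta> + B\<^sup>2 / (1 - \<theta>)"
  shows "C \<le> A + B"
proof (rule field_le_epsilon)
  fix e :: real assume e: "e > 0"
  \<comment> \<open>The perturbation keeps the optimal parameter strictly between 0 and 1 even if A
    or B is zero.\<close>
  define a b where "a = A + e / 2" and "b = B + e / 2"
  have ab: "a > 0" "b > 0" "A \<le> a" "B \<le> b" using AB e by (auto simp: a_def b_def)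
  have "1 - a / (a + b) = b / (a + b)" using ab by (simp add: field_simps)
  then have "C\<^sup>2 \<le> A\<^sup>2 / (a / (a + b)) + B\<^sup>2 / (b / (a + b))"
    using q[of "a / (a + b)"] ab by simp
  also have "\<dots> \<le> a * (a + b) + b * (a + b)"
  proof (rule add_mono)
    have le: "y\<^sup>2 / (z / (a + b)) \<le> z * (a + b)" if "0 \<le> y" "y \<le> z" "0 < z" for y z
    proof -
      have "y\<^sup>2 \<le> z * z" using that by (simp add: power2_eq_square mult_mono)
      also have "\<dots> = z * (a + b) * (z / (a + b))" using ab by simp
      finally show ?thesis using ab that by (subst pos_divide_le_eq) auto
    qed
    show "A\<^sup>2 / (a / (a + b)) \<le> a * (a + b)" "B\<^sup>2 / (b / (a + b)) \<le> b * (a + b)"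
      by (rule le; use AB ab in simp)+
  qed
  also have "\<dots> = (a + b)\<^sup>2"
    by (simp add: power2_eq_square distrib_left distrib_right)
  finally have "C \<le> a + b" by (rule power2_le_imp_le) (use ab in simp)
  then show "C \<le> A + B + e" by (simp add: a_def b_def)
qed

lemma cmod_add_square_le:
  assumes "0 < \<theta>" "\<theta> < 1"
  shows "(cmod (a + b))\<^sup>2 \<le> (cmod a)\<^sup>2 / \<theta> + (cmod b)\<^sup>2 / (1 - \<theta>)"
proof -
  have "(cmod (a + b))\<^sup>2 \<le> (cmod a + cmod b)\<^sup>2"
    by (intro power_mono norm_triangle_ineq) auto
  also have "\<dots> \<le> (cmod a)\<^sup>2 / \<theta> + (cmod b)\<^sup>2 / (1 - \<theta>)"
  proof -
    have "(cmod a)\<^sup>2 / \<theta> + (cmod b)\<^sup>2 / (1 - \<theta>) - (cmod a + cmod b)\<^sup>2 =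
      ((1 - \<theta>) * cmod a - \<theta> * cmod b)\<^sup>2 / (\<theta> * (1 - \<theta>))"
      using assms by (simp add: field_simps power2_eq_square)
    also have "\<dots> \<ge> 0" using assms by (intro divide_nonneg_pos) auto
    finally show ?thesis by linarith
  qed
  finally show ?thesis .
qed

text \<open>Stated with a weight so that one proof serves L2 (weight 1) and the history space
  (weight g in the second coordinate).\<close>

lemma weighted_square_integral_add:
  fixes f h :: "'a \<Rightarrow> complex" and w :: "'a \<Rightarrow> real"
  assumes [measurable]: "f \<in> borel_measurable M" "h \<in> borel_measurable M" "w \<in> borel_measurable M"
    and w: "\<forall>x\<in>space M. w x \<ge> 0"
    and f: "integrable M (\<lambda>x. w x * (cmod (f x))\<^sup>2)" and h: "integrable M (\<lambda>x. w x * (cmod (h x))\<^sup>2)"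
  shows "integrable M (\<lambda>x. w x * (cmod (f x + h x))\<^sup>2)"
    and "0 < \<theta> \<Longrightarrow> \<theta> < 1 \<Longrightarrow> (LINT x|M. w x * (cmod (f x + h x))\<^sup>2) \<le>
      (LINT x|M. w x * (cmod (f x))\<^sup>2) / \<theta> + (LINT x|M. w x * (cmod (h x))\<^sup>2) / (1 - \<theta>)"
proof -
  have le: "w x * (cmod (f x + h x))\<^sup>2 \<le> w x * (cmod (f x))\<^sup>2 / \<theta> + w x * (cmod (h x))\<^sup>2 / (1 - \<theta>)"
    if "x \<in> space M" "0 < \<theta>" "\<theta> < 1" for x \<theta>
    using mult_left_mono[OF cmod_add_square_le[OF that(2,3)] bspec[OF w that(1)], of "f x" "h x"]
    by (simp add: distrib_left)
  have i: "integrable M (\<lambda>x. w x * (cmod (f x))\<^sup>2 / \<theta> + w x * (cmod (h x))\<^sup>2 / (1 - \<theta>))" for \<theta>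
    using f h by simp
  show int: "integrable M (\<lambda>x. w x * (cmod (f x + h x))\<^sup>2)"
    by (rule Bochner_Integration.integrable_bound[OF i[of "1/2"]])
      (use le[of _ "1/2"] w in \<open>auto intro!: AE_I2 order_trans[OF _ abs_ge_self]\<close>)
  assume \<theta>: "0 < \<theta>" "\<theta> < 1"
  have "(LINT x|M. w x * (cmod (f x + h x))\<^sup>2) \<le> (LINT x|M. w x * (cmod (f x))\<^sup>2 / \<theta> + w x * (cmod (h x))\<^sup>2 / (1 - \<theta>))"
    by (rule integral_mono[OF int i le[OF _ \<theta>]])
  also have "\<dots> = (LINT x|M. w x * (cmod (f x))\<^sup>2) / \<theta> + (LINT x|M. w x * (cmod (h x))\<^sup>2) / (1 - \<theta>)"
    using f h by simp
  finally show "(LINT x|M. w x * (cmod (f x + h x))\<^sup>2) \<le>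
      (LINT x|M. w x * (cmod (f x))\<^sup>2) / \<theta> + (LINT x|M. w x * (cmod (h x))\<^sup>2) / (1 - \<theta>)" .
qed

section \<open>L2 on the unit interval\<close>

lemma finite_measure_I01: "finite_measure (lborel_on I01)"
  by (rule finite_measureI) (simp add: emeasure_restrict_space space_restrict_space)

lemma measure_I01: "measure (lborel_on I01) I01 = 1"
  by (simp add: measure_restrict_space)

lemma integrable_I01_bounded:
  fixes f :: "real \<Rightarrow> 'a::{banach, second_countable_topology}"
  assumes "f \<in> borel_measurable (lborel_on I01)" "\<And>x. x \<in> I01 \<Longrightarrow> norm (f x) \<le> C"
  shows "integrable (lborel_on I01) f"
  using assms
  by (intro finite_measure.integrable_const_bound[OF finite_measure_I01, of _ C])
    (auto intro!: AE_I2 simp: space_restrict_space)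

lemma L2_measurable: "f \<in> L2 \<Longrightarrow> f \<in> borel_measurable (lborel_on I01)"
  by (simp add: L2_def)

lemma L2_square_integrable: "f \<in> L2 \<Longrightarrow> integrable (lborel_on I01) (\<lambda>x. (cmod (f x))\<^sup>2)"
  by (simp add: L2_def)

lemma L2_norm_nonneg: "L2_norm f \<ge> 0"
  by (simp add: L2_norm_def)

lemma L2_norm_power2: "(L2_norm f)\<^sup>2 = (LINT x|lborel_on I01. (cmod (f x))\<^sup>2)"
  by (simp add: L2_norm_def)

lemma L2_integrable:
  assumes "f \<in> L2" shows "integrable (lborel_on I01) f"
proof (rule Bochner_Integration.integrable_bound[where f="\<lambda>x. 1 + (cmod (f x))\<^sup>2"])
  show "integrable (lborel_on I01) (\<lambda>x. 1 + (cmod (f x))\<^sup>2)"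
    by (intro Bochner_Integration.integrable_add L2_square_integrable[OF assms] finite_measure.integrable_const[OF finite_measure_I01])
  have "t \<le> 1 + t\<^sup>2" for t :: real
    using sum_power2_ge_zero[of "t - 1/2" 0] by (simp add: power2_eq_square algebra_simps)
  then show "AE x in lborel_on I01. norm (f x) \<le> norm (1 + (cmod (f x))\<^sup>2)" by simp
qed (rule L2_measurable[OF assms])

text \<open>The interval has measure one, so a uniform bound is a bound of the norm with the same
  constant. This is how pointwise residual estimates become norm estimates.\<close>

lemma L2_bounded:
  assumes "f \<in> borel_measurable (lborel_on I01)" "\<And>x. x \<in> I01 \<Longrightarrow> cmod (f x) \<le> C"
  shows "f \<in> L2" "L2_norm f \<le> C"
proof -
  have m[measurable]: "f \<in> borel_measurable (lborel_on I01)" by fact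
  have le: "(cmod (f x))\<^sup>2 \<le> C\<^sup>2" if "x \<in> I01" for x
    using assms(2)[OF that] by (intro power_mono) auto
  have i: "integrable (lborel_on I01) (\<lambda>x. (cmod (f x))\<^sup>2)"
    by (rule integrable_I01_bounded[where C="C\<^sup>2"]) (use le in auto)
  then show "f \<in> L2" by (simp add: L2_def)
  have "(1/2::real) \<in> I01" by simp
  from assms(2)[OF this] have C: "C \<ge> 0" by (rule order_trans[rotated]) simp
  have "(LINT x|lborel_on I01. (cmod (f x))\<^sup>2) \<le> (LINT x|lborel_on I01. C\<^sup>2)"
    by (rule integral_mono[OF i]) (use le finite_measure.integrable_const[OF finite_measure_I01] in \<open>auto simp: space_restrict_space\<close>)
  also have "\<dots> = C\<^sup>2" by (simp add: space_restrict_space measure_I01)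
  finally show "L2_norm f \<le> C" unfolding L2_norm_def using C by (simp add: real_le_lsqrt)
qed

lemma L2_add:
  assumes "f \<in> L2" "h \<in> L2"
  shows "(\<lambda>x. f x + h x) \<in> L2"
    and "0 < \<theta> \<Longrightarrow> \<theta> < 1 \<Longrightarrow> (L2_norm (\<lambda>x. f x + h x))\<^sup>2 \<le> (L2_norm f)\<^sup>2 / \<theta> + (L2_norm h)\<^sup>2 / (1 - \<theta>)"
  using weighted_square_integral_add(1)[of f "lborel_on I01" h "\<lambda>_. 1"]
    weighted_square_integral_add(2)[of f "lborel_on I01" h "\<lambda>_. 1" \<theta>]
    L2_measurable[OF assms(1)] L2_measurable[OF assms(2)] L2_square_integrable[OF assms(1)] L2_square_integrable[OF assms(2)]
  unfolding L2_norm_power2 by (auto simp: L2_def)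

lemma L2_scale:
  assumes "f \<in> L2"
  shows "(\<lambda>x. c * f x) \<in> L2"
  using assms by (auto simp: L2_def norm_mult power_mult_distrib)

lemma L2_diff:
  assumes "f \<in> L2" "h \<in> L2"
  shows "(\<lambda>x. f x - h x) \<in> L2"
  using L2_add(1)[OF assms(1) L2_scale[OF assms(2), of "-1"]] by simp

lemma L2_norm_scale: "L2_norm (\<lambda>x. c * f x) = cmod c * L2_norm f"
  by (simp add: L2_norm_def norm_mult power_mult_distrib real_sqrt_mult)

lemma L2_norm_triangle:
  assumes "f \<in> L2" "h \<in> L2"
  shows "L2_norm (\<lambda>x. f x + h x) \<le> L2_norm f + L2_norm h"
  by (rule triangle_of_quadratic) (use L2_add(2)[OF assms] in \<open>auto simp: L2_norm_nonneg\<close>)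

lemma L2_norm_cong_AE:
  assumes "f \<in> borel_measurable (lborel_on I01)" "h \<in> borel_measurable (lborel_on I01)"
    "AE x in lborel_on I01. f x = h x"
  shows "L2_norm f = L2_norm h"
proof -
  have [measurable]: "f \<in> borel_measurable (lborel_on I01)" "h \<in> borel_measurable (lborel_on I01)" by fact+
  have "(LINT x|lborel_on I01. (cmod (f x))\<^sup>2) = (LINT x|lborel_on I01. (cmod (h x))\<^sup>2)"
    by (rule integral_cong_AE) (use assms(3) in \<open>auto elim!: eventually_mono\<close>)
  then show ?thesis by (simp add: L2_norm_def)
qed

text \<open>Dominated convergence in the form in which cutoff errors occur: uniformly bounded, and
  zero at each point from some index on.\<close>

lemma L2_norm_tendsto_0:
  assumes m: "\<And>n. h n \<in> borel_measurable (lborel_on I01)"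
    and b: "\<And>n x. x \<in> I01 \<Longrightarrow> cmod (h n x) \<le> C"
    and e: "\<And>x. x \<in> I01 \<Longrightarrow> \<forall>\<^sub>F n in sequentially. h n x = 0"
  shows "(\<lambda>n. L2_norm (h n)) \<longlonglongrightarrow> 0"
proof -
  have [measurable]: "\<And>n. h n \<in> borel_measurable (lborel_on I01)" by fact
  have "(\<lambda>n. LINT x|lborel_on I01. (cmod (h n x))\<^sup>2) \<longlonglongrightarrow> (LINT x|lborel_on I01. 0)"
  proof (rule integral_dominated_convergence[where w="\<lambda>_. C\<^sup>2"])
    show "AE x in lborel_on I01. (\<lambda>n. (cmod (h n x))\<^sup>2) \<longlonglongrightarrow> 0"
    proof (rule AE_I2)
      fix x assume "x \<in> space (lborel_on I01)"
      then have "\<forall>\<^sub>F n in sequentially. h n x = 0" using e by (simp add: space_restrict_space)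
      then have "\<forall>\<^sub>F n in sequentially. (cmod (h n x))\<^sup>2 = 0" by eventually_elim simp
      then show "(\<lambda>n. (cmod (h n x))\<^sup>2) \<longlonglongrightarrow> 0" by (rule tendsto_eventually)
    qed
    show "AE x in lborel_on I01. norm ((cmod (h n x))\<^sup>2) \<le> C\<^sup>2" for n
      using b by (auto intro!: AE_I2 power_mono simp: space_restrict_space)
  qed (use finite_measure.integrable_const[OF finite_measure_I01] in auto)
  then show ?thesis
    unfolding L2_norm_def using tendsto_real_sqrt by fastforce
qed

text \<open>\<open>weak_deriv\<close> is a Hilbert choice, so an explicit formula for it is
  available only through uniqueness, hence almost everywhere. Every later computation of a weak
  derivative rests on this.\<close>

lemma weak_deriv_AE:
  assumes "f' \<in> L2" "has_weak_deriv I01 f f'"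
  shows "weak_deriv f \<in> L2" "has_weak_deriv I01 f (weak_deriv f)"
    "AE x in lborel_on I01. weak_deriv f x = f' x"
proof -
  have 1: "weak_deriv f \<in> L2 \<and> has_weak_deriv I01 f (weak_deriv f)"
    unfolding weak_deriv_def by (rule someI[of _ f']) (use assms in simp)
  then show "weak_deriv f \<in> L2" "has_weak_deriv I01 f (weak_deriv f)" by auto
  have i: "set_integrable lborel {a..b} u" if "u \<in> L2" "{a..b} \<subseteq> I01" for u and a b :: real
  proof -
    have "set_integrable lborel I01 u"
      using L2_integrable[OF that(1)] unfolding set_integrable_def by (simp add: integrable_restrict_space)
    then show ?thesis by (rule set_integrable_subset) (use that in auto)
  qed
  show "AE x in lborel_on I01. weak_deriv f x = f' x"
    by (rule weak_deriv_unique_AE[of _ f]) (use 1 assms i in auto)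
qed

section \<open>Calculus of weak derivatives in H1\<close>

lemma H1_weak_deriv:
  assumes "f \<in> H1"
  shows "f \<in> L2" "weak_deriv f \<in> L2" "has_weak_deriv I01 f (weak_deriv f)"
  using assms weak_deriv_AE unfolding H1_def by blast+

lemma test_function_bounds:
  assumes "\<phi> \<in> test_functions S"
  obtains C where "\<And>x. cmod (\<phi> x) \<le> C" "\<And>x. cmod (vector_derivative \<phi> (at x)) \<le> C"
    "\<phi> \<in> borel_measurable borel" "(\<lambda>x. vector_derivative \<phi> (at x)) \<in> borel_measurable borel"
proof -
  obtain \<phi>' K where \<phi>: "C1_deriv \<phi> \<phi>'" and K: "compact K" "\<And>x. x \<notin> K \<Longrightarrow> \<phi> x = 0"
    "\<And>x. x \<notin> K \<Longrightarrow> \<phi>' x = 0" and vd: "\<And>x. vector_derivative \<phi> (at x) = \<phi>' x"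
    using assms by (rule test_functionE) blast
  have bd: "\<exists>C. \<forall>x. cmod (u x) \<le> C" if "continuous_on UNIV u" "\<And>x. x \<notin> K \<Longrightarrow> u x = 0" for u
  proof -
    have "bounded (u ` K)"
      using compact_continuous_image[OF continuous_on_subset[OF that(1) subset_UNIV] K(1)] compact_imp_bounded by blast
    then obtain C where "C > 0" "\<And>x. x \<in> K \<Longrightarrow> cmod (u x) \<le> C" unfolding bounded_pos by auto
    then have "cmod (u x) \<le> C" for x using that(2)[of x] by (cases "x \<in> K") auto
    then show ?thesis by blast
  qed
  obtain C where C: "\<And>x. cmod (\<phi> x) \<le> C" using bd[OF C1_derivD(3)[OF \<phi>] K(2)] by blast
  obtain D where D: "\<And>x. cmod (\<phi>' x) \<le> D" using bd[OF C1_derivD(2)[OF \<phi>] K(3)] by blast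
  show ?thesis
  proof (rule that[of "max C D"])
    show "cmod (\<phi> x) \<le> max C D" "cmod (vector_derivative \<phi> (at x)) \<le> max C D" for x
      using C[of x] D[of x] by (auto simp: vd le_max_iff_disj)
    show "\<phi> \<in> borel_measurable borel" "(\<lambda>x. vector_derivative \<phi> (at x)) \<in> borel_measurable borel"
      unfolding vd using C1_derivD(2,3)[OF \<phi>, of UNIV] by (auto intro: borel_measurable_continuous_onI)
  qed
qed

lemma integrable_mult_test_function:
  assumes \<phi>: "\<phi> \<in> test_functions S" and f: "integrable (lborel_on T) f"
  shows "integrable (lborel_on T) (\<lambda>x. f x * \<phi> x)" "integrable (lborel_on T) (\<lambda>x. f x * vector_derivative \<phi> (at x))"
proof -
  obtain C where C: "\<And>x. cmod (\<phi> x) \<le> C" "\<And>x. cmod (vector_derivative \<phi> (at x)) \<le> C"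
    and m: "\<phi> \<in> borel_measurable borel" "(\<lambda>x. vector_derivative \<phi> (at x)) \<in> borel_measurable borel"
    using test_function_bounds[OF \<phi>] by blast
  have C0: "C \<ge> 0" using C(1)[of 0] norm_ge_zero order_trans by blast
  have g: "integrable (lborel_on T) (\<lambda>x. f x * u x)" if u: "\<And>x. cmod (u x) \<le> C" "u \<in> borel_measurable borel" for u
  proof (rule Bochner_Integration.integrable_bound[where f="\<lambda>x. C *\<^sub>R f x"])
    show "integrable (lborel_on T) (\<lambda>x. C *\<^sub>R f x)" using f by simp
    have [measurable]: "u \<in> borel_measurable (lborel_on T)"
      using u(2) by (intro measurable_restrict_space1) simp
    have [measurable]: "f \<in> borel_measurable (lborel_on T)" using f by auto
    show "(\<lambda>x. f x * u x) \<in> borel_measurable (lborel_on T)" by measurable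
    show "AE x in lborel_on T. norm (f x * u x) \<le> norm (C *\<^sub>R f x)"
      using u(1) C0 by (auto simp: norm_mult mult.commute[of C] intro!: mult_left_mono)
  qed
  show "integrable (lborel_on T) (\<lambda>x. f x * \<phi> x)" "integrable (lborel_on T) (\<lambda>x. f x * vector_derivative \<phi> (at x))"
    using g[OF C(1) m(1)] g[OF C(2) m(2)] .
qed

lemma has_weak_deriv_add:
  assumes "integrable (lborel_on S) f" "integrable (lborel_on S) f'" "has_weak_deriv S f f'"
    "integrable (lborel_on S) h" "integrable (lborel_on S) h'" "has_weak_deriv S h h'"
  shows "has_weak_deriv S (\<lambda>x. f x + h x) (\<lambda>x. f' x + h' x)"
  using assms unfolding has_weak_deriv_def
  by (simp add: distrib_right integrable_mult_test_function)

lemma has_weak_deriv_scale: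
  assumes "has_weak_deriv S f f'"
  shows "has_weak_deriv S (\<lambda>x. c * f x) (\<lambda>x. c * f' x)"
  using assms unfolding has_weak_deriv_def by (simp add: mult.assoc)

lemma has_weak_deriv_cong_AE:
  assumes "has_weak_deriv S f f'"
    and m: "f \<in> borel_measurable (lborel_on S)" "h \<in> borel_measurable (lborel_on S)"
      "f' \<in> borel_measurable (lborel_on S)" "h' \<in> borel_measurable (lborel_on S)"
    and ae: "AE x in lborel_on S. f x = h x" "AE x in lborel_on S. f' x = h' x"
  shows "has_weak_deriv S h h'"
  unfolding has_weak_deriv_def
proof
  fix \<phi> assume \<phi>: "\<phi> \<in> test_functions S"
  have mm: "\<phi> \<in> borel_measurable (lborel_on S)" "(\<lambda>x. vector_derivative \<phi> (at x)) \<in> borel_measurable (lborel_on S)"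
    by (rule test_function_bounds[OF \<phi>], auto intro!: measurable_restrict_space1)+
  have "(LINT x|lborel_on S. f x * vector_derivative \<phi> (at x)) = (LINT x|lborel_on S. h x * vector_derivative \<phi> (at x))"
    by (rule integral_cong_AE) (use mm m ae(1) in \<open>auto elim!: eventually_mono\<close>)
  moreover have "(LINT x|lborel_on S. f' x * \<phi> x) = (LINT x|lborel_on S. h' x * \<phi> x)"
    by (rule integral_cong_AE) (use mm m ae(2) in \<open>auto elim!: eventually_mono\<close>)
  ultimately show "(LINT x|lborel_on S. h x * vector_derivative \<phi> (at x)) = - (LINT x|lborel_on S. h' x * \<phi> x)"
    using assms(1) \<phi> unfolding has_weak_deriv_def by simp
qed

lemma H1_add:
  assumes "f \<in> H1" "h \<in> H1"
  shows "(\<lambda>x. f x + h x) \<in> H1"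
    "AE x in lborel_on I01. weak_deriv (\<lambda>x. f x + h x) x = weak_deriv f x + weak_deriv h x"
proof -
  note f = H1_weak_deriv[OF assms(1)] and h = H1_weak_deriv[OF assms(2)]
  have d: "has_weak_deriv I01 (\<lambda>x. f x + h x) (\<lambda>x. weak_deriv f x + weak_deriv h x)"
    using f h by (intro has_weak_deriv_add L2_integrable)
  show "(\<lambda>x. f x + h x) \<in> H1"
    unfolding H1_def using d L2_add(1)[OF f(1) h(1)] L2_add(1)[OF f(2) h(2)] by blast
  show "AE x in lborel_on I01. weak_deriv (\<lambda>x. f x + h x) x = weak_deriv f x + weak_deriv h x"
    by (rule weak_deriv_AE[OF L2_add(1)[OF f(2) h(2)] d])
qed

lemma H1_scale:
  assumes "f \<in> H1"
  shows "(\<lambda>x. c * f x) \<in> H1" "AE x in lborel_on I01. weak_deriv (\<lambda>x. c * f x) x = c * weak_deriv f x"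
proof -
  note f = H1_weak_deriv[OF assms(1)]
  show "(\<lambda>x. c * f x) \<in> H1"
    unfolding H1_def using has_weak_deriv_scale[OF f(3)] L2_scale[OF f(1)] L2_scale[OF f(2)] by blast
  show "AE x in lborel_on I01. weak_deriv (\<lambda>x. c * f x) x = c * weak_deriv f x"
    by (rule weak_deriv_AE[OF L2_scale[OF f(2)] has_weak_deriv_scale[OF f(3)]])
qed

lemma continuous_L2:
  assumes "continuous_on UNIV f"
  shows "f \<in> L2"
proof -
  have "bounded (f ` {0..1})"
    using compact_continuous_image[OF continuous_on_subset[OF assms subset_UNIV] compact_Icc] compact_imp_bounded by blast
  then obtain C where "\<forall>x\<in>{0..1}. cmod (f x) \<le> C" unfolding bounded_iff by auto
  then show ?thesis
    using assms by (intro L2_bounded[of _ C])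
      (auto intro!: measurable_restrict_space1 borel_measurable_continuous_onI)
qed

lemma C1_H1:
  assumes "C1_deriv f f'"
  shows "f \<in> H1" "AE x in lborel_on I01. weak_deriv f x = f' x"
proof -
  have L: "f \<in> L2" "f' \<in> L2" using C1_derivD(2,3)[OF assms] by (auto intro: continuous_L2)
  have w: "has_weak_deriv I01 f f'" by (rule has_weak_deriv_C1[OF _ assms]) simp
  show "f \<in> H1" unfolding H1_def using L w by blast
  show "AE x in lborel_on I01. weak_deriv f x = f' x" by (rule weak_deriv_AE[OF L(2) w])
qed

section \<open>The space H10\<close>

lemma test_functions_linear:
  assumes "\<phi> \<in> test_functions S" "\<psi> \<in> test_functions S"
  shows "(\<lambda>x. \<phi> x + c * \<psi> x) \<in> test_functions S"
    and "vector_derivative (\<lambda>x. \<phi> x + c * \<psi> x) (at x) = vector_derivative \<phi> (at x) + c * vector_derivative \<psi> (at x)"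
proof -
  obtain \<phi>' K where \<phi>: "C1_deriv \<phi> \<phi>'" and K: "compact K" "K \<subseteq> S" "\<And>x. x \<notin> K \<Longrightarrow> \<phi> x = 0"
    and vd: "\<And>x. vector_derivative \<phi> (at x) = \<phi>' x"
    using assms(1) by (rule test_functionE) blast
  obtain \<psi>' L where \<psi>: "C1_deriv \<psi> \<psi>'" and L: "compact L" "L \<subseteq> S" "\<And>x. x \<notin> L \<Longrightarrow> \<psi> x = 0"
    and vd': "\<And>x. vector_derivative \<psi> (at x) = \<psi>' x"
    using assms(2) by (rule test_functionE) blast
  have s: "C1_deriv (\<lambda>x. \<phi> x + c * \<psi> x) (\<lambda>x. \<phi>' x + c * \<psi>' x)"
    unfolding C1_deriv_def using C1_derivD(1)[OF \<phi>] C1_derivD(1)[OF \<psi>] C1_derivD(2)[OF \<phi>] C1_derivD(2)[OF \<psi>]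
    by (auto intro!: derivative_intros continuous_intros)
  show "(\<lambda>x. \<phi> x + c * \<psi> x) \<in> test_functions S"
    by (rule test_functionI[OF s compact_Un[OF K(1) L(1)]]) (use K L in auto)
  show "vector_derivative (\<lambda>x. \<phi> x + c * \<psi> x) (at x) = vector_derivative \<phi> (at x) + c * vector_derivative \<psi> (at x)"
    unfolding vd vd' by (rule vector_derivative_at[OF C1_derivD(1)[OF s]])
qed

lemma test_function_L2:
  assumes "\<phi> \<in> test_functions S"
  shows "\<phi> \<in> L2" "(\<lambda>x. vector_derivative \<phi> (at x)) \<in> L2"
proof -
  obtain \<phi>' K where \<phi>: "C1_deriv \<phi> \<phi>'" and vd: "\<And>x. vector_derivative \<phi> (at x) = \<phi>' x"
    using assms by (rule test_functionE) blast
  show "\<phi> \<in> L2" "(\<lambda>x. vector_derivative \<phi> (at x)) \<in> L2"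
    unfolding vd by (rule continuous_L2[OF C1_derivD(3)[OF \<phi>]], rule continuous_L2[OF C1_derivD(2)[OF \<phi>]])
qed

lemma H10_H1: "f \<in> H10 \<Longrightarrow> f \<in> H1"
  by (simp add: H10_def)

lemma H10E:
  assumes "f \<in> H10" "\<epsilon> > 0"
  obtains \<phi> where "\<phi> \<in> test_functions I01" "L2_norm (\<lambda>x. f x - \<phi> x) < \<epsilon>"
    "L2_norm (\<lambda>x. weak_deriv f x - vector_derivative \<phi> (at x)) < \<epsilon>"
  using assms unfolding H10_def by blast

text \<open>This form covers sums with c = 1 and multiples by writing c f as f + (c - 1) f.\<close>

lemma H10_linear:
  assumes f: "f \<in> H10" and h: "h \<in> H10"
  shows "(\<lambda>x. f x + c * h x) \<in> H10"
proof -
  note f1 = H10_H1[OF f] and h1 = H10_H1[OF h]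
  note fw = H1_weak_deriv[OF f1] and hw = H1_weak_deriv[OF h1]
  let ?s = "\<lambda>x. f x + c * h x"
  have s1: "?s \<in> H1" by (rule H1_add(1)[OF f1 H1_scale(1)[OF h1]])
  have ae: "AE x in lborel_on I01. weak_deriv ?s x = weak_deriv f x + c * weak_deriv h x"
    using H1_add(2)[OF f1 H1_scale(1)[OF h1, of c]] H1_scale(2)[OF h1, of c] by eventually_elim simp
  have "\<exists>\<phi>\<in>test_functions I01. L2_norm (\<lambda>x. ?s x - \<phi> x) < \<epsilon> \<and>
     L2_norm (\<lambda>x. weak_deriv ?s x - vector_derivative \<phi> (at x)) < \<epsilon>" if \<epsilon>: "\<epsilon> > 0" for \<epsilon>
  proof -
    define d where "d = \<epsilon> / (1 + cmod c)"
    have c1: "1 + cmod c > 0" using norm_ge_zero[of c] by linarith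
    have "d + cmod c * d = d * (1 + cmod c)" by (simp add: algebra_simps)
    then have d: "d > 0" "d + cmod c * d = \<epsilon>"
      using \<epsilon> c1 by (simp_all add: d_def)
    obtain \<phi> where \<phi>: "\<phi> \<in> test_functions I01" "L2_norm (\<lambda>x. f x - \<phi> x) < d"
      "L2_norm (\<lambda>x. weak_deriv f x - vector_derivative \<phi> (at x)) < d" by (rule H10E[OF f d(1)])
    obtain \<psi> where \<psi>: "\<psi> \<in> test_functions I01" "L2_norm (\<lambda>x. h x - \<psi> x) < d"
      "L2_norm (\<lambda>x. weak_deriv h x - vector_derivative \<psi> (at x)) < d" by (rule H10E[OF h d(1)])
    note L = test_function_L2[OF \<phi>(1)] test_function_L2[OF \<psi>(1)]
    have est: "L2_norm (\<lambda>x. u x + c * v x) < \<epsilon>" if "u \<in> L2" "v \<in> L2" "L2_norm u < d" "L2_norm v < d" for u v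
    proof -
      have "L2_norm (\<lambda>x. u x + c * v x) \<le> L2_norm u + L2_norm (\<lambda>x. c * v x)"
        by (intro L2_norm_triangle that L2_scale)
      also have "\<dots> < d + cmod c * d"
        unfolding L2_norm_scale using that by (intro add_less_le_mono mult_left_mono) auto
      finally show ?thesis using d by simp
    qed
    have "L2_norm (\<lambda>x. ?s x - (\<phi> x + c * \<psi> x)) = L2_norm (\<lambda>x. (f x - \<phi> x) + c * (h x - \<psi> x))"
      by (simp add: algebra_simps)
    also have "\<dots> < \<epsilon>"
      using \<phi> \<psi> L fw hw by (intro est L2_diff) auto
    finally have 1: "L2_norm (\<lambda>x. ?s x - (\<phi> x + c * \<psi> x)) < \<epsilon>" .
    let ?t = "\<lambda>x. \<phi> x + c * \<psi> x"
    have "L2_norm (\<lambda>x. weak_deriv ?s x - vector_derivative ?t (at x)) =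
       L2_norm (\<lambda>x. (weak_deriv f x - vector_derivative \<phi> (at x)) + c * (weak_deriv h x - vector_derivative \<psi> (at x)))"
    proof (rule L2_norm_cong_AE)
      show "(\<lambda>x. weak_deriv ?s x - vector_derivative ?t (at x)) \<in> borel_measurable (lborel_on I01)"
        using H1_weak_deriv[OF s1] test_function_L2[OF test_functions_linear(1)[OF \<phi>(1) \<psi>(1)], of c]
        by (intro borel_measurable_diff L2_measurable)
      show "(\<lambda>x. (weak_deriv f x - vector_derivative \<phi> (at x)) + c * (weak_deriv h x - vector_derivative \<psi> (at x))) \<in> borel_measurable (lborel_on I01)"
        using fw hw L by (intro L2_measurable L2_add L2_scale L2_diff)
      show "AE x in lborel_on I01. weak_deriv ?s x - vector_derivative ?t (at x) = (weak_deriv f x - vector_derivative \<phi> (at x)) + c * (weak_deriv h x - vector_derivative \<psi> (at x))"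
        using ae by eventually_elim (simp add: test_functions_linear(2)[OF \<phi>(1) \<psi>(1)] algebra_simps)
    qed
    also have "\<dots> < \<epsilon>"
      using \<phi> \<psi> L fw hw by (intro est L2_diff) auto
    finally show ?thesis
      by (intro bexI[of _ ?t] conjI 1 test_functions_linear(1)[OF \<phi>(1) \<psi>(1)])
  qed
  then show ?thesis using s1 unfolding H10_def by blast
qed

text \<open>The approximants are \<open>\<xi> n * f\<close>. The dangerous term is
  \<open>\<xi>' n * f\<close>, where \<open>\<xi>' n\<close> is unbounded in n; since f vanishes at
  both ends with bounded derivative, it is at most a constant times the distance to the boundary,
  which compensates exactly this growth.\<close>

lemma H10_C1:
  assumes f: "C1_deriv f f'" and f0: "f 0 = 0" and f1: "f 1 = 0"
  shows "f \<in> H10"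
proof -
  have "bounded (f' ` {0..1})"
    by (rule compact_imp_bounded[OF compact_continuous_image[OF C1_derivD(2)[OF f] compact_Icc]])
  then obtain C where C: "\<forall>x\<in>{0..1}. cmod (f' x) \<le> C"
    unfolding bounded_iff by auto
  have "cmod (f' 0) \<le> C" using C by simp
  then have C0: "C \<ge> 0" by (rule order_trans[OF norm_ge_zero])
  have lip: "cmod (f b - f a) \<le> C * (b - a)" if "0 \<le> a" "a \<le> b" "b \<le> 1" for a b
  proof -
    have "(f' has_integral f b - f a) {a..b}"
      by (rule fundamental_theorem_of_calculus[OF that(2) C1_derivD(1)[OF f]])
    then show ?thesis
      using has_integral_bound_real[OF C0 finite.emptyI, of f' _ a b] C that by auto
  qed
  have fmin: "cmod (f x) \<le> C * min x (1 - x)" if "x \<in> I01" for x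
    using lip[of 0 x] lip[of x 1] that f0 f1 by (simp add: min_def)
  obtain \<xi> \<xi>' :: "nat \<Rightarrow> real \<Rightarrow> real" and B where
    \<xi>: "\<And>n. C1_deriv (\<xi> n) (\<xi>' n)" and
    ge: "\<And>n x. 0 \<le> \<xi> n x" and le: "\<And>n x. \<xi> n x \<le> 1" and
    out: "\<And>n x. x \<notin> {0 + 1 / Suc n .. 1 - 1 / Suc n} \<Longrightarrow> \<xi> n x = 0" and
    ev: "\<And>x. x \<in> {0<..<1} \<Longrightarrow> \<forall>\<^sub>F n in sequentially. \<xi> n x = 1 \<and> \<xi>' n x = 0" and
    B: "\<And>n x. x \<in> {0<..<1} \<Longrightarrow> \<bar>\<xi>' n x\<bar> * min (x - 0) (1 - x) \<le> B"
    by (rule cutoff_exists[of 0 1]) (simp, blast)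
  define \<phi> where "\<phi> n x = complex_of_real (\<xi> n x) * f x" for n x
  define \<phi>' where "\<phi>' n x = complex_of_real (\<xi> n x) * f' x + complex_of_real (\<xi>' n x) * f x" for n x
  have \<phi>: "C1_deriv (\<phi> n) (\<phi>' n)" for n
    unfolding \<phi>_def \<phi>'_def by (rule C1_deriv_mult[OF C1_deriv_of_real[OF \<xi>] f])
  have test: "\<phi> n \<in> test_functions I01" for n
  proof (rule test_functionI[OF \<phi> compact_Icc])
    have "0 < 1 / real (Suc n)" by simp
    then show "{0 + 1 / Suc n .. 1 - 1 / Suc n} \<subseteq> I01"
      unfolding subset_iff atLeastAtMost_iff greaterThanLessThan_iff by linarith
  qed (use out in \<open>auto simp: \<phi>_def\<close>)
  have vd: "vector_derivative (\<phi> n) (at x) = \<phi>' n x" for n x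
    by (rule vector_derivative_at[OF C1_derivD(1)[OF \<phi>]])
  note wd = C1_H1[OF f]
  have cm: "u \<in> borel_measurable (lborel_on I01)" if "continuous_on UNIV u" for u :: "real \<Rightarrow> complex"
    using that by (intro L2_measurable continuous_L2)
  note m = cm[OF C1_derivD(3)[OF f]] cm[OF C1_derivD(2)[OF f]] cm[OF C1_derivD(3)[OF \<phi>]] cm[OF C1_derivD(2)[OF \<phi>]]
  have l1: "(\<lambda>n. L2_norm (\<lambda>x. f x - \<phi> n x)) \<longlonglongrightarrow> 0"
  proof (rule L2_norm_tendsto_0[where C=C])
    show "(\<lambda>x. f x - \<phi> n x) \<in> borel_measurable (lborel_on I01)" for n
      by (intro borel_measurable_diff m)
    show "cmod (f x - \<phi> n x) \<le> C" if x: "x \<in> I01" for n x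
    proof -
      have "f x - \<phi> n x = of_real (1 - \<xi> n x) * f x" by (simp add: \<phi>_def algebra_simps)
      then have "cmod (f x - \<phi> n x) = (1 - \<xi> n x) * cmod (f x)"
        using le[of n x] by (simp add: norm_mult del: of_real_diff)
      also have "\<dots> \<le> 1 * (C * min x (1 - x))"
        using fmin[OF x] ge[of n x] le[of n x] by (intro mult_mono) auto
      also have "\<dots> \<le> C * 1" using x C0 by (simp add: mult_left_le min_le_iff_disj)
      finally show ?thesis by simp
    qed
    show "\<forall>\<^sub>F n in sequentially. f x - \<phi> n x = 0" if "x \<in> I01" for x
      using ev[OF that] by eventually_elim (simp add: \<phi>_def)
  qed
  have l2: "(\<lambda>n. L2_norm (\<lambda>x. f' x - \<phi>' n x)) \<longlonglongrightarrow> 0"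
  proof (rule L2_norm_tendsto_0[where C="C + C * B"])
    show "(\<lambda>x. f' x - \<phi>' n x) \<in> borel_measurable (lborel_on I01)" for n
      by (intro borel_measurable_diff m)
    show "cmod (f' x - \<phi>' n x) \<le> C + C * B" if x: "x \<in> I01" for n x
    proof -
      have "f' x - \<phi>' n x = of_real (1 - \<xi> n x) * f' x - of_real (\<xi>' n x) * f x" by (simp add: \<phi>'_def algebra_simps)
      then have "cmod (f' x - \<phi>' n x) \<le> cmod (of_real (1 - \<xi> n x) * f' x) + cmod (of_real (\<xi>' n x) * f x)"
        by (metis norm_triangle_ineq4)
      also have "cmod (of_real (1 - \<xi> n x) * f' x) = (1 - \<xi> n x) * cmod (f' x)"
        using le[of n x] by (simp add: norm_mult del: of_real_diff)
      also have "\<dots> \<le> 1 * C"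
        using C x ge[of n x] le[of n x] by (intro mult_mono) auto
      also have "cmod (of_real (\<xi>' n x) * f x) \<le> \<bar>\<xi>' n x\<bar> * (C * min x (1 - x))"
        unfolding norm_mult norm_of_real using fmin[OF x] by (intro mult_left_mono) auto
      also have "\<dots> = C * (\<bar>\<xi>' n x\<bar> * min (x - 0) (1 - x))" by simp
      also have "\<dots> \<le> C * B" using B[OF x] C0 by (rule mult_left_mono)
      finally show ?thesis by simp
    qed
    show "\<forall>\<^sub>F n in sequentially. f' x - \<phi>' n x = 0" if "x \<in> I01" for x
      using ev[OF that] by eventually_elim (simp add: \<phi>'_def)
  qed
  have "L2_norm (\<lambda>x. weak_deriv f x - vector_derivative (\<phi> n) (at x)) = L2_norm (\<lambda>x. f' x - \<phi>' n x)" for n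
    unfolding vd
  proof (rule L2_norm_cong_AE)
    show "(\<lambda>x. weak_deriv f x - \<phi>' n x) \<in> borel_measurable (lborel_on I01)"
      "(\<lambda>x. f' x - \<phi>' n x) \<in> borel_measurable (lborel_on I01)"
      using L2_measurable[OF H1_weak_deriv(2)[OF wd(1)]] by (intro borel_measurable_diff m; assumption)+
    show "AE x in lborel_on I01. weak_deriv f x - \<phi>' n x = f' x - \<phi>' n x"
      using wd(2) by eventually_elim simp
  qed
  with l2 have l3: "(\<lambda>n. L2_norm (\<lambda>x. weak_deriv f x - vector_derivative (\<phi> n) (at x))) \<longlonglongrightarrow> 0" by simp
  have "\<exists>\<phi>\<in>test_functions I01. L2_norm (\<lambda>x. f x - \<phi> x) < \<epsilon> \<and>
     L2_norm (\<lambda>x. weak_deriv f x - vector_derivative \<phi> (at x)) < \<epsilon>" if \<epsilon>: "\<epsilon> > 0" for \<epsilon>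
  proof -
    have "\<forall>\<^sub>F n in sequentially. L2_norm (\<lambda>x. f x - \<phi> n x) < \<epsilon> \<and>
      L2_norm (\<lambda>x. weak_deriv f x - vector_derivative (\<phi> n) (at x)) < \<epsilon>"
      using order_tendstoD(2)[OF l1 \<epsilon>] order_tendstoD(2)[OF l3 \<epsilon>] by eventually_elim simp
    then obtain n where "L2_norm (\<lambda>x. f x - \<phi> n x) < \<epsilon> \<and>
      L2_norm (\<lambda>x. weak_deriv f x - vector_derivative (\<phi> n) (at x)) < \<epsilon>"
      using eventually_happens'[OF sequentially_bot] by blast
    then show ?thesis using test by blast
  qed
  then show ?thesis using wd(1) unfolding H10_def by blast
qed

text \<open>A value of \<open>\<phi>\<close> is the integral of \<open>\<phi>'\<close> from 0, hence
  at most the L1 norm c of \<open>\<phi>'\<close>, which on an interval of measure one is at most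
  its L2 norm.\<close>

lemma Poincare_test_function:
  assumes "\<phi> \<in> test_functions I01"
  shows "L2_norm \<phi> \<le> L2_norm (\<lambda>x. vector_derivative \<phi> (at x))"
proof -
  obtain \<phi>' K where \<phi>: "C1_deriv \<phi> \<phi>'" and K: "compact K" "K \<subseteq> I01" "\<And>x. x \<notin> K \<Longrightarrow> \<phi> x = 0"
    "\<And>x. x \<notin> K \<Longrightarrow> \<phi>' x = 0" and vd: "\<And>x. vector_derivative \<phi> (at x) = \<phi>' x"
    using assms by (rule test_functionE) blast
  have L: "\<phi> \<in> L2" "\<phi>' \<in> L2" using test_function_L2[OF assms] unfolding vd by auto
  have i: "integrable (lborel_on I01) (\<lambda>x. cmod (\<phi>' x))" using L2_integrable[OF L(2)] by simp
  define c where "c = (LINT x|lborel_on I01. cmod (\<phi>' x))"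
  have c0: "c \<ge> 0" unfolding c_def by simp
  have "cmod (\<phi> x) \<le> c" if x: "x \<in> I01" for x
  proof -
    have "(LINT y|lborel. indicator {0..x} y *\<^sub>R \<phi>' y) = \<phi> x - \<phi> 0"
      using x by (intro integral_FTC_atLeastAtMost C1_derivD[OF \<phi>]) auto
    moreover have "\<phi> 0 = 0" using K(3)[of 0] subsetD[OF K(2), of 0] by fastforce
    ultimately have "cmod (\<phi> x) = cmod (LINT y|lborel. indicator {0..x} y *\<^sub>R \<phi>' y)" by simp
    also have "\<dots> \<le> (LINT y|lborel. norm (indicator {0..x} y *\<^sub>R \<phi>' y))"
      by (rule integral_norm_bound)
    also have "\<dots> \<le> (LINT y|lborel. indicator I01 y *\<^sub>R cmod (\<phi>' y))"
    proof (rule integral_mono)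
      show "integrable lborel (\<lambda>y. norm (indicator {0..x} y *\<^sub>R \<phi>' y))"
        by (intro integrable_norm borel_integrable_compact C1_derivD[OF \<phi>]) auto
      show "integrable lborel (\<lambda>y. indicator I01 y *\<^sub>R cmod (\<phi>' y))"
        using i by (simp add: integrable_restrict_space)
      show "norm (indicator {0..x} y *\<^sub>R \<phi>' y) \<le> indicator I01 y *\<^sub>R cmod (\<phi>' y)" for y
        using K(2) K(4)[of y] x by (cases "y \<in> K") (auto split: split_indicator)
    qed
    also have "\<dots> = c" unfolding c_def by (simp add: integral_restrict_space)
    finally show ?thesis .
  qed
  then have 1: "L2_norm \<phi> \<le> c" by (rule L2_bounded(2)[OF L2_measurable[OF L(1)]])
  have s: "integrable (lborel_on I01) (\<lambda>x. (cmod (\<phi>' x))\<^sup>2)" by (rule L2_square_integrable[OF L(2)])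
  have k: "integrable (lborel_on I01) (\<lambda>x. c\<^sup>2)" by (rule finite_measure.integrable_const[OF finite_measure_I01])
  \<comment> \<open>Nonnegativity of the variance of \<open>cmod (\<phi>' x)\<close> takes the place
    of the Cauchy-Schwarz inequality.\<close>
  have "0 \<le> (LINT x|lborel_on I01. (cmod (\<phi>' x) - c)\<^sup>2)" by simp
  also have "\<dots> = (LINT x|lborel_on I01. (cmod (\<phi>' x))\<^sup>2 - (2 * c) * cmod (\<phi>' x) + c\<^sup>2)"
    by (simp add: power2_diff algebra_simps)
  also have "\<dots> = (LINT x|lborel_on I01. (cmod (\<phi>' x))\<^sup>2) - (2 * c) * c + c\<^sup>2"
    using s i k by (subst Bochner_Integration.integral_add, simp, simp, subst Bochner_Integration.integral_diff)
      (simp_all add: c_def space_restrict_space measure_I01)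
  finally have "c\<^sup>2 \<le> (L2_norm \<phi>')\<^sup>2" unfolding L2_norm_power2 by (simp add: power2_eq_square)
  then have "c \<le> L2_norm \<phi>'" by (rule power2_le_imp_le) (rule L2_norm_nonneg)
  with 1 show ?thesis unfolding vd by simp
qed

text \<open>Density: an approximating test function has error below e / 2 in the function and in the
  derivative, which adds up to e.\<close>

lemma Poincare_H10:
  assumes f: "f \<in> H10"
  shows "L2_norm f \<le> L2_norm (weak_deriv f)"
proof (rule field_le_epsilon)
  fix e :: real assume "e > 0"
  then have "e / 2 > 0" by simp
  then obtain \<phi> where \<phi>: "\<phi> \<in> test_functions I01" "L2_norm (\<lambda>x. f x - \<phi> x) < e / 2"
      "L2_norm (\<lambda>x. weak_deriv f x - vector_derivative \<phi> (at x)) < e / 2" by (rule H10E[OF f])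
  note L = test_function_L2[OF \<phi>(1)] and w = H1_weak_deriv[OF H10_H1[OF f]]
  have "L2_norm f = L2_norm (\<lambda>x. (f x - \<phi> x) + \<phi> x)" by simp
  also have "\<dots> \<le> L2_norm (\<lambda>x. f x - \<phi> x) + L2_norm \<phi>"
    by (intro L2_norm_triangle L2_diff L w)
  also have "L2_norm \<phi> \<le> L2_norm (\<lambda>x. vector_derivative \<phi> (at x))"
    by (rule Poincare_test_function[OF \<phi>(1)])
  also have "\<dots> = L2_norm (\<lambda>x. weak_deriv f x + (- 1) * (weak_deriv f x - vector_derivative \<phi> (at x)))"
    by simp
  also have "\<dots> \<le> L2_norm (weak_deriv f) + L2_norm (\<lambda>x. (- 1) * (weak_deriv f x - vector_derivative \<phi> (at x)))"
    by (intro L2_norm_triangle L2_scale L2_diff L w)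
  finally show "L2_norm f \<le> L2_norm (weak_deriv f) + e"
    using \<phi>(2,3) unfolding L2_norm_scale by simp
qed

section \<open>Resolvent bound for uniformly stable semigroups\<close>

text \<open>The derivative of exp at 0, arranged as the coefficient left in front of U when the
  phase exp(- i omega h) is inserted into the difference quotient of the semigroup.\<close>

lemma exp_difference_quotient:
  fixes c :: complex
  shows "((\<lambda>h::real. (1 - exp (c * of_real h)) / of_real h + c) \<longlongrightarrow> 0) (at_right 0)"
proof (cases "c = 0")
  case False
  have "((\<lambda>h::real. c * of_real h) \<longlongrightarrow> c * of_real 0) (at_right 0)" by (intro tendsto_intros)
  then have "filterlim (\<lambda>h::real. c * of_real h) (at 0) (at_right 0)"
    using False by (auto simp: filterlim_at eventually_at_filter)
  with lim_exp_minus_1 have "((\<lambda>h::real. (exp (c * of_real h) - 1) / (c * of_real h)) \<longlongrightarrow> 1) (at_right 0)"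
    by (rule filterlim_compose)
  then have "((\<lambda>h::real. c - c * ((exp (c * of_real h) - 1) / (c * of_real h))) \<longlongrightarrow> c - c * 1) (at_right 0)"
    by (intro tendsto_intros)
  then have "((\<lambda>h::real. c - c * ((exp (c * of_real h) - 1) / (c * of_real h))) \<longlongrightarrow> 0) (at_right 0)" by simp
  moreover have "c - c * ((exp (c * of_real h) - 1) / (c * of_real h)) = (1 - exp (c * of_real h)) / of_real h + c" for h :: real
  proof -
    have "c * ((exp (c * of_real h) - 1) / (c * of_real h)) = (exp (c * of_real h) - 1) / of_real h"
      using False by simp
    then show ?thesis by (simp only:) (simp add: diff_divide_distrib)
  qed
  ultimately show ?thesis by (simp only:)
qed simp

text \<open>Telescoping along \<open>t = n h\<close> bounds \<open>U - exp (- \<i> \<omega> t) T t U\<close> by \<open>t M N F\<close> with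
  \<open>F = \<i> \<omega> U - A U\<close>, without integrating in the seminormed space of representatives.\<close>

lemma uniformly_stable_resolvent_bound:
  fixes sc :: "complex \<Rightarrow> 'a::ab_group_add \<Rightarrow> 'a"
  assumes vs: "vector_space sc"
    and add: "\<And>U V. U \<in> X \<Longrightarrow> V \<in> X \<Longrightarrow> U + V \<in> X"
    and scl: "\<And>c U. U \<in> X \<Longrightarrow> sc c U \<in> X"
    and tri: "\<And>U V. U \<in> X \<Longrightarrow> V \<in> X \<Longrightarrow> N (U + V) \<le> N U + N V"
    and hom: "\<And>c U. U \<in> X \<Longrightarrow> N (sc c U) = cmod c * N U"
    and gen: "generates_semigroup sc X N D A T"
    and stable: "uniformly_stable X N T"
  shows "\<exists>C. \<forall>\<omega>::real. \<forall>U\<in>X. \<forall>V\<in>X. U \<in> D \<longrightarrow> N (V - A U) = 0 \<longrightarrow> N U \<le> C * N (sc (\<i> * \<omega>) U - V)"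
proof -
  interpret vector_space sc by fact
  obtain M \<epsilon> where M: "M \<ge> 1" and \<epsilon>: "\<epsilon> > 0"
    and st: "\<And>t U. t \<ge> 0 \<Longrightarrow> U \<in> X \<Longrightarrow> N (T t U) \<le> M * exp (- \<epsilon> * t) * N U"
    using stable unfolding uniformly_stable_def by blast
  from gen have sg: "C0_semigroup sc X N T" and
    gn: "\<And>U V. U \<in> X \<Longrightarrow> V \<in> X \<Longrightarrow> U \<in> D \<Longrightarrow> N (V - A U) = 0 \<Longrightarrow>
      ((\<lambda>h. N (sc (of_real (1 / h)) (T h U - U) - V)) \<longlongrightarrow> 0) (at_right 0)"
    unfolding generates_semigroup_def by blast+
  from sg have TX: "\<And>t U. t \<ge> 0 \<Longrightarrow> U \<in> X \<Longrightarrow> T t U \<in> X"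
    and Tadd: "\<And>t U V. t \<ge> 0 \<Longrightarrow> U \<in> X \<Longrightarrow> V \<in> X \<Longrightarrow> N (T t (U + V) - (T t U + T t V)) = 0"
    and Tsc: "\<And>t c U. t \<ge> 0 \<Longrightarrow> U \<in> X \<Longrightarrow> N (T t (sc c U) - sc c (T t U)) = 0"
    and T0: "\<And>U. U \<in> X \<Longrightarrow> N (T 0 U - U) = 0"
    and Tplus: "\<And>t s U. t \<ge> 0 \<Longrightarrow> s \<ge> 0 \<Longrightarrow> U \<in> X \<Longrightarrow> N (T (t + s) U - T t (T s U)) = 0"
    unfolding C0_semigroup_def by simp_all
  have mX: "- U \<in> X" and Nm: "N (- U) = N U" if "U \<in> X" for U
    using scl[OF that, of "-1"] hom[OF that, of "-1"] by simp_all
  have dX: "U - V \<in> X" if "U \<in> X" "V \<in> X" for U V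
    using add[OF that(1) mX[OF that(2)]] by simp
  have N0: "N U \<ge> 0" if "U \<in> X" for U
    using tri[OF that mX[OF that]] Nm[OF that] hom[OF that, of 0] by simp
  \<comment> \<open>At this time the decay factor \<open>M * exp (- \<epsilon> * t)\<close> is one
    half, so the propagated state can be absorbed into the left side at the end.\<close>
  define t where "t = ln (2 * M) / \<epsilon>"
  have t: "t > 0" using M \<epsilon> by (simp add: t_def)
  have half: "M * exp (- \<epsilon> * t) = 1 / 2"
    using M \<epsilon> by (simp add: t_def exp_minus field_simps)
  have "N U \<le> 2 * t * M * N (sc (\<i> * \<omega>) U - V)"
    if U: "U \<in> X" and V: "V \<in> X" and UD: "U \<in> D" and VA: "N (V - A U) = 0" for \<omega> :: real and U V
  proof -
    define e where "e r = exp (- (\<i> * of_real (\<omega> * r)))" for r :: real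
    \<comment> \<open>The semigroup twisted by a unimodular phase, whose generator is A - i omega.
      The twist leaves norms unchanged, so the stability estimate carries over with constants free
      of \<open>\<omega>\<close>.\<close>
    define S where "S r W = sc (e r) (T r W)" for r W
    define F where "F = sc (\<i> * \<omega>) U - V"
    have ecm: "cmod (e r) = 1" for r by (simp add: e_def)
    have eadd: "e (r + s) = e r * e s" for r s
      by (simp add: e_def exp_add[symmetric] algebra_simps)
    have SX: "S r W \<in> X" if "r \<ge> 0" "W \<in> X" for r W
      unfolding S_def by (intro scl TX that)
    have FX: "F \<in> X" unfolding F_def by (intro dX scl U V)
    have step: "N (S a U - S (a + h) U) \<le> M * N (U - S h U)" if a: "a \<ge> 0" and h: "h \<ge> 0" for a h
    proof -
      let ?W = "U + sc (- e h) (T h U)"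
      let ?Y1 = "T a (sc (- e h) (T h U))" and ?Y2 = "T a (T h U)"
      let ?Z = "T a U + sc (- e h) (T (a + h) U)"
      note ThX = TX[OF h U]
      have WX: "?W \<in> X" by (intro add scl U ThX)
      have X: "T a ?W \<in> X" "T a U \<in> X" "?Y1 \<in> X" "?Y2 \<in> X" "T (a + h) U \<in> X"
        by (intro TX add_nonneg_nonneg a h WX U scl[OF ThX] ThX)+
      \<comment> \<open>T is additive, homogeneous and a semigroup only up to elements of seminorm
        zero. p, q and r are these three defects; they are kept as explicit summands and removed by
        the triangle inequality.\<close>
      define p where "p = T a ?W - (T a U + ?Y1)"
      define q where "q = ?Y1 - sc (- e h) ?Y2"
      define r where "r = T (a + h) U - ?Y2"
      have pX: "p \<in> X" and qX: "q \<in> X" and rX: "r \<in> X"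
        unfolding p_def q_def r_def by (intro dX add scl X)+
      have z: "N p = 0" "N q = 0" "N r = 0"
        unfolding p_def q_def r_def
        by (rule Tadd[OF a U scl[OF ThX]], rule Tsc[OF a ThX], rule Tplus[OF a h U])
      have "?Z = T a ?W + (- p) + (- q) + sc (- e h) r"
        unfolding p_def q_def r_def by (simp add: scale_right_diff_distrib)
      then have "N ?Z = N (T a ?W + (- p) + (- q) + sc (- e h) r)" by (rule arg_cong)
      then have "N ?Z \<le> N (T a ?W) + N (- p) + N (- q) + N (sc (- e h) r)"
        using tri[OF X(1) mX[OF pX]] tri[OF add[OF X(1) mX[OF pX]] mX[OF qX]]
          tri[OF add[OF add[OF X(1) mX[OF pX]] mX[OF qX]] scl[OF rX, of "- e h"]] by linarith
      also have "\<dots> = N (T a ?W)" using z Nm[OF pX] Nm[OF qX] hom[OF rX, of "- e h"] by (simp only:)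
      also have "\<dots> \<le> M * exp (- \<epsilon> * a) * N ?W" by (rule st[OF a WX])
      also have "\<dots> \<le> M * 1 * N ?W"
        using M \<epsilon> a N0[OF WX] by (intro mult_right_mono mult_left_mono) auto
      also have "?W = U - S h U" by (simp add: S_def)
      finally have "N ?Z \<le> M * N (U - S h U)" by simp
      moreover have "S a U - S (a + h) U = sc (e a) ?Z"
        by (simp add: S_def eadd scale_right_diff_distrib)
      moreover have "?Z \<in> X" by (intro add scl X)
      ultimately show ?thesis by (simp add: hom ecm)
    qed
    have tele: "N (U - S (real n * h) U) \<le> real n * (M * N (U - S h U))" if h: "h \<ge> 0" for n h
    proof (induction n)
      case 0
      have "e 0 = 1" by (simp add: e_def)
      then have "N (U - S 0 U) = N (- (T 0 U - U))" by (simp add: S_def)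
      also have "\<dots> = 0" using Nm[OF dX[OF TX[OF order_refl U] U]] T0[OF U] by simp
      finally show ?case by simp
    next
      case (Suc n)
      let ?a = "real n * h"
      have a: "?a \<ge> 0" using h by simp
      have "U - S (?a + h) U = (U - S ?a U) + (S ?a U - S (?a + h) U)" by simp
      also have "N \<dots> \<le> N (U - S ?a U) + N (S ?a U - S (?a + h) U)"
        using a h by (intro tri dX U SX) auto
      also have "\<dots> \<le> real n * (M * N (U - S h U)) + M * N (U - S h U)"
        by (intro add_mono Suc.IH step a h)
      finally show ?case by (simp add: algebra_simps)
    qed
    \<comment> \<open>The first summand is the error in the generator's difference quotient, the
      others come from the phase. Together they bound how far the quotient of the twisted semigroup
      is from F.\<close>
    define k where "k h = N (sc (of_real (1 / h)) (T h U - U) - V)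
      + (cmod ((1 - e h) / of_real h - \<i> * \<omega>) * N U + cmod (1 - e h) * N V)" for h
    have "(k \<longlongrightarrow> 0 + (cmod 0 * N U + cmod (1 - e 0) * N V)) (at_right 0)"
      unfolding k_def
    proof (intro tendsto_add tendsto_mult tendsto_norm tendsto_const gn U V UD VA)
      show "((\<lambda>h. (1 - e h) / of_real h - \<i> * \<omega>) \<longlongrightarrow> 0) (at_right 0)"
        using exp_difference_quotient[of "- (\<i> * \<omega>)"] by (simp add: e_def algebra_simps)
      show "((\<lambda>h. 1 - e h) \<longlongrightarrow> 1 - e 0) (at_right 0)"
        unfolding e_def by (intro tendsto_intros)
    qed
    then have k0: "(k \<longlongrightarrow> 0) (at_right 0)" by (simp add: e_def)
    have kbound: "N (sc (of_real (1 / h)) (U - S h U)) \<le> N F + k h" if h: "h > 0" for h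
    proof -
      let ?G = "sc (of_real (1 / h)) (T h U - U) - V"
      let ?b = "(1 - e h) / of_real h - \<i> * \<omega>"
      have ThX: "T h U \<in> X" using TX h U by simp
      then have GX: "?G \<in> X" by (intro dX scl U V)
      have c: "- e h * of_real (1 / h) = - (e h / of_real h)" by simp
      have "sc (of_real (1 / h)) (U - S h U) = F + (sc (- e h) ?G + (sc ?b U + sc (1 - e h) V))"
        unfolding F_def S_def
        by (simp add: scale_right_diff_distrib scale_left_diff_distrib scale_left_distrib diff_divide_distrib)
      also have "N \<dots> \<le> N F + (N (sc (- e h) ?G) + (N (sc ?b U) + N (sc (1 - e h) V)))"
        using tri[OF scl[OF U, of ?b] scl[OF V, of "1 - e h"]]
          tri[OF scl[OF GX, of "- e h"] add[OF scl[OF U, of ?b] scl[OF V, of "1 - e h"]]]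
          tri[OF FX add[OF scl[OF GX, of "- e h"] add[OF scl[OF U, of ?b] scl[OF V, of "1 - e h"]]]]
        by linarith
      also have "\<dots> = N F + k h"
        unfolding k_def hom[OF GX] hom[OF U] hom[OF V] by (simp add: ecm)
      finally show ?thesis .
    qed
    \<comment> \<open>With n + 1 steps of length t / (n + 1) the number of steps is t / h, which is
      just the factor turning the increment into a difference quotient. Only the error k remains,
      and it disappears in the limit.\<close>
    have bound: "N (U - S t U) \<le> t * M * N F"
    proof -
      define h where "h n = t / real (Suc n)" for n
      have hpos: "h n > 0" for n using t by (simp add: h_def)
      have "h \<longlonglongrightarrow> 0"
        unfolding h_def using LIMSEQ_Suc[OF lim_const_over_n[of t]] by simp
      then have "filterlim h (at_right 0) sequentially"
        using hpos by (simp add: filterlim_at less_imp_neq[THEN not_sym])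
      with k0 have "(\<lambda>n. k (h n)) \<longlonglongrightarrow> 0" by (rule filterlim_compose)
      then have "(\<lambda>n. t * M * (N F + k (h n))) \<longlonglongrightarrow> t * M * (N F + 0)"
        by (intro tendsto_intros)
      moreover have "N (U - S t U) \<le> t * M * (N F + k (h n))" for n
      proof -
        have "real (Suc n) * h n = t" by (simp add: h_def)
        then have "N (U - S t U) \<le> real (Suc n) * (M * N (U - S (h n) U))"
          using tele[of "h n" "Suc n"] hpos[of n] by simp
        also have "real (Suc n) = t * (1 / h n)" using t by (simp add: h_def)
        also have "t * (1 / h n) * (M * N (U - S (h n) U)) = t * M * N (sc (of_real (1 / h n)) (U - S (h n) U))"
          using hpos[of n] hom[OF dX[OF U SX[OF less_imp_le[OF hpos[of n]] U]], of "of_real (1 / h n)"]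
          by (simp add: norm_divide)
        also have "\<dots> \<le> t * M * (N F + k (h n))"
          using kbound[OF hpos[of n]] t M by (intro mult_left_mono) auto
        finally show ?thesis .
      qed
      ultimately show ?thesis using LIMSEQ_le_const by fastforce
    qed
    \<comment> \<open>Half of N U is absorbed, which yields the constant 2 t M.\<close>
    have "N U = N ((U - S t U) + S t U)" by simp
    also have "\<dots> \<le> N (U - S t U) + N (S t U)"
      using t by (intro tri dX U SX) auto
    also have "N (S t U) = N (T t U)" using TX[of t U] t U by (simp add: S_def hom ecm)
    also have "\<dots> \<le> 1 / 2 * N U" using st[OF less_imp_le[OF t] U] unfolding half .
    finally show ?thesis using bound by (simp add: F_def)
  qed
  then show ?thesis by blast
qed

section \<open>The history space\<close>

lemma H10_L2: "f \<in> H10 \<Longrightarrow> f \<in> L2"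
  by (rule H1_weak_deriv(1)[OF H10_H1])

section \<open>Null sets and slices of the product of the unit interval with the half-line\<close>

abbreviation strip :: "(real \<times> real) measure" where
  "strip \<equiv> lborel_on I01 \<Otimes>\<^sub>M lborel_on Rpos"

interpretation strip: pair_sigma_finite "lborel_on I01" "lborel_on Rpos"
  by (intro pair_sigma_finite.intro sigma_finite_measure_restrict_space sigma_finite_lborel) auto

text \<open>Information on x-derivatives holds for almost every s, information on s-derivatives for
  almost every x. Both are brought to the product measure by Fubini for null sets, which is why
  joint measurability is carried along.\<close>

lemma AE_strip_iff:
  fixes u v :: "real \<Rightarrow> real \<Rightarrow> complex"
  assumes [measurable]: "case_prod u \<in> borel_measurable strip" "case_prod v \<in> borel_measurable strip"
  shows "(AE p in strip. case_prod u p = case_prod v p) \<longleftrightarrow> (AE x in lborel_on I01. AE s in lborel_on Rpos. u x s = v x s)"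
    and "(AE p in strip. case_prod u p = case_prod v p) \<longleftrightarrow> (AE s in lborel_on Rpos. AE x in lborel_on I01. u x s = v x s)"
proof -
  have m: "{p \<in> space strip. case_prod u p = case_prod v p} \<in> sets strip" by measurable
  then have m': "{p \<in> space strip. u (fst p) (snd p) = v (fst p) (snd p)} \<in> sets strip"
    by (simp add: case_prod_beta')
  show 1: "(AE p in strip. case_prod u p = case_prod v p) \<longleftrightarrow> (AE x in lborel_on I01. AE s in lborel_on Rpos. u x s = v x s)"
    using strip.AE_pair_iff[OF m'] by (simp add: case_prod_beta')
  then show "(AE p in strip. case_prod u p = case_prod v p) \<longleftrightarrow> (AE s in lborel_on Rpos. AE x in lborel_on I01. u x s = v x s)"
    using strip.AE_commute[OF m'] by simp
qed

lemma strip_section_measurable: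
  assumes "case_prod u \<in> borel_measurable strip"
  shows "x \<in> I01 \<Longrightarrow> u x \<in> borel_measurable (lborel_on Rpos)"
    and "s \<in> Rpos \<Longrightarrow> (\<lambda>x. u x s) \<in> borel_measurable (lborel_on I01)"
  using measurable_Pair2[OF assms, of x] measurable_Pair1[OF assms, of s]
  by (simp_all add: space_restrict_space)

text \<open>Uniqueness of the weak derivative on almost every slice identifies the chosen
  x-derivative with any other admissible one.\<close>

lemma x_deriv_spec:
  assumes "has_x_deriv \<eta> \<eta>'"
  shows "has_x_deriv \<eta> (x_deriv \<eta>)" "AE p in strip. case_prod (x_deriv \<eta>) p = case_prod \<eta>' p"
proof -
  show x: "has_x_deriv \<eta> (x_deriv \<eta>)"
    unfolding x_deriv_def by (rule someI[of _ \<eta>']) (rule assms)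
  from x assms have m: "case_prod (x_deriv \<eta>) \<in> borel_measurable strip" "case_prod \<eta>' \<in> borel_measurable strip"
    by (auto simp: has_x_deriv_def)
  have "AE s in lborel_on Rpos. (\<lambda>x. x_deriv \<eta> x s) \<in> L2 \<and> has_weak_deriv I01 (\<lambda>x. \<eta> x s) (\<lambda>x. x_deriv \<eta> x s)"
    "AE s in lborel_on Rpos. (\<lambda>x. \<eta>' x s) \<in> L2 \<and> has_weak_deriv I01 (\<lambda>x. \<eta> x s) (\<lambda>x. \<eta>' x s)"
    using x assms by (auto simp: has_x_deriv_def)
  then have "AE s in lborel_on Rpos. AE x in lborel_on I01. x_deriv \<eta> x s = \<eta>' x s"
  proof eventually_elim
    case (elim s)
    from elim(1) have 1: "AE x in lborel_on I01. weak_deriv (\<lambda>x. \<eta> x s) x = x_deriv \<eta> x s"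
      using weak_deriv_AE(3)[of "\<lambda>x. x_deriv \<eta> x s" "\<lambda>x. \<eta> x s"] by simp
    from elim(2) have 2: "AE x in lborel_on I01. weak_deriv (\<lambda>x. \<eta> x s) x = \<eta>' x s"
      using weak_deriv_AE(3)[of "\<lambda>x. \<eta>' x s" "\<lambda>x. \<eta> x s"] by simp
    from 1 2 show ?case by eventually_elim simp
  qed
  then show "AE p in strip. case_prod (x_deriv \<eta>) p = case_prod \<eta>' p"
    using AE_strip_iff(2)[OF m] by simp
qed

text \<open>The density of the squared history norm as a function of the pair, in the shape that
  Fubini and Tonelli on \<open>strip\<close> require.\<close>

definition Qg :: "(real \<Rightarrow> real) \<Rightarrow> (real \<Rightarrow> real \<Rightarrow> complex) \<Rightarrow> real \<times> real \<Rightarrow> real" where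
  "Qg g u = (\<lambda>p. g (snd p) * (cmod (case_prod u p))\<^sup>2)"

lemma Qg_measurable:
  assumes [measurable]: "g \<in> borel_measurable (lborel_on Rpos)" "case_prod u \<in> borel_measurable strip"
  shows "Qg g u \<in> borel_measurable strip"
  unfolding Qg_def by measurable

lemma Qg_cong_AE:
  assumes g: "g \<in> borel_measurable (lborel_on Rpos)"
    and u: "case_prod u \<in> borel_measurable strip" and v: "case_prod v \<in> borel_measurable strip"
    and ae: "AE p in strip. case_prod u p = case_prod v p"
  shows "integrable strip (Qg g u) \<longleftrightarrow> integrable strip (Qg g v)"
    "integral\<^sup>L strip (Qg g u) = integral\<^sup>L strip (Qg g v)"
proof -
  have e: "AE p in strip. Qg g u p = Qg g v p"
    using ae by eventually_elim (simp add: Qg_def)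
  show "integrable strip (Qg g u) \<longleftrightarrow> integrable strip (Qg g v)"
    by (rule integrable_cong_AE[OF Qg_measurable[OF g u] Qg_measurable[OF g v] e])
  show "integral\<^sup>L strip (Qg g u) = integral\<^sup>L strip (Qg g v)"
    by (rule integral_cong_AE[OF Qg_measurable[OF g u] Qg_measurable[OF g v] e])
qed

lemma L2g_iff:
  "\<eta> \<in> L2g g \<longleftrightarrow> case_prod \<eta> \<in> borel_measurable strip \<and> (AE s in lborel_on Rpos. (\<lambda>x. \<eta> x s) \<in> H10) \<and>
     (\<exists>\<eta>'. has_x_deriv \<eta> \<eta>') \<and> integrable strip (Qg g (x_deriv \<eta>))"
  unfolding L2g_def Qg_def by (simp add: case_prod_beta')

lemma L2g_norm_power2:
  assumes g: "\<forall>s>0. g s > 0" and i: "integrable strip (Qg g (x_deriv \<eta>))"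
  shows "(L2g_norm g \<eta>)\<^sup>2 = integral\<^sup>L strip (Qg g (x_deriv \<eta>))"
proof -
  have "(LINT x|lborel_on I01. LINT s|lborel_on Rpos. g s * (cmod (x_deriv \<eta> x s))\<^sup>2) = integral\<^sup>L strip (Qg g (x_deriv \<eta>))"
    using strip.integral_fst'[OF i] by (simp add: Qg_def)
  moreover have "integral\<^sup>L strip (Qg g (x_deriv \<eta>)) \<ge> 0"
    by (rule Bochner_Integration.integral_nonneg)
      (auto simp: Qg_def space_pair_measure space_restrict_space intro!: mult_nonneg_nonneg less_imp_le[OF g[rule_format]])
  ultimately show ?thesis by (simp add: L2g_norm_def)
qed

text \<open>Membership and norm may be computed from any x-derivative instead of the chosen
  \<open>x_deriv\<close>.\<close>

lemma L2gI:
  assumes g: "g \<in> borel_measurable (lborel_on Rpos)" "\<forall>s>0. g s > 0"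
    and d: "has_x_deriv \<eta> \<eta>'" and i: "integrable strip (Qg g \<eta>')"
  shows "case_prod \<eta> \<in> borel_measurable strip \<Longrightarrow> AE s in lborel_on Rpos. (\<lambda>x. \<eta> x s) \<in> H10 \<Longrightarrow> \<eta> \<in> L2g g"
    and "(L2g_norm g \<eta>)\<^sup>2 = integral\<^sup>L strip (Qg g \<eta>')"
proof -
  note x = x_deriv_spec[OF d]
  have m: "case_prod (x_deriv \<eta>) \<in> borel_measurable strip" "case_prod \<eta>' \<in> borel_measurable strip"
    using x d by (auto simp: has_x_deriv_def)
  note c = Qg_cong_AE[OF g(1) m x(2)]
  show "case_prod \<eta> \<in> borel_measurable strip \<Longrightarrow> AE s in lborel_on Rpos. (\<lambda>x. \<eta> x s) \<in> H10 \<Longrightarrow> \<eta> \<in> L2g g"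
    using d i c by (auto simp: L2g_iff)
  show "(L2g_norm g \<eta>)\<^sup>2 = integral\<^sup>L strip (Qg g \<eta>')"
    using L2g_norm_power2[where g=g, OF g(2)] i c by simp
qed

lemma L2gD:
  assumes "\<eta> \<in> L2g g"
  shows "case_prod \<eta> \<in> borel_measurable strip" "AE s in lborel_on Rpos. (\<lambda>x. \<eta> x s) \<in> H10"
    "has_x_deriv \<eta> (x_deriv \<eta>)" "case_prod (x_deriv \<eta>) \<in> borel_measurable strip"
    "integrable strip (Qg g (x_deriv \<eta>))"
  using assms x_deriv_spec(1) unfolding L2g_iff has_x_deriv_def by blast+

lemma has_x_deriv_linear:
  assumes u: "has_x_deriv u u'" "AE s in lborel_on Rpos. (\<lambda>x. u x s) \<in> L2"
    and v: "has_x_deriv v v'" "AE s in lborel_on Rpos. (\<lambda>x. v x s) \<in> L2"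
  shows "has_x_deriv (\<lambda>x s. u x s + c * v x s) (\<lambda>x s. u' x s + c * v' x s)"
  unfolding has_x_deriv_def
proof
  have [measurable]: "case_prod u' \<in> borel_measurable strip" "case_prod v' \<in> borel_measurable strip"
    using u v by (auto simp: has_x_deriv_def)
  have "(\<lambda>p. case_prod u' p + c * case_prod v' p) \<in> borel_measurable strip" by measurable
  then show "(\<lambda>(x, s). u' x s + c * v' x s) \<in> borel_measurable strip" by (simp add: case_prod_beta')
  have "AE s in lborel_on Rpos. (\<lambda>x. u' x s) \<in> L2 \<and> has_weak_deriv I01 (\<lambda>x. u x s) (\<lambda>x. u' x s)"
    "AE s in lborel_on Rpos. (\<lambda>x. v' x s) \<in> L2 \<and> has_weak_deriv I01 (\<lambda>x. v x s) (\<lambda>x. v' x s)"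
    using u v by (auto simp: has_x_deriv_def)
  with u(2) v(2) show "AE s in lborel_on Rpos. (\<lambda>x. u' x s + c * v' x s) \<in> L2 \<and>
      has_weak_deriv I01 (\<lambda>x. u x s + c * v x s) (\<lambda>x. u' x s + c * v' x s)"
  proof eventually_elim
    case (elim s)
    then show ?case
      by (intro conjI L2_add(1) L2_scale has_weak_deriv_add has_weak_deriv_scale L2_integrable) auto
  qed
qed

text \<open>The norm estimate is kept in quadratic form so that it can be added to those of the
  other energy components before \<open>triangle_of_quadratic\<close> is applied.\<close>

lemma L2g_linear:
  assumes g: "g \<in> borel_measurable (lborel_on Rpos)" "\<forall>s>0. g s > 0"
    and u: "u \<in> L2g g" and v: "v \<in> L2g g"
  shows "(\<lambda>x s. u x s + c * v x s) \<in> L2g g"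
    and "0 < \<theta> \<Longrightarrow> \<theta> < 1 \<Longrightarrow>
      (L2g_norm g (\<lambda>x s. u x s + v x s))\<^sup>2 \<le> (L2g_norm g u)\<^sup>2 / \<theta> + (L2g_norm g v)\<^sup>2 / (1 - \<theta>)"
proof -
  note U = L2gD[OF u] and V = L2gD[OF v]
  note [measurable] = g(1) U(1,4) V(1,4)
  have uL: "AE s in lborel_on Rpos. (\<lambda>x. u x s) \<in> L2" and vL: "AE s in lborel_on Rpos. (\<lambda>x. v x s) \<in> L2"
    using eventually_mono[OF U(2) H10_L2] eventually_mono[OF V(2) H10_L2] by simp_all
  have d: "has_x_deriv (\<lambda>x s. u x s + c * v x s) (\<lambda>x s. x_deriv u x s + c * x_deriv v x s)" for c
    by (rule has_x_deriv_linear[OF U(3) uL V(3) vL])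
  have gs: "\<forall>p\<in>space strip. g (snd p) \<ge> 0"
    using g(2) by (auto simp: space_pair_measure space_restrict_space less_imp_le)
  have gm: "(\<lambda>p. g (snd p)) \<in> borel_measurable strip" by measurable
  have vc: "integrable strip (\<lambda>p. g (snd p) * (cmod (c * case_prod (x_deriv v) p))\<^sup>2)" for c
    using integrable_mult_right[OF V(5), of "(cmod c)\<^sup>2"]
    by (simp add: Qg_def norm_mult power_mult_distrib mult_ac)
  have cm: "(\<lambda>p. c * case_prod (x_deriv v) p) \<in> borel_measurable strip" for c by measurable
  note W = weighted_square_integral_add[OF U(4) cm gm gs U(5)[unfolded Qg_def] vc]
  have i: "integrable strip (Qg g (\<lambda>x s. x_deriv u x s + c * x_deriv v x s))" for c
    using W(1)[of c] by (simp add: Qg_def case_prod_beta')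
  show "(\<lambda>x s. u x s + c * v x s) \<in> L2g g"
  proof (rule L2gI(1)[where g=g, OF g d i])
    have "(\<lambda>p. case_prod u p + c * case_prod v p) \<in> borel_measurable strip" by measurable
    then show "(\<lambda>(x, s). u x s + c * v x s) \<in> borel_measurable strip" by (simp add: case_prod_beta')
    show "AE s in lborel_on Rpos. (\<lambda>x. u x s + c * v x s) \<in> H10"
      using U(2) V(2) by eventually_elim (rule H10_linear)
  qed
  assume \<theta>: "0 < \<theta>" "\<theta> < 1"
  have "(L2g_norm g (\<lambda>x s. u x s + v x s))\<^sup>2 = integral\<^sup>L strip (Qg g (\<lambda>x s. x_deriv u x s + 1 * x_deriv v x s))"
    using L2gI(2)[where g=g, OF g d i, of 1] by simp
  also have "\<dots> \<le> integral\<^sup>L strip (Qg g (x_deriv u)) / \<theta> + integral\<^sup>L strip (Qg g (x_deriv v)) / (1 - \<theta>)"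
    using W(2)[OF \<theta>, of 1] by (simp add: Qg_def case_prod_beta')
  also have "\<dots> = (L2g_norm g u)\<^sup>2 / \<theta> + (L2g_norm g v)\<^sup>2 / (1 - \<theta>)"
    using L2g_norm_power2[where g=g, OF g(2) U(5)] L2g_norm_power2[where g=g, OF g(2) V(5)] by simp
  finally show "(L2g_norm g (\<lambda>x s. u x s + v x s))\<^sup>2 \<le> (L2g_norm g u)\<^sup>2 / \<theta> + (L2g_norm g v)\<^sup>2 / (1 - \<theta>)" .
qed

lemma L2g_scale:
  assumes g: "g \<in> borel_measurable (lborel_on Rpos)" "\<forall>s>0. g s > 0"
    and v: "v \<in> L2g g"
  shows "(\<lambda>x s. c * v x s) \<in> L2g g"
    and "L2g_norm g (\<lambda>x s. c * v x s) = cmod c * L2g_norm g v"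
proof -
  show "(\<lambda>x s. c * v x s) \<in> L2g g"
    using L2g_linear(1)[where g=g, OF g v v, of "c - 1"] by (simp add: algebra_simps)
  note V = L2gD[OF v]
  have vL: "AE s in lborel_on Rpos. (\<lambda>x. v x s) \<in> L2"
    by (rule eventually_mono[OF V(2) H10_L2])
  have d: "has_x_deriv (\<lambda>x s. c * v x s) (\<lambda>x s. c * x_deriv v x s)"
    using has_x_deriv_linear[OF V(3) vL V(3) vL, of "c - 1"] by (simp add: algebra_simps)
  have eq: "Qg g (\<lambda>x s. c * x_deriv v x s) = (\<lambda>p. (cmod c)\<^sup>2 * Qg g (x_deriv v) p)"
    by (auto simp: Qg_def norm_mult power_mult_distrib)
  have "integrable strip (Qg g (\<lambda>x s. c * x_deriv v x s))" unfolding eq using V(5) by simp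
  then have "(L2g_norm g (\<lambda>x s. c * v x s))\<^sup>2 = integral\<^sup>L strip (Qg g (\<lambda>x s. c * x_deriv v x s))"
    by (intro L2gI(2)[where g=g] g d)
  also have "\<dots> = (cmod c * L2g_norm g v)\<^sup>2"
    unfolding eq using L2g_norm_power2[where g=g, OF g(2) V(5)] by (simp add: power_mult_distrib)
  finally have "(L2g_norm g (\<lambda>x s. c * v x s))\<^sup>2 = (cmod c * L2g_norm g v)\<^sup>2" .
  moreover have "L2g_norm g w \<ge> 0" for w
    unfolding L2g_norm_def
    by (intro real_sqrt_ge_zero Bochner_Integration.integral_nonneg mult_nonneg_nonneg)
      (auto simp: space_restrict_space less_imp_le[OF g(2)[rule_format]])
  ultimately show "L2g_norm g (\<lambda>x s. c * v x s) = cmod c * L2g_norm g v"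
    by (simp add: power2_eq_iff_nonneg)
qed

text \<open>The Poincare inequality transfers the weighted bound from \<open>x_deriv \<zeta>\<close> to \<open>\<zeta>\<close> itself; this makes
  \<open>\<zeta> x\<close> locally integrable in \<open>s\<close>, which uniqueness of the weak \<open>s\<close>-derivative requires.\<close>

lemma L2g_integrable_Qg:
  assumes g: "g \<in> borel_measurable (lborel_on Rpos)" "\<forall>s>0. g s > 0"
    and z: "\<zeta> \<in> L2g g"
  shows "integrable strip (Qg g \<zeta>)"
proof -
  note Z = L2gD[OF z]
  have m: "Qg g \<zeta> \<in> borel_measurable strip" "Qg g (x_deriv \<zeta>) \<in> borel_measurable strip"
    by (rule Qg_measurable[OF g(1) Z(1)], rule Qg_measurable[OF g(1) Z(4)])
  have nn: "Qg g w p \<ge> 0" if "p \<in> space strip" for w p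
    using that g(2)[rule_format, of "snd p"] by (auto simp: Qg_def space_pair_measure space_restrict_space less_imp_le)
  have sq: "(\<integral>\<^sup>+x. ennreal ((cmod (f x))\<^sup>2) \<partial>lborel_on I01) = ennreal ((L2_norm f)\<^sup>2)" if "f \<in> L2" for f
    unfolding L2_norm_power2 by (rule nn_integral_eq_integral[OF L2_square_integrable[OF that]]) simp
  have ae: "AE s in lborel_on Rpos. (\<integral>\<^sup>+x. Qg g \<zeta> (x, s) \<partial>lborel_on I01) \<le> (\<integral>\<^sup>+x. Qg g (x_deriv \<zeta>) (x, s) \<partial>lborel_on I01)"
  proof -
    have "AE s in lborel_on Rpos. (\<lambda>x. x_deriv \<zeta> x s) \<in> L2 \<and> has_weak_deriv I01 (\<lambda>x. \<zeta> x s) (\<lambda>x. x_deriv \<zeta> x s)"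
      using Z(3) by (simp add: has_x_deriv_def)
    with Z(2) AE_space show ?thesis
    proof eventually_elim
      case (elim s)
      have s: "s > 0" using elim(2) by (simp add: space_restrict_space)
      note w = H1_weak_deriv[OF H10_H1[OF elim(1)]]
      have x: "(\<lambda>x. x_deriv \<zeta> x s) \<in> L2" using elim(3) by simp
      have "L2_norm (\<lambda>x. \<zeta> x s) \<le> L2_norm (weak_deriv (\<lambda>x. \<zeta> x s))" by (rule Poincare_H10[OF elim(1)])
      also have "\<dots> = L2_norm (\<lambda>x. x_deriv \<zeta> x s)"
        by (rule L2_norm_cong_AE[OF L2_measurable[OF w(2)] L2_measurable[OF x] weak_deriv_AE(3)]) (use elim(3) in auto)
      finally have le: "(L2_norm (\<lambda>x. \<zeta> x s))\<^sup>2 \<le> (L2_norm (\<lambda>x. x_deriv \<zeta> x s))\<^sup>2"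
        by (rule power_mono) (rule L2_norm_nonneg)
      have fac: "(\<integral>\<^sup>+x. Qg g v (x, s) \<partial>lborel_on I01) = ennreal (g s) * ennreal ((L2_norm (\<lambda>x. v x s))\<^sup>2)"
        if "(\<lambda>x. v x s) \<in> L2" for v
      proof -
        have [measurable]: "(\<lambda>x. v x s) \<in> borel_measurable (lborel_on I01)" by (rule L2_measurable[OF that])
        have "(\<integral>\<^sup>+x. Qg g v (x, s) \<partial>lborel_on I01) = (\<integral>\<^sup>+x. ennreal (g s) * ennreal ((cmod (v x s))\<^sup>2) \<partial>lborel_on I01)"
          using g(2)[rule_format, OF s] by (simp add: Qg_def ennreal_mult')
        also have "\<dots> = ennreal (g s) * (\<integral>\<^sup>+x. ennreal ((cmod (v x s))\<^sup>2) \<partial>lborel_on I01)"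
          by (rule nn_integral_cmult) measurable
        finally show ?thesis by (simp add: sq[OF that])
      qed
      show ?case unfolding fac[of \<zeta>, OF w(1)] fac[of "x_deriv \<zeta>", OF x] using le by (intro mult_left_mono ennreal_leI) auto
    qed
  qed
  \<comment> \<open>Tonelli with s outermost, because the Poincare inequality acts on slices of
    fixed s. Nonnegative integrals are used since integrability is what is to be shown.\<close>
  have "(\<integral>\<^sup>+p. Qg g \<zeta> p \<partial>strip) = (\<integral>\<^sup>+s. \<integral>\<^sup>+x. Qg g \<zeta> (x, s) \<partial>lborel_on I01 \<partial>lborel_on Rpos)"
    using m(1) by (subst strip.nn_integral_snd) auto
  also have "\<dots> \<le> (\<integral>\<^sup>+s. \<integral>\<^sup>+x. Qg g (x_deriv \<zeta>) (x, s) \<partial>lborel_on I01 \<partial>lborel_on Rpos)"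
    by (rule nn_integral_mono_AE[OF ae])
  also have "\<dots> = (\<integral>\<^sup>+p. Qg g (x_deriv \<zeta>) p \<partial>strip)"
    using m(2) by (subst strip.nn_integral_snd) auto
  also have "\<dots> < \<infinity>"
    using nn_integral_eq_integral[OF Z(5)] nn by (simp add: AE_I2)
  finally show ?thesis
    using m(1) nn by (intro integrableI_nonneg) (auto intro: AE_I2)
qed

text \<open>On a compact interval in the half-line the decreasing weight is at least its value g b >
  0 at the right end, so the modulus of \<open>\<zeta> x s\<close> is dominated by 1 plus the
  integrable density divided by g b.\<close>

lemma L2g_locally_integrable:
  assumes g: "g \<in> borel_measurable (lborel_on Rpos)" "\<forall>s>0. g s > 0" "antimono_on Rpos g"
    and z: "\<zeta> \<in> L2g g"
  shows "AE x in lborel_on I01. \<forall>a b. {a..b} \<subseteq> Rpos \<longrightarrow> set_integrable lborel {a..b} (\<zeta> x)"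
proof -
  have "AE x in lborel_on I01. integrable (lborel_on Rpos) (\<lambda>s. Qg g \<zeta> (x, s))"
    by (rule strip.AE_integrable_fst'[OF L2g_integrable_Qg[where g=g, OF g(1,2) z]])
  with AE_space show ?thesis
  proof eventually_elim
    case (elim x)
    have x: "x \<in> I01" using elim(1) by (simp add: space_restrict_space)
    show ?case
    proof (intro allI impI)
      fix a b :: real assume ab: "{a..b} \<subseteq> Rpos"
      have "(\<lambda>s. indicator Rpos s *\<^sub>R \<zeta> x s) \<in> borel_measurable lborel"
        using strip_section_measurable(1)[OF L2gD(1)[OF z] x] by (simp add: borel_measurable_restrict_space_iff)
      then have "(\<lambda>s. indicator {a..b} s *\<^sub>R (indicator Rpos s *\<^sub>R \<zeta> x s)) \<in> borel_measurable lborel"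
        by measurable
      also have "(\<lambda>s. indicator {a..b} s *\<^sub>R (indicator Rpos s *\<^sub>R \<zeta> x s)) = (\<lambda>s. indicator {a..b} s *\<^sub>R \<zeta> x s)"
        using ab by (auto simp: fun_eq_iff indicator_def)
      finally have m: "(\<lambda>s. indicator {a..b} s *\<^sub>R \<zeta> x s) \<in> borel_measurable lborel" .
      have i: "integrable lborel (\<lambda>s. indicator Rpos s *\<^sub>R (g s * (cmod (\<zeta> x s))\<^sup>2))"
        using elim(2) by (simp add: integrable_restrict_space Qg_def)
      have k: "integrable lborel (\<lambda>s. indicator {a..b} s *\<^sub>R (1::real))"
        by (intro borel_integrable_compact) auto
      show "set_integrable lborel {a..b} (\<zeta> x)"
        unfolding set_integrable_def
      proof (rule Bochner_Integration.integrable_bound[OF _ m])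
        show "integrable lborel (\<lambda>s. indicator {a..b} s *\<^sub>R 1 + (indicator Rpos s *\<^sub>R (g s * (cmod (\<zeta> x s))\<^sup>2)) / g b)"
          using i k by (intro Bochner_Integration.integrable_add integrable_divide)
        show "AE s in lborel. norm (indicator {a..b} s *\<^sub>R \<zeta> x s) \<le>
          norm (indicator {a..b} s *\<^sub>R 1 + (indicator Rpos s *\<^sub>R (g s * (cmod (\<zeta> x s))\<^sup>2)) / g b)"
        proof (rule AE_I2)
          fix s
          show "norm (indicator {a..b} s *\<^sub>R \<zeta> x s) \<le>
            norm (indicator {a..b} s *\<^sub>R 1 + (indicator Rpos s *\<^sub>R (g s * (cmod (\<zeta> x s))\<^sup>2)) / g b)"
          proof (cases "s \<in> {a..b}")
            case True
            then have s: "s > 0" "b > 0" "s \<le> b" using ab by auto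
            have gb: "g b > 0" using g(2) s by simp
            have "g b \<le> g s" using g(3) s by (auto simp: monotone_on_def)
            then have "(cmod (\<zeta> x s))\<^sup>2 \<le> g s * (cmod (\<zeta> x s))\<^sup>2 / g b"
              using gb by (simp add: field_simps mult_right_mono)
            moreover have "t \<le> 1 + t\<^sup>2" for t :: real
              using sum_power2_ge_zero[of "t - 1/2" 0] by (simp add: power2_eq_square algebra_simps)
            ultimately show ?thesis
              using True s by (auto simp: abs_of_nonneg g(2) intro!: order_trans[OF _ abs_ge_self] order_trans[OF \<open>cmod (\<zeta> x s) \<le> 1 + (cmod (\<zeta> x s))\<^sup>2\<close>])
          qed simp
        qed
      qed
    qed
  qed
qed

text \<open>The counterpart of \<open>x_deriv_spec\<close> for the other variable: uniqueness of
  weak derivatives on the half-line for almost every x, then passage to the product measure.\<close>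

lemma s_deriv_AE:
  assumes g: "g \<in> borel_measurable (lborel_on Rpos)" "\<forall>s>0. g s > 0" "antimono_on Rpos g"
    and d: "has_s_deriv g \<eta> \<eta>'"
  shows "s_deriv g \<eta> \<in> L2g g" "AE p in strip. case_prod (s_deriv g \<eta>) p = case_prod \<eta>' p"
proof -
  have s: "has_s_deriv g \<eta> (s_deriv g \<eta>)"
    unfolding s_deriv_def by (rule someI[of _ \<eta>']) (rule d)
  then show L: "s_deriv g \<eta> \<in> L2g g" by (simp add: has_s_deriv_def)
  have L': "\<eta>' \<in> L2g g" using d by (simp add: has_s_deriv_def)
  have "AE x in lborel_on I01. has_weak_deriv Rpos (\<eta> x) (s_deriv g \<eta> x)"
    "AE x in lborel_on I01. has_weak_deriv Rpos (\<eta> x) (\<eta>' x)"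
    using s d by (auto simp: has_s_deriv_def)
  with L2g_locally_integrable[where g=g, OF g L] L2g_locally_integrable[where g=g, OF g L']
  have "AE x in lborel_on I01. AE s in lborel_on Rpos. s_deriv g \<eta> x s = \<eta>' x s"
  proof eventually_elim
    case (elim x)
    show ?case
      by (rule weak_deriv_unique_AE[OF _ elim(3,4)]) (use elim(1,2) in auto)
  qed
  then show "AE p in strip. case_prod (s_deriv g \<eta>) p = case_prod \<eta>' p"
    using AE_strip_iff(1)[OF L2gD(1)[OF L] L2gD(1)[OF L']] by simp
qed

section \<open>The kernel and the energy norm\<close>

text \<open>On functions the linear structure is exact even though the norm is a seminorm, so
  regrouping terms in the abstract resolvent estimate is genuine algebra.\<close>

lemma vector_space_scale_state: "vector_space scale_state"
  by unfold_locales (auto simp: fun_eq_iff algebra_simps)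

lemma decaying_kernel_integrable:
  fixes g :: "real \<Rightarrow> real"
  assumes m: "g \<in> borel_measurable (lborel_on Rpos)" and pos: "\<forall>s>0. g s > 0"
    and le: "\<forall>s>0. g s \<le> C * exp (- c * s)" and c: "c > 0"
  shows "integrable (lborel_on Rpos) g"
proof -
  have C: "C \<ge> 0" using le[rule_format, of 1] pos[rule_format, of 1] by (smt (verit) exp_gt_zero mult_neg_pos)
  have "(\<integral>\<^sup>+s. ennreal (C * exp (- c * s)) * indicator {0..} s \<partial>lborel) = ennreal (0 - (- C * exp (- c * 0) / c))"
  proof (rule nn_integral_FTC_atLeast)
    have "((\<lambda>s. - C * exp (- c * s) / c) \<longlongrightarrow> - C * 0 / c) at_top"
    proof (intro tendsto_intros)
      have "filterlim (\<lambda>s. c * s) at_top at_top"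
        using c by (intro filterlim_tendsto_pos_mult_at_top[OF tendsto_const c] filterlim_ident)
      then have "filterlim (\<lambda>s. - (c * s)) at_bot at_top"
        by (simp add: filterlim_uminus_at_bot)
      then have "((\<lambda>s. exp (- (c * s))) \<longlongrightarrow> 0) at_top"
        by (rule filterlim_compose[OF exp_at_bot])
      then show "((\<lambda>s. exp (- c * s)) \<longlongrightarrow> 0) at_top" by simp
    qed (use c in auto)
    then show "((\<lambda>s. - C * exp (- c * s) / c) \<longlongrightarrow> 0) at_top" by simp
  qed (use c C in \<open>auto intro!: derivative_eq_intros\<close>)
  then have fin: "(\<integral>\<^sup>+s. ennreal (C * exp (- c * s)) * indicator {0..} s \<partial>lborel) < \<infinity>" by simp
  have "(\<integral>\<^sup>+s. ennreal (g s) \<partial>lborel_on Rpos) = (\<integral>\<^sup>+s. ennreal (g s) * indicator Rpos s \<partial>lborel)"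
    by (subst nn_integral_restrict_space) auto
  also have "\<dots> \<le> (\<integral>\<^sup>+s. ennreal (C * exp (- c * s)) * indicator {0..} s \<partial>lborel)"
    using le by (intro nn_integral_mono) (auto split: split_indicator intro: ennreal_leI)
  finally have "(\<integral>\<^sup>+s. ennreal (g s) \<partial>lborel_on Rpos) < \<infinity>" using fin by simp
  then show ?thesis
    using m pos by (intro integrableI_nonneg) (auto intro!: AE_I2 simp: space_restrict_space less_imp_le)
qed

text \<open>Shifting by half a period \<open>h = pi / \<omega>\<close> changes the sign of the oscillating factor, and the total
  variation of the decreasing kernel bounds the integral of \<open>\<bar>G s - G (s + h)\<bar>\<close>.\<close>

lemma monotone_kernel_Fourier_bound:
  fixes G :: "real \<Rightarrow> real"
  assumes G: "integrable lborel G" and z: "\<And>s. s \<le> 0 \<Longrightarrow> G s = 0"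
    and b: "\<And>s. 0 \<le> G s" "\<And>s. G s \<le> L" and mono: "antimono_on Rpos G" and \<omega>: "\<omega> > 0"
  shows "cmod (LINT s|lborel. of_real (G s) * exp (- (\<i> * of_real (\<omega> * s)))) \<le> L * pi / \<omega>"
proof -
  define h where "h = pi / \<omega>"
  have h: "h > 0" using \<omega> by (simp add: h_def)
  define e where "e s = exp (- (\<i> * of_real (\<omega> * s)))" for s :: real
  have ecm: "cmod (e s) = 1" for s by (simp add: e_def)
  have "e \<in> borel_measurable borel"
    unfolding e_def by (intro borel_measurable_continuous_onI continuous_intros)
  then have em[measurable]: "e \<in> borel_measurable lborel" by simp
  have eh: "e (h + s) = - e s" for s
  proof -
    have "\<omega> * (h + s) = pi + \<omega> * s" using \<omega> by (simp add: h_def algebra_simps)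
    then have "e (h + s) = exp (- (\<i> * of_real pi)) * e s" by (simp add: e_def exp_add[symmetric] algebra_simps)
    then show ?thesis by (simp add: exp_minus)
  qed
  have i: "integrable lborel (\<lambda>s. of_real (F s) * e s)" if "integrable lborel F" for F
  proof (rule Bochner_Integration.integrable_bound[OF that])
    have [measurable]: "F \<in> borel_measurable lborel" using that by auto
    show "(\<lambda>s. of_real (F s) * e s) \<in> borel_measurable lborel" by measurable
  qed (simp add: norm_mult ecm)
  have Gh: "integrable lborel (\<lambda>s. G (h + s))"
    using lborel_integrable_real_affine[OF G, of 1 h] by simp
  have Ih: "(LINT s|lborel. G (h + s)) = (LINT s|lborel. G s)"
    using lborel_integral_real_affine[of 1 G h] by simp
  let ?I = "LINT s|lborel. of_real (G s) * e s"
  have "?I = (LINT s|lborel. of_real (G (h + s)) * e (h + s))"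
    using lborel_integral_real_affine[of 1 "\<lambda>s. of_real (G s) * e s" h] by simp
  also have "\<dots> = - (LINT s|lborel. of_real (G (h + s)) * e s)" by (simp add: eh)
  finally have "2 * ?I = ?I - (LINT s|lborel. of_real (G (h + s)) * e s)" by simp
  also have "\<dots> = (LINT s|lborel. of_real (G s - G (h + s)) * e s)"
    using i[OF G] i[OF Gh] by (simp add: left_diff_distrib)
  finally have "2 * cmod ?I = cmod (LINT s|lborel. of_real (G s - G (h + s)) * e s)"
    by (metis norm_mult norm_numeral)
  also have "\<dots> \<le> (LINT s|lborel. cmod (of_real (G s - G (h + s)) * e s))"
    by (rule integral_norm_bound)
  \<comment> \<open>For s > 0 the difference is nonnegative. On {-h..0} it equals - G (h + s), and
    adding 2 L corrects the sign. By translation invariance the difference itself integrates to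
    zero, so only 2 L h is left.\<close>
  also have "\<dots> \<le> (LINT s|lborel. (G s - G (h + s)) + 2 * L * indicator {-h..0} s)"
  proof (rule integral_mono)
    show "integrable lborel (\<lambda>s. cmod (of_real (G s - G (h + s)) * e s))"
      using G Gh by (intro integrable_norm i) simp
    show "integrable lborel (\<lambda>s. (G s - G (h + s)) + 2 * L * indicator {-h..0} s)"
      using G Gh by (intro Bochner_Integration.integrable_add Bochner_Integration.integrable_diff
          integrable_mult_right integrable_real_indicator) (auto simp: emeasure_lborel_Icc_eq)
    show "cmod (of_real (G s - G (h + s)) * e s) \<le> (G s - G (h + s)) + 2 * L * indicator {-h..0} s" for s
    proof -
      consider "s > 0" | "s \<in> {-h..0}" | "s < - h" by fastforce
      then have "\<bar>G s - G (h + s)\<bar> \<le> (G s - G (h + s)) + 2 * L * indicator {-h..0} s"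
      proof cases
        case 1
        then have "G (h + s) \<le> G s" using mono h by (auto simp: monotone_on_def)
        then show ?thesis using 1 by simp
      next
        case 2
        then show ?thesis using z[of s] b[of "h + s"] by simp
      next
        case 3
        then show ?thesis using z[of s] z[of "h + s"] h by simp
      qed
      then show ?thesis by (simp add: norm_mult ecm del: of_real_diff)
    qed
  qed
  also have "\<dots> = 2 * L * h"
    using G Gh h by (simp add: Ih)
  finally show ?thesis unfolding e_def h_def by simp
qed

section \<open>Consequences of the kernel hypothesis and the energy seminorm\<close>

locale timoshenko =
  fixes \<rho>1 \<rho>2 k1 k2 :: real and g :: "real \<Rightarrow> real"
  assumes pos: "\<rho>1 > 0" "\<rho>2 > 0" "k1 > 0" "k2 > 0"
    and H: "hypothesis_H k2 g"
begin

abbreviation "N \<equiv> energy_norm \<rho>1 \<rho>2 k1 k2 g"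

lemma g_pos: "\<forall>s>0. g s > 0" and g_mono: "antimono_on Rpos g" and k_pos: "reduced_k2 k2 g > 0"
  using H by (simp_all add: hypothesis_H_def)

lemma g_measurable: "g \<in> borel_measurable (lborel_on Rpos)"
proof -
  have "continuous_on Rpos g"
    using H unfolding hypothesis_H_def
    by (auto intro!: continuous_at_imp_continuous_on differentiable_imp_continuous_within)
  then have "g \<in> borel_measurable (restrict_space borel Rpos)"
    by (rule borel_measurable_continuous_on_restrict)
  then show ?thesis
    by (subst measurable_cong_sets[OF sets_restrict_space_cong[OF sets_lborel] refl])
qed

text \<open>By monotonicity the finite limit at 0 is an upper bound.\<close>

lemma g_bounded: obtains L where "\<And>s. s > 0 \<Longrightarrow> g s \<le> L"
proof -
  obtain L where L: "(g \<longlongrightarrow> L) (at_right 0)" using H by (auto simp: hypothesis_H_def)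
  show ?thesis
  proof (rule that)
    fix t :: real assume t: "t > 0"
    have "\<forall>\<^sub>F s in at_right 0. g t \<le> g s"
      using eventually_at_right_less[of 0] eventually_at_right_real[OF t]
      by eventually_elim (use g_mono t in \<open>auto simp: monotone_on_def\<close>)
    then show "g t \<le> L" by (rule tendsto_lowerbound[OF L]) simp
  qed
qed

text \<open>The Bochner integral in \<open>reduced_k2\<close> would be 0 for a non-integrable
  kernel, so integrability has to be derived: the differential inequality makes g s * exp (c s)
  nonincreasing. The comparison starts at 1, since g is controlled only on positive arguments; the
  factor exp c makes the same bound exceed L for s below 1.\<close>

lemma g_integrable: "integrable (lborel_on Rpos) g"
proof -
  obtain c where c: "c > 0" and dg: "\<forall>s>0. deriv g s \<le> - c * g s"
    using H by (auto simp: hypothesis_H_def)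
  obtain L where L: "\<And>s. s > 0 \<Longrightarrow> g s \<le> L" by (rule g_bounded) blast
  have L0: "L > 0" using L[of 1] g_pos[rule_format, of 1] by simp
  have "g s \<le> (L * exp c) * exp (- c * s)" if s: "s > 0" for s
  proof (cases "s \<ge> 1")
    case True
    have "g s * exp (c * s) \<le> g 1 * exp (c * 1)"
    proof (rule DERIV_nonpos_imp_nonincreasing[OF True])
      fix x :: real assume x: "1 \<le> x" "x \<le> s"
      have "g differentiable at x" using H x by (auto simp: hypothesis_H_def)
      then have "(g has_real_derivative deriv g x) (at x)"
        by (simp add: DERIV_deriv_iff_real_differentiable)
      then have "((\<lambda>s. g s * exp (c * s)) has_real_derivative (deriv g x + c * g x) * exp (c * x)) (at x)"
        by (auto intro!: derivative_eq_intros simp: algebra_simps)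
      moreover have "(deriv g x + c * g x) * exp (c * x) \<le> 0"
        using dg[rule_format, of x] x by (intro mult_nonpos_nonneg) auto
      ultimately show "\<exists>y. ((\<lambda>s. g s * exp (c * s)) has_real_derivative y) (at x) \<and> y \<le> 0" by blast
    qed
    also have "\<dots> \<le> L * exp c" using L[of 1] by simp
    finally show ?thesis by (simp add: exp_minus field_simps)
  next
    case False
    have "L \<le> L * (exp c * exp (- c * s))"
      using False c L0 by (subst exp_add[symmetric]) (simp add: algebra_simps)
    then show ?thesis using L[OF s] by simp
  qed
  then show ?thesis
    by (intro decaying_kernel_integrable[OF g_measurable g_pos _ c]) auto
qed

text \<open>The one-sided Fourier transform of the kernel, produced by the oscillating part of the
  history 1 - exp(- i omega s).\<close>

definition ghat :: "real \<Rightarrow> complex" where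
  "ghat \<omega> = (LINT s|lborel_on Rpos. of_real (g s) * exp (- (\<i> * of_real (\<omega> * s))))"

lemma ghat_bound: obtains L where "\<And>\<omega>. \<omega> > 0 \<Longrightarrow> cmod (ghat \<omega>) \<le> L / \<omega>"
proof -
  obtain L where L: "\<And>s. s > 0 \<Longrightarrow> g s \<le> L" by (rule g_bounded) blast
  have L0: "L > 0" using L[of 1] g_pos[rule_format, of 1] by simp
  show ?thesis
  proof (rule that)
    fix \<omega> :: real assume \<omega>: "\<omega> > 0"
    let ?G = "\<lambda>s. indicator Rpos s *\<^sub>R g s"
    have "ghat \<omega> = (LINT s|lborel. of_real (?G s) * exp (- (\<i> * of_real (\<omega> * s))))"
      unfolding ghat_def
      by (subst integral_restrict_space)
        (auto intro!: Bochner_Integration.integral_cong split: split_indicator)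
    also have "cmod \<dots> \<le> L * pi / \<omega>"
    proof (rule monotone_kernel_Fourier_bound[OF _ _ _ _ _ \<omega>])
      show "integrable lborel ?G" using g_integrable by (simp add: integrable_restrict_space)
      show "antimono_on Rpos ?G" using g_mono by (auto simp: monotone_on_def)
    qed (use L L0 g_pos in \<open>auto simp: less_imp_le split: split_indicator\<close>)
    finally show "cmod (ghat \<omega>) \<le> (L * pi) / \<omega>" .
  qed
qed

lemma energy_norm_power2:
  "(N (v1, v2, v3, v4, v5))\<^sup>2 = \<rho>1 * (L2_norm v3)\<^sup>2 + \<rho>2 * (L2_norm v4)\<^sup>2
       + k1 * (L2_norm (\<lambda>x. weak_deriv v1 x + v2 x))\<^sup>2
       + reduced_k2 k2 g * (L2_norm (weak_deriv v2))\<^sup>2 + (L2g_norm g v5)\<^sup>2"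
  using pos k_pos by (simp del: real_sqrt_pow2_iff)

lemma energy_norm_nonneg: "N U \<ge> 0"
  using pos k_pos by (cases U) simp

text \<open>Each of the five squared terms satisfies the quadratic estimate with the same
  \<open>\<theta>\<close>; their weighted sum is the hypothesis of
  \<open>triangle_of_quadratic\<close>, so no inner product is involved.\<close>

lemma energy_space_add:
  assumes "U \<in> energy_space g" "V \<in> energy_space g"
  shows "U + V \<in> energy_space g" "N (U + V) \<le> N U + N V"
proof -
  obtain u1 u2 u3 u4 u5 where U: "U = (u1, u2, u3, u4, u5)" by (cases U)
  obtain v1 v2 v3 v4 v5 where V: "V = (v1, v2, v3, v4, v5)" by (cases V)
  have u: "u1 \<in> H10" "u2 \<in> H10" "u3 \<in> L2" "u4 \<in> L2" "u5 \<in> L2g g"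
    and v: "v1 \<in> H10" "v2 \<in> H10" "v3 \<in> L2" "v4 \<in> L2" "v5 \<in> L2g g"
    using assms by (auto simp: energy_space_def U V)
  have UV: "U + V = (\<lambda>x. u1 x + v1 x, \<lambda>x. u2 x + v2 x, \<lambda>x. u3 x + v3 x, \<lambda>x. u4 x + v4 x, \<lambda>x s. u5 x s + v5 x s)"
    by (simp add: U V plus_fun_def)
  have h: "(\<lambda>x. f x + f' x) \<in> H10" if "f \<in> H10" "f' \<in> H10" for f f'
    using H10_linear[OF that, of 1] by simp
  have w: "(\<lambda>x s. u5 x s + v5 x s) \<in> L2g g"
    using L2g_linear(1)[OF g_measurable g_pos u(5) v(5), of 1] by simp
  show "U + V \<in> energy_space g"
    unfolding UV energy_space_def using u v w by (auto intro: h L2_add(1))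
  note wu = H1_weak_deriv[OF H10_H1[OF u(1)]] H1_weak_deriv[OF H10_H1[OF u(2)]]
  note wv = H1_weak_deriv[OF H10_H1[OF v(1)]] H1_weak_deriv[OF H10_H1[OF v(2)]]
  note a1 = H1_add[OF H10_H1[OF u(1)] H10_H1[OF v(1)]] and a2 = H1_add[OF H10_H1[OF u(2)] H10_H1[OF v(2)]]
  have e3: "L2_norm (\<lambda>x. weak_deriv (\<lambda>x. u1 x + v1 x) x + (u2 x + v2 x)) =
      L2_norm (\<lambda>x. (weak_deriv u1 x + u2 x) + (weak_deriv v1 x + v2 x))"
  proof (rule L2_norm_cong_AE)
    show "AE x in lborel_on I01. weak_deriv (\<lambda>x. u1 x + v1 x) x + (u2 x + v2 x) = (weak_deriv u1 x + u2 x) + (weak_deriv v1 x + v2 x)"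
      using a1(2) by eventually_elim simp
  qed (intro L2_measurable L2_add wu wv H1_weak_deriv(2)[OF a1(1)])+
  have e4: "L2_norm (weak_deriv (\<lambda>x. u2 x + v2 x)) = L2_norm (\<lambda>x. weak_deriv u2 x + weak_deriv v2 x)"
    by (rule L2_norm_cong_AE[OF _ _ a2(2)]) (intro L2_measurable L2_add wu wv H1_weak_deriv(2)[OF a2(1)])+
  show "N (U + V) \<le> N U + N V"
  proof (rule triangle_of_quadratic[OF energy_norm_nonneg energy_norm_nonneg])
    fix \<theta> :: real assume \<theta>: "0 < \<theta>" "\<theta> < 1"
    have s: "c * a \<le> c * b / \<theta> + c * d / (1 - \<theta>)" if "a \<le> b / \<theta> + d / (1 - \<theta>)" "c \<ge> 0" for a b c d :: real
      using mult_left_mono[OF that] by (simp add: distrib_left)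
    note q = s[OF L2_add(2)[OF u(3) v(3) \<theta>] less_imp_le[OF pos(1)]]
      s[OF L2_add(2)[OF u(4) v(4) \<theta>] less_imp_le[OF pos(2)]]
      s[OF L2_add(2)[OF L2_add(1)[OF wu(2) wu(4)] L2_add(1)[OF wv(2) wv(4)] \<theta>] less_imp_le[OF pos(3)]]
      s[OF L2_add(2)[OF wu(5) wv(5) \<theta>] less_imp_le[OF k_pos]]
      L2g_linear(2)[OF g_measurable g_pos u(5) v(5) \<theta>]
    show "(N (U + V))\<^sup>2 \<le> (N U)\<^sup>2 / \<theta> + (N V)\<^sup>2 / (1 - \<theta>)"
      unfolding UV unfolding U V energy_norm_power2 e3 e4 add_divide_distrib using q by linarith
  qed
qed

lemma energy_space_scale:
  assumes "U \<in> energy_space g"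
  shows "scale_state c U \<in> energy_space g" "N (scale_state c U) = cmod c * N U"
proof -
  obtain u1 u2 u3 u4 u5 where U: "U = (u1, u2, u3, u4, u5)" by (cases U)
  have u: "u1 \<in> H10" "u2 \<in> H10" "u3 \<in> L2" "u4 \<in> L2" "u5 \<in> L2g g"
    using assms by (auto simp: energy_space_def U)
  have h: "(\<lambda>x. c * f x) \<in> H10" if "f \<in> H10" for f
    using H10_linear[OF that that, of "c - 1"] by (simp add: algebra_simps)
  note g5 = L2g_scale[OF g_measurable g_pos u(5), of c]
  show "scale_state c U \<in> energy_space g"
    unfolding U energy_space_def using u g5 by (auto intro: h L2_scale)
  note w1 = H1_weak_deriv[OF H10_H1[OF u(1)]] and w2 = H1_weak_deriv[OF H10_H1[OF u(2)]]
  note a1 = H1_scale[OF H10_H1[OF u(1)], of c] and a2 = H1_scale[OF H10_H1[OF u(2)], of c]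
  have e3: "L2_norm (\<lambda>x. weak_deriv (\<lambda>x. c * u1 x) x + c * u2 x) = L2_norm (\<lambda>x. c * (weak_deriv u1 x + u2 x))"
  proof (rule L2_norm_cong_AE)
    show "AE x in lborel_on I01. weak_deriv (\<lambda>x. c * u1 x) x + c * u2 x = c * (weak_deriv u1 x + u2 x)"
      using a1(2) by eventually_elim (simp add: distrib_left)
  qed (intro L2_measurable L2_add L2_scale w1 w2 H1_weak_deriv(2)[OF a1(1)])+
  have e4: "L2_norm (weak_deriv (\<lambda>x. c * u2 x)) = L2_norm (\<lambda>x. c * weak_deriv u2 x)"
    by (rule L2_norm_cong_AE[OF _ _ a2(2)]) (intro L2_measurable L2_scale w2 H1_weak_deriv(2)[OF a2(1)])+
  have "(N (scale_state c U))\<^sup>2 = (cmod c * N U)\<^sup>2"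
    unfolding U scale_state.simps power_mult_distrib energy_norm_power2 e3 e4 L2_norm_scale g5(2)
    by (simp add: algebra_simps)
  then show "N (scale_state c U) = cmod c * N U"
    using energy_norm_nonneg by (simp add: power2_eq_iff_nonneg)
qed

end

section \<open>Separated states\<close>

lemma continuous_measurable_lborel_on:
  fixes f :: "real \<Rightarrow> complex"
  assumes "continuous_on UNIV f" shows "f \<in> borel_measurable (lborel_on S)"
  using assms by (intro measurable_restrict_space1) (simp add: borel_measurable_continuous_onI)

text \<open>A second weak derivative is taken of a chosen first one, which agrees with the classical
  derivative only almost everywhere. Weak derivatives do not see the difference.\<close>

lemma AE_eq_C1_H1:
  assumes w: "w \<in> L2" and ae: "AE x in lborel_on I01. w x = f x" and f: "C1_deriv f f'"
  shows "w \<in> H1" "AE x in lborel_on I01. weak_deriv w x = f' x"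
proof -
  have "AE x in lborel_on I01. f x = w x" using ae by eventually_elim simp
  moreover have "has_weak_deriv I01 f f'" by (rule has_weak_deriv_C1[OF _ f]) simp
  moreover note m = continuous_measurable_lborel_on[OF C1_derivD(2)[OF f]] continuous_measurable_lborel_on[OF C1_derivD(3)[OF f]]
  ultimately have d: "has_weak_deriv I01 w f'"
    using has_weak_deriv_cong_AE[of I01 f f' w f'] L2_measurable[OF w] by simp
  have f': "f' \<in> L2" by (rule continuous_L2[OF C1_derivD(2)[OF f]])
  show "w \<in> H1" unfolding H1_def using w d f' by blast
  show "AE x in lborel_on I01. weak_deriv w x = f' x" by (rule weak_deriv_AE(3)[OF f' d])
qed

lemma C2_H2:
  assumes f: "C1_deriv f f'" and f': "C1_deriv f' f''"
  shows "f \<in> H2" "AE x in lborel_on I01. weak_deriv (weak_deriv f) x = f'' x"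
proof -
  note w = C1_H1[OF f]
  note w2 = AE_eq_C1_H1[OF H1_weak_deriv(2)[OF w(1)] w(2) f']
  show "f \<in> H2" unfolding H2_def using w w2 by simp
  show "AE x in lborel_on I01. weak_deriv (weak_deriv f) x = f'' x" by (rule w2(2))
qed

lemma C1_deriv_scale:
  fixes f :: "real \<Rightarrow> complex"
  assumes "C1_deriv f f'"
  shows "C1_deriv (\<lambda>x. c * f x) (\<lambda>x. c * f' x)"
  using assms unfolding C1_deriv_def by (auto intro!: derivative_intros continuous_intros)

lemma C1_deriv_add:
  fixes f :: "real \<Rightarrow> complex"
  assumes "C1_deriv f f'" "C1_deriv h h'"
  shows "C1_deriv (\<lambda>x. f x + h x) (\<lambda>x. f' x + h' x)"
  using assms unfolding C1_deriv_def by (auto intro!: derivative_intros continuous_intros)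

lemma has_x_deriv_tensor:
  assumes \<psi>: "C1_deriv \<psi> \<psi>'" and E: "continuous_on UNIV E"
  shows "has_x_deriv (\<lambda>x s. \<psi> x * E s) (\<lambda>x s. \<psi>' x * E s)"
    and "case_prod (\<lambda>x s. \<psi> x * E s) \<in> borel_measurable strip"
proof -
  have m: "case_prod (\<lambda>x s. f x * E s) \<in> borel_measurable strip" if "continuous_on UNIV f" for f
  proof -
    have [measurable]: "f \<in> borel_measurable (lborel_on I01)" "E \<in> borel_measurable (lborel_on Rpos)"
      using that E by (auto intro: continuous_measurable_lborel_on)
    show ?thesis by measurable
  qed
  show "case_prod (\<lambda>x s. \<psi> x * E s) \<in> borel_measurable strip" by (rule m[OF C1_derivD(3)[OF \<psi>]])
  have "(\<lambda>x. \<psi>' x * E s) \<in> L2 \<and> has_weak_deriv I01 (\<lambda>x. \<psi> x * E s) (\<lambda>x. \<psi>' x * E s)" for s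
  proof
    have "(\<lambda>x. E s * \<psi>' x) \<in> L2" by (intro L2_scale continuous_L2 C1_derivD(2)[OF \<psi>])
    then show "(\<lambda>x. \<psi>' x * E s) \<in> L2" by (simp add: mult.commute)
    have "has_weak_deriv I01 (\<lambda>x. E s * \<psi> x) (\<lambda>x. E s * \<psi>' x)"
      by (intro has_weak_deriv_scale has_weak_deriv_C1 \<psi>) simp
    then show "has_weak_deriv I01 (\<lambda>x. \<psi> x * E s) (\<lambda>x. \<psi>' x * E s)" by (simp add: mult.commute)
  qed
  then show "has_x_deriv (\<lambda>x s. \<psi> x * E s) (\<lambda>x s. \<psi>' x * E s)"
    unfolding has_x_deriv_def using m[OF C1_derivD(2)[OF \<psi>]] by simp
qed

text \<open>For almost every s the norm of the slice derivative is the modulus of E s times a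
  constant, which is continuous and zero at s = 0.\<close>

lemma zero_trace_tensor:
  assumes \<psi>: "C1_deriv \<psi> \<psi>'" and E: "continuous_on UNIV E" and E0: "E 0 = 0"
  shows "zero_trace (\<lambda>x s. \<psi> x * E s)"
  unfolding zero_trace_def
proof (intro allI impI)
  fix \<epsilon> :: real assume \<epsilon>: "\<epsilon> > 0"
  let ?\<eta> = "\<lambda>x s. \<psi> x * E s"
  note d = has_x_deriv_tensor(1)[OF \<psi> E]
  note x = x_deriv_spec[OF d]
  have m: "case_prod (x_deriv ?\<eta>) \<in> borel_measurable strip" "case_prod (\<lambda>x s. \<psi>' x * E s) \<in> borel_measurable strip"
    using x d by (auto simp: has_x_deriv_def)
  have "AE s in lborel_on Rpos. AE x in lborel_on I01. x_deriv ?\<eta> x s = \<psi>' x * E s"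
    using x(2) AE_strip_iff(2)[OF m] by simp
  with AE_space have n: "AE s in lborel_on Rpos. L2_norm (\<lambda>x. x_deriv ?\<eta> x s) = cmod (E s) * L2_norm \<psi>'"
  proof eventually_elim
    case (elim s)
    have s: "s \<in> Rpos" using elim(1) by (simp add: space_restrict_space)
    have "L2_norm (\<lambda>x. x_deriv ?\<eta> x s) = L2_norm (\<lambda>x. \<psi>' x * E s)"
      by (rule L2_norm_cong_AE[OF strip_section_measurable(2)[OF m(1) s] strip_section_measurable(2)[OF m(2) s] elim(2)])
    also have "\<dots> = cmod (E s) * L2_norm \<psi>'"
      using L2_norm_scale[of "E s" \<psi>'] by (simp add: mult.commute)
    finally show ?case .
  qed
  have "continuous_on UNIV (\<lambda>s. cmod (E s) * L2_norm \<psi>')" using E by (intro continuous_intros)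
  then have "isCont (\<lambda>s. cmod (E s) * L2_norm \<psi>') 0" by (simp add: continuous_on_eq_continuous_at)
  then obtain \<delta> where \<delta>: "\<delta> > 0" "\<And>s. \<bar>s\<bar> < \<delta> \<Longrightarrow> \<bar>cmod (E s) * L2_norm \<psi>'\<bar> < \<epsilon>"
    using \<epsilon> unfolding continuous_at_eps_delta by (auto simp: E0 dist_real_def)
  have "AE s in lborel_on Rpos. s < \<delta> \<longrightarrow> L2_norm (\<lambda>x. x_deriv ?\<eta> x s) < \<epsilon>"
    using n AE_space
  proof eventually_elim
    case (elim s)
    then show ?case using \<delta>(2)[of s] by (auto simp: space_restrict_space)
  qed
  then show "\<exists>\<delta>>0. AE s in lborel_on Rpos. s < \<delta> \<longrightarrow> L2_norm (\<lambda>x. x_deriv ?\<eta> x s) < \<epsilon>"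
    using \<delta>(1) by blast
qed

lemma integral_I01_FTC:
  fixes f :: "real \<Rightarrow> real"
  assumes "C1_deriv F f"
  shows "(LINT x|lborel_on I01. f x) = F 1 - F 0"
proof -
  have [measurable]: "f \<in> borel_measurable borel"
    by (rule borel_measurable_continuous_onI[OF C1_derivD(2)[OF assms]])
  have "(LINT x|lborel_on I01. f x) = (LINT x|lborel. indicator I01 x *\<^sub>R f x)"
    by (simp add: integral_restrict_space)
  also have "\<dots> = (LINT x|lborel. indicator {0..1} x *\<^sub>R f x)"
  proof (rule integral_cong_AE)
    show "AE x in lborel. indicator I01 x *\<^sub>R f x = indicator {0..1} x *\<^sub>R f x"
      using AE_lborel_singleton[of "0::real"] AE_lborel_singleton[of "1::real"]
      by eventually_elim (auto split: split_indicator)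
  qed measurable
  also have "\<dots> = F 1 - F 0"
    by (intro integral_FTC_atLeastAtMost C1_derivD[OF assms]) simp
  finally show ?thesis .
qed

context timoshenko
begin

text \<open>The density factorises into a function of x and one of s; the latter is integrable
  because E is bounded and g integrable.\<close>

lemma tensor_L2g:
  assumes \<psi>: "C1_deriv \<psi> \<psi>'" "\<psi> 0 = 0" "\<psi> 1 = 0" and E: "continuous_on UNIV E" "\<And>s. cmod (E s) \<le> K"
  shows "(\<lambda>x s. \<psi> x * E s) \<in> L2g g"
proof (rule L2gI(1)[where g=g, OF g_measurable g_pos has_x_deriv_tensor(1)[OF \<psi>(1) E(1)]])
  show "case_prod (\<lambda>x s. \<psi> x * E s) \<in> borel_measurable strip" by (rule has_x_deriv_tensor(2)[OF \<psi>(1) E(1)])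
  have "(\<lambda>x. \<psi> x * E s) \<in> H10" for s
    using H10_linear[of "\<lambda>x. E s * \<psi> x" "\<lambda>x. E s * \<psi> x" 0] H10_C1[OF C1_deriv_scale[OF \<psi>(1)], of "E s"] \<psi>(2,3)
    by (simp add: mult.commute)
  then show "AE s in lborel_on Rpos. (\<lambda>x. \<psi> x * E s) \<in> H10" by simp
  have K: "K \<ge> 0" using E(2)[of 0] by (rule order_trans[OF norm_ge_zero])
  have gE: "integrable (lborel_on Rpos) (\<lambda>s. g s * (cmod (E s))\<^sup>2)"
  proof (rule Bochner_Integration.integrable_bound[where f="\<lambda>s. K\<^sup>2 * g s"])
    have [measurable]: "g \<in> borel_measurable (lborel_on Rpos)" "E \<in> borel_measurable (lborel_on Rpos)"
      by (rule g_measurable, rule continuous_measurable_lborel_on[OF E(1)])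
    show "(\<lambda>s. g s * (cmod (E s))\<^sup>2) \<in> borel_measurable (lborel_on Rpos)" by measurable
    show "AE s in lborel_on Rpos. norm (g s * (cmod (E s))\<^sup>2) \<le> norm (K\<^sup>2 * g s)"
      using E(2) by (auto intro!: AE_I2 mult_left_mono power_mono simp: abs_mult mult.commute[of "K\<^sup>2"])
  qed (use g_integrable in simp)
  show "integrable strip (Qg g (\<lambda>x s. \<psi>' x * E s))"
  proof (rule strip.Fubini_integrable)
    have eq: "Qg g (\<lambda>x s. \<psi>' x * E s) (x, s) = (cmod (\<psi>' x))\<^sup>2 * (g s * (cmod (E s))\<^sup>2)" for x s
      by (simp add: Qg_def norm_mult power_mult_distrib)
    show "Qg g (\<lambda>x s. \<psi>' x * E s) \<in> borel_measurable strip"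
      using has_x_deriv_tensor(1)[OF \<psi>(1) E(1)] by (intro Qg_measurable g_measurable) (simp add: has_x_deriv_def)
    show "AE x in lborel_on I01. integrable (lborel_on Rpos) (\<lambda>s. Qg g (\<lambda>x s. \<psi>' x * E s) (x, s))"
      unfolding eq using gE by simp
    have "(LINT s|lborel_on Rpos. norm (Qg g (\<lambda>x s. \<psi>' x * E s) (x, s))) =
      (cmod (\<psi>' x))\<^sup>2 * (LINT s|lborel_on Rpos. \<bar>g s * (cmod (E s))\<^sup>2\<bar>)" for x
      unfolding eq by (simp add: abs_mult)
    then show "integrable (lborel_on I01) (\<lambda>x. LINT s|lborel_on Rpos. norm (Qg g (\<lambda>x s. \<psi>' x * E s) (x, s)))"
      using L2_square_integrable[OF continuous_L2[OF C1_derivD(2)[OF \<psi>(1)]]] by simp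
  qed
qed

text \<open>Applied both to V - A U, where the last component vanishes only almost everywhere, and
  to the resolvent residual, where it vanishes identically.\<close>

lemma energy_norm_reduced:
  assumes r3: "r3 \<in> L2" and r4: "r4 \<in> L2"
    and r5: "case_prod r5 \<in> borel_measurable strip" "AE p in strip. case_prod r5 p = 0"
  shows "(N (\<lambda>_. 0, \<lambda>_. 0, r3, r4, r5))\<^sup>2 = \<rho>1 * (L2_norm r3)\<^sup>2 + \<rho>2 * (L2_norm r4)\<^sup>2"
proof -
  have "C1_deriv (\<lambda>_. 0::complex) (\<lambda>_. 0)" by (simp add: C1_deriv_def)
  note w = C1_H1[OF this]
  have L0: "L2_norm (\<lambda>_. 0) = 0" by (simp add: L2_norm_def)
  have w0: "L2_norm (weak_deriv (\<lambda>_. 0)) = 0"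
    using L2_norm_cong_AE[OF L2_measurable[OF H1_weak_deriv(2)[OF w(1)]] _ w(2)] L0 by simp
  have d: "has_x_deriv r5 (\<lambda>_ _. 0)"
  proof -
    have "AE s in lborel_on Rpos. AE x in lborel_on I01. r5 x s = 0"
      using AE_strip_iff(2)[OF r5(1), of "\<lambda>_ _. 0"] r5(2) by simp
    with AE_space have "AE s in lborel_on Rpos. has_weak_deriv I01 (\<lambda>x. r5 x s) (\<lambda>x. 0)"
    proof eventually_elim
      case (elim s)
      have s: "s \<in> Rpos" using elim(1) by (simp add: space_restrict_space)
      have "AE x in lborel_on I01. 0 = r5 x s" using elim(2) by eventually_elim simp
      then show ?case
        using has_weak_deriv_cong_AE[of I01 "\<lambda>_. 0" "\<lambda>_. 0" "\<lambda>x. r5 x s" "\<lambda>_. 0"] strip_section_measurable(2)[OF r5(1) s]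
        by (simp add: has_weak_deriv_def)
    qed
    moreover have "(\<lambda>_. 0) \<in> L2" by (rule continuous_L2) simp
    ultimately show ?thesis by (simp add: has_x_deriv_def)
  qed
  have "Qg g (\<lambda>_ _. 0) = (\<lambda>_. 0)" by (auto simp: Qg_def)
  then have "(L2g_norm g r5)\<^sup>2 = 0"
    using L2gI(2)[where g=g, OF g_measurable g_pos d] by simp
  then show ?thesis unfolding energy_norm_power2 by (simp add: w0)
qed

text \<open>E solves E' + \<open>\<mu>\<close> E = \<open>\<mu>\<close> with E 0 = 0, so the history
  equation holds exactly. V lists the image of U under the operator by classical formulas;
  \<open>A1\<close> works with chosen weak derivatives, hence agreement only up to seminorm
  zero.\<close>

lemma A1_separated:
  fixes \<omega> :: real
  assumes \<phi>: "C1_deriv \<phi> \<phi>'" "C1_deriv \<phi>' \<phi>''" "\<phi> 0 = 0" "\<phi> 1 = 0"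
    and \<psi>: "C1_deriv \<psi> \<psi>'" "C1_deriv \<psi>' \<psi>''" "\<psi> 0 = 0" "\<psi> 1 = 0"
  defines "\<mu> \<equiv> \<i> * of_real \<omega>"
  defines "E \<equiv> \<lambda>s::real. 1 - exp (- (\<i> * of_real (\<omega> * s)))"
  defines "U \<equiv> (\<phi>, \<psi>, \<lambda>x. \<mu> * \<phi> x, \<lambda>x. \<mu> * \<psi> x, \<lambda>x s. \<psi> x * E s)"
  defines "V \<equiv> (\<lambda>x. \<mu> * \<phi> x, \<lambda>x. \<mu> * \<psi> x, \<lambda>x. of_real (k1 / \<rho>1) * (\<phi>'' x + \<psi>' x),
      \<lambda>x. of_real (1 / \<rho>2) * ((of_real k2 - ghat \<omega>) * \<psi>'' x - of_real k1 * (\<phi>' x + \<psi> x)),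
      \<lambda>x s. \<mu> * (\<psi> x * E s))"
  shows "U \<in> energy_space g" "V \<in> energy_space g" "U \<in> domain_A1 k2 g" "N (V - A1 \<rho>1 \<rho>2 k1 k2 g U) = 0"
proof -
  define E' where "E' s = \<mu> * exp (- (\<i> * of_real (\<omega> * s)))" for s :: real
  let ?\<eta> = "\<lambda>x s. \<psi> x * E s" and ?\<eta>' = "\<lambda>x s. \<psi> x * E' s"
  define \<sigma> where "\<sigma> = of_real k2 - ghat \<omega>"
  have E: "C1_deriv E E'"
    unfolding C1_deriv_def
  proof
    have "((\<lambda>s::real. - (\<i> * of_real (\<omega> * s))) has_vector_derivative - \<mu>) (at s)" for s
      unfolding \<mu>_def by (auto intro!: derivative_eq_intros)
    from field_vector_diff_chain_at[OF this DERIV_exp]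
    have "((\<lambda>s::real. exp (- (\<i> * of_real (\<omega> * s)))) has_vector_derivative - \<mu> * exp (- (\<i> * of_real (\<omega> * s)))) (at s)" for s
      by (simp add: o_def)
    then show "\<forall>s. (E has_vector_derivative E' s) (at s)"
      unfolding E_def E'_def by (auto intro!: derivative_eq_intros)
    show "continuous_on UNIV E'" unfolding E'_def by (intro continuous_intros)
  qed
  note Ec = C1_derivD(3,2)[OF E, of UNIV]
  have Eb: "cmod (E s) \<le> 2" for s
    unfolding E_def by (rule order_trans[OF norm_triangle_ineq4]) simp
  have E'b: "cmod (E' s) \<le> \<bar>\<omega>\<bar>" for s by (simp add: E'_def \<mu>_def norm_mult)
  have E0: "E 0 = 0" by (simp add: E_def)
  have h: "\<phi> \<in> H10" "\<psi> \<in> H10" "(\<lambda>x. \<mu> * \<phi> x) \<in> H10" "(\<lambda>x. \<mu> * \<psi> x) \<in> H10"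
    using \<phi> \<psi> by (auto intro: H10_C1 C1_deriv_scale)
  have eta: "?\<eta> \<in> L2g g" by (rule tensor_L2g[OF \<psi>(1,3,4) Ec(1) Eb])
  have eta': "?\<eta>' \<in> L2g g" by (rule tensor_L2g[OF \<psi>(1,3,4) Ec(2) E'b])
  have cL: "continuous_on UNIV f \<Longrightarrow> f \<in> L2" for f by (rule continuous_L2)
  note ct = C1_derivD(2,3)[OF \<phi>(1)] C1_derivD(2)[OF \<phi>(2)] C1_derivD(2,3)[OF \<psi>(1)] C1_derivD(2)[OF \<psi>(2)]
  show Ue: "U \<in> energy_space g"
    unfolding U_def energy_space_def using h eta H10_L2 by simp
  have V3: "(\<lambda>x. of_real (k1 / \<rho>1) * (\<phi>'' x + \<psi>' x)) \<in> L2"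
    and V4: "(\<lambda>x. of_real (1 / \<rho>2) * ((of_real k2 - ghat \<omega>) * \<psi>'' x - of_real k1 * (\<phi>' x + \<psi> x))) \<in> L2"
    by (intro cL continuous_intros ct)+
  show Ve: "V \<in> energy_space g"
    unfolding V_def energy_space_def using h V3 V4 L2g_scale(1)[OF g_measurable g_pos eta] by simp
  have sd: "has_s_deriv g ?\<eta> ?\<eta>'"
    unfolding has_s_deriv_def using eta' E
    by (auto intro!: AE_I2 has_weak_deriv_scale has_weak_deriv_C1)
  \<comment> \<open>The constant part of E restores the mass of g that \<open>reduced_k2\<close>
    subtracts, leaving k2 - \<open>ghat \<omega>\<close>. The stress is thus a complex multiple of
    \<open>\<psi>\<close> and inherits its regularity and boundary values.\<close>
  have ts: "total_stress k2 g \<psi> ?\<eta> = (\<lambda>x. \<sigma> * \<psi> x)"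
  proof -
    have i: "integrable (lborel_on Rpos) (\<lambda>s. complex_of_real (g s))" using g_integrable by simp
    have ie: "integrable (lborel_on Rpos) (\<lambda>s. of_real (g s) * exp (- (\<i> * of_real (\<omega> * s))))"
    proof (rule Bochner_Integration.integrable_bound[OF g_integrable])
      have [measurable]: "g \<in> borel_measurable (lborel_on Rpos)"
        "(\<lambda>s. exp (- (\<i> * of_real (\<omega> * s)))) \<in> borel_measurable (lborel_on Rpos)"
        by (rule g_measurable, intro continuous_measurable_lborel_on continuous_intros)
      show "(\<lambda>s. of_real (g s) * exp (- (\<i> * of_real (\<omega> * s)))) \<in> borel_measurable (lborel_on Rpos)"
        by measurable
    qed (simp add: norm_mult)
    have "(LINT s|lborel_on Rpos. of_real (g s) * (\<psi> x * E s)) = \<psi> x * (of_real (LINT s|lborel_on Rpos. g s) - ghat \<omega>)" for x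
    proof -
      have "(LINT s|lborel_on Rpos. of_real (g s) * (\<psi> x * E s)) =
        (LINT s|lborel_on Rpos. \<psi> x * (of_real (g s) - of_real (g s) * exp (- (\<i> * of_real (\<omega> * s)))))"
        by (intro Bochner_Integration.integral_cong) (auto simp: E_def algebra_simps)
      also have "\<dots> = \<psi> x * (LINT s|lborel_on Rpos. of_real (g s) - of_real (g s) * exp (- (\<i> * of_real (\<omega> * s))))"
        by (rule integral_mult_right_zero)
      also have "(LINT s|lborel_on Rpos. of_real (g s) - of_real (g s) * exp (- (\<i> * of_real (\<omega> * s)))) =
          of_real (LINT s|lborel_on Rpos. g s) - ghat \<omega>"
        unfolding ghat_def using Bochner_Integration.integral_diff[OF i ie] by simp
      finally show ?thesis .
    qed
    then show ?thesis
      unfolding total_stress_def by (simp add: fun_eq_iff \<sigma>_def reduced_k2_def algebra_simps)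
  qed
  note s1 = C1_deriv_scale[OF \<psi>(1), of \<sigma>] and s2 = C1_deriv_scale[OF \<psi>(2), of \<sigma>]
  show Ud: "U \<in> domain_A1 k2 g"
    using Ue sd C2_H2(1)[OF \<phi>(1,2)] h C2_H2(1)[OF s1 s2] H10_C1[OF s1] \<psi>(3,4) zero_trace_tensor[OF \<psi>(1) Ec(1) E0]
    unfolding domain_A1_def by (auto simp: U_def ts)
  note w1 = C1_H1[OF \<phi>(1)]
  have v3: "(\<lambda>y. weak_deriv \<phi> y + \<psi> y) \<in> L2"
    using H1_weak_deriv(2)[OF w1(1)] H10_L2[OF h(2)] by (rule L2_add(1))
  have "AE x in lborel_on I01. weak_deriv \<phi> x + \<psi> x = \<phi>' x + \<psi> x"
    using w1(2) by eventually_elim simp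
  note w3 = AE_eq_C1_H1[OF v3 this C1_deriv_add[OF \<phi>(2) \<psi>(1)]]
  note w4 = C2_H2[OF s1 s2]
  have w4L: "weak_deriv (weak_deriv (\<lambda>x. \<sigma> * \<psi> x)) \<in> L2"
    using w4(1) H1_weak_deriv(2) unfolding H2_def by blast
  note sa = s_deriv_AE[OF g_measurable g_pos g_mono sd]
  define r3 where "r3 x = of_real (k1 / \<rho>1) * (\<phi>'' x + \<psi>' x) - of_real (k1 / \<rho>1) * weak_deriv (\<lambda>y. weak_deriv \<phi> y + \<psi> y) x" for x
  define r4 where "r4 x = of_real (1 / \<rho>2) * ((of_real k2 - ghat \<omega>) * \<psi>'' x - of_real k1 * (\<phi>' x + \<psi> x)) -
      of_real (1 / \<rho>2) * (weak_deriv (weak_deriv (\<lambda>x. \<sigma> * \<psi> x)) x - of_real k1 * (weak_deriv \<phi> x + \<psi> x))" for x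
  define r5 where "r5 x s = \<mu> * (\<psi> x * E s) - (\<mu> * \<psi> x - s_deriv g ?\<eta> x s)" for x s
  have VA: "V - A1 \<rho>1 \<rho>2 k1 k2 g U = (\<lambda>_. 0, \<lambda>_. 0, r3, r4, r5)"
    unfolding V_def U_def A1.simps ts by (simp add: fun_eq_iff r3_def r4_def r5_def)
  have r3L: "r3 \<in> L2" unfolding r3_def
    by (intro L2_diff V3 L2_scale H1_weak_deriv(2)[OF w3(1)])
  have r4L: "r4 \<in> L2" unfolding r4_def
    by (intro L2_diff V4 L2_scale w4L v3)
  have z: "L2_norm r = 0" if "r \<in> L2" "AE x in lborel_on I01. r x = 0" for r
    using L2_norm_cong_AE[OF L2_measurable[OF that(1)] _ that(2)] by (simp add: L2_norm_def)
  have r3z: "L2_norm r3 = 0"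
  proof (rule z[OF r3L])
    show "AE x in lborel_on I01. r3 x = 0" using w3(2) by eventually_elim (simp add: r3_def)
  qed
  have r4z: "L2_norm r4 = 0"
  proof (rule z[OF r4L])
    show "AE x in lborel_on I01. r4 x = 0"
      using w4(2) w1(2) by eventually_elim (simp add: r4_def \<sigma>_def)
  qed
  have sm[measurable]: "case_prod (s_deriv g ?\<eta>) \<in> borel_measurable strip" by (rule L2gD(1)[OF sa(1)])
  have em[measurable]: "case_prod ?\<eta> \<in> borel_measurable strip" by (rule L2gD(1)[OF eta])
  have pm[measurable]: "\<psi> \<in> borel_measurable (lborel_on I01)" by (rule L2_measurable[OF H10_L2[OF h(2)]])
  have "(\<lambda>p. \<mu> * case_prod ?\<eta> p - (\<mu> * \<psi> (fst p) - case_prod (s_deriv g ?\<eta>) p)) \<in> borel_measurable strip"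
    by measurable
  then have r5m: "case_prod r5 \<in> borel_measurable strip" by (simp add: r5_def case_prod_beta')
  \<comment> \<open>Once the chosen s-derivative is replaced by \<open>\<psi> x * E' s\<close>, this
    is the differential equation for E.\<close>
  have r5z: "AE p in strip. case_prod r5 p = 0"
    using sa(2) by eventually_elim (auto simp: r5_def E_def E'_def algebra_simps)
  show "N (V - A1 \<rho>1 \<rho>2 k1 k2 g U) = 0"
    unfolding VA using energy_norm_reduced[OF r3L r4L r5m r5z] r3z r4z by (simp del: energy_norm.simps)
qed

text \<open>The first, second and fifth components of \<open>\<mu>\<close> U - V cancel identically.
  Since the square of \<open>\<mu>\<close> is minus the square of \<open>\<omega>\<close>, the other
  two are, up to sign and the densities, the equation residuals bounded in \<open>b3\<close> and
  \<open>b4\<close>.\<close>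

lemma resolvent_residual:
  fixes \<omega> :: real and \<eta> :: "real \<Rightarrow> real \<Rightarrow> complex"
  assumes \<phi>: "C1_deriv \<phi> \<phi>'" "C1_deriv \<phi>' \<phi>''" and \<psi>: "C1_deriv \<psi> \<psi>'" "C1_deriv \<psi>' \<psi>''"
  defines "\<mu> \<equiv> \<i> * of_real \<omega>"
  defines "U \<equiv> (\<phi>, \<psi>, \<lambda>x. \<mu> * \<phi> x, \<lambda>x. \<mu> * \<psi> x, \<eta>)"
  defines "V \<equiv> (\<lambda>x. \<mu> * \<phi> x, \<lambda>x. \<mu> * \<psi> x, \<lambda>x. of_real (k1 / \<rho>1) * (\<phi>'' x + \<psi>' x),
      \<lambda>x. of_real (1 / \<rho>2) * ((of_real k2 - ghat \<omega>) * \<psi>'' x - of_real k1 * (\<phi>' x + \<psi> x)),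
      \<lambda>x s. \<mu> * \<eta> x s)"
  assumes b3: "\<And>x. cmod (of_real (\<rho>1 * \<omega>\<^sup>2) * \<phi> x + of_real k1 * (\<phi>'' x + \<psi>' x)) \<le> \<rho>1 * C3"
    and b4: "\<And>x. cmod (of_real (\<rho>2 * \<omega>\<^sup>2) * \<psi> x + (of_real k2 - ghat \<omega>) * \<psi>'' x - of_real k1 * (\<phi>' x + \<psi> x)) \<le> \<rho>2 * C4"
  shows "(N (scale_state \<mu> U - V))\<^sup>2 \<le> \<rho>1 * C3\<^sup>2 + \<rho>2 * C4\<^sup>2"
proof -
  define r3 where "r3 x = \<mu> * (\<mu> * \<phi> x) - of_real (k1 / \<rho>1) * (\<phi>'' x + \<psi>' x)" for x
  define r4 where "r4 x = \<mu> * (\<mu> * \<psi> x) -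
    of_real (1 / \<rho>2) * ((of_real k2 - ghat \<omega>) * \<psi>'' x - of_real k1 * (\<phi>' x + \<psi> x))" for x
  have eq: "scale_state \<mu> U - V = (\<lambda>_. 0, \<lambda>_. 0, r3, r4, \<lambda>_ _. 0)"
    unfolding U_def V_def by (simp add: fun_eq_iff r3_def r4_def)
  note ct = C1_derivD(2,3)[OF \<phi>(1)] C1_derivD(2)[OF \<phi>(2)] C1_derivD(2,3)[OF \<psi>(1)] C1_derivD(2)[OF \<psi>(2)]
  have mm: "\<mu> * (\<mu> * z) = - (of_real (\<omega>\<^sup>2) * z)" for z
    by (simp add: \<mu>_def power2_eq_square algebra_simps)
  have c3: "cmod (r3 x) \<le> C3" for x
  proof -
    have "of_real \<rho>1 * r3 x = - (of_real (\<rho>1 * \<omega>\<^sup>2) * \<phi> x + of_real k1 * (\<phi>'' x + \<psi>' x))"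
      using pos unfolding r3_def mm by (simp add: field_simps)
    then have "\<rho>1 * cmod (r3 x) \<le> \<rho>1 * C3" using b3[of x] pos
      by (metis abs_of_pos norm_minus_cancel norm_mult norm_of_real)
    then show ?thesis using pos by simp
  qed
  have c4: "cmod (r4 x) \<le> C4" for x
  proof -
    have "of_real \<rho>2 * r4 x = - (of_real (\<rho>2 * \<omega>\<^sup>2) * \<psi> x + (of_real k2 - ghat \<omega>) * \<psi>'' x - of_real k1 * (\<phi>' x + \<psi> x))"
      using pos unfolding r4_def mm by (simp add: field_simps)
    then have "\<rho>2 * cmod (r4 x) \<le> \<rho>2 * C4" using b4[of x] pos
      by (metis abs_of_pos norm_minus_cancel norm_mult norm_of_real)
    then show ?thesis using pos by simp
  qed
  have m: "r3 \<in> borel_measurable (lborel_on I01)" "r4 \<in> borel_measurable (lborel_on I01)"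
    unfolding r3_def r4_def by (intro continuous_measurable_lborel_on continuous_intros ct)+
  note L3 = L2_bounded[OF m(1), of C3] and L4 = L2_bounded[OF m(2), of C4]
  have "(N (scale_state \<mu> U - V))\<^sup>2 = \<rho>1 * (L2_norm r3)\<^sup>2 + \<rho>2 * (L2_norm r4)\<^sup>2"
    unfolding eq by (rule energy_norm_reduced) (use L3(1) L4(1) c3 c4 in auto)
  also have "\<dots> \<le> \<rho>1 * C3\<^sup>2 + \<rho>2 * C4\<^sup>2"
    using L3(2) L4(2) c3 c4 pos by (intro add_mono mult_left_mono power_mono L2_norm_nonneg) auto
  finally show ?thesis .
qed

end

section \<open>Quasimodes\<close>

context timoshenko
begin

lemma quasimodes:
  assumes speeds: "\<rho>1 / k1 \<noteq> \<rho>2 / k2"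
  obtains K where "\<And>n. n \<ge> (1::nat) \<Longrightarrow> \<exists>\<omega>::real. \<exists>U\<in>energy_space g. \<exists>V\<in>energy_space g.
    U \<in> domain_A1 k2 g \<and> N (V - A1 \<rho>1 \<rho>2 k1 k2 g U) = 0 \<and> k1 / 2 \<le> (N U)\<^sup>2 \<and>
    (N (scale_state (\<i> * of_real \<omega>) U - V))\<^sup>2 \<le> K / (real n)\<^sup>2"
proof -
  obtain L where L: "\<And>\<omega>. \<omega> > 0 \<Longrightarrow> cmod (ghat \<omega>) \<le> L / \<omega>" by (rule ghat_bound) blast
  \<comment> \<open>c is the speed of the first wave. r is fixed by k2 (r \<open>\<nu>\<close>)^2 =
    \<open>\<rho>2\<close> \<open>\<omega>\<close>^2 with \<open>\<omega>\<close> = c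
    \<open>\<nu>\<close>: the second equation without memory resonates with \<open>\<omega>\<close>
    at the spatial frequency r \<open>\<nu>\<close>.\<close>
  define c where "c = sqrt (k1 / \<rho>1)"
  define r where "r = c * sqrt (\<rho>2 / k2)"
  \<comment> \<open>The detuning: k2 \<open>\<nu>\<close>^2 - \<open>\<rho>2\<close>
    \<open>\<omega>\<close>^2 = \<open>\<kappa>\<close> \<open>\<nu>\<close>^2, with
    \<open>\<kappa>\<close> nonzero because the wave speeds differ.\<close>
  define \<kappa> where "\<kappa> = k2 - \<rho>2 * k1 / \<rho>1"
  define A where "A = k1 / \<bar>\<kappa>\<bar>"
  \<comment> \<open>C3 / \<open>\<nu>\<close> and C4 / \<open>\<nu>\<close> will bound the two
    residuals. The summands of C4 stem from the rounding of \<open>\<tau>\<close>, from the memory,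
    and from the zero-order coupling term k1 q.\<close>
  define C3 where "C3 = k1 * (A * (r + 2)) / \<rho>1"
  define C4 where "C4 = (A * (k2 * (pi * (2 * r + 1))) + L / c * (A * (1 + (r + 1)\<^sup>2)) + k1 * (2 * A)) / \<rho>2"
  have c: "c > 0" "c\<^sup>2 = k1 / \<rho>1" using pos by (auto simp: c_def)
  have r: "r > 0" "k2 * r\<^sup>2 = \<rho>2 * c\<^sup>2" using c pos by (auto simp: r_def power_mult_distrib)
  have \<kappa>: "\<kappa> \<noteq> 0" using speeds pos by (auto simp: \<kappa>_def field_simps)
  have A: "A > 0" using \<kappa> pos by (simp add: A_def)
  show ?thesis
  proof (rule that[of "\<rho>1 * C3\<^sup>2 + \<rho>2 * C4\<^sup>2"])
    fix n :: nat assume n: "n \<ge> 1"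
    define \<nu> where "\<nu> = 2 * pi * real n"
    \<comment> \<open>For small n the rounding may give \<open>\<tau>\<close> = 0 or
      \<open>\<tau>\<close> = \<open>\<nu>\<close>. Both are harmless: in the second case q is zero,
      and the identities and bounds below remain true.\<close>
    define \<tau> where "\<tau> = 2 * pi * of_int (round (r * \<nu> / (2 * pi)))"
    define \<omega> where "\<omega> = c * \<nu>"
    \<comment> \<open>The solution of a (\<open>\<rho>2\<close> \<open>\<omega>\<close>^2 - k2
      \<open>\<nu>\<close>^2) = k1, so that a cos (\<open>\<nu>\<close> x) balances the coupling
      term.\<close>
    define a where "a = - k1 / (\<kappa> * \<nu>\<^sup>2)"
    have "pi > 1" using pi_gt3 by linarith
    then have \<nu>n: "\<nu> \<ge> real n" and \<nu>pi: "\<nu> \<ge> pi" using n by (auto simp: \<nu>_def mult_left_le_one_le intro: order_trans[OF _ mult_right_mono])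
    have \<nu>1: "\<nu> \<ge> 1" "\<nu> > 0" using \<nu>pi \<open>pi > 1\<close> by auto
    have \<omega>: "\<omega> > 0" using c \<nu>1 by (simp add: \<omega>_def)
    have near: "\<bar>\<tau> - r * \<nu>\<bar> \<le> pi"
    proof -
      have "\<bar>of_int (round (r * \<nu> / (2 * pi))) - r * \<nu> / (2 * pi)\<bar> \<le> 1 / 2"
        by (rule of_int_round_abs_le)
      then have "2 * pi * \<bar>of_int (round (r * \<nu> / (2 * pi))) - r * \<nu> / (2 * pi)\<bar> \<le> 2 * pi * (1 / 2)"
        by (intro mult_left_mono) auto
      also have "2 * pi * \<bar>of_int (round (r * \<nu> / (2 * pi))) - r * \<nu> / (2 * pi)\<bar> = \<bar>2 * pi * (of_int (round (r * \<nu> / (2 * pi))) - r * \<nu> / (2 * pi))\<bar>"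
        by (simp add: abs_mult)
      also have "2 * pi * (of_int (round (r * \<nu> / (2 * pi))) - r * \<nu> / (2 * pi)) = \<tau> - r * \<nu>"
        by (simp add: \<tau>_def right_diff_distrib)
      finally show ?thesis by simp
    qed
    have r\<nu>: "r * \<nu> > 0" using r \<nu>1 by simp
    have \<tau>: "\<bar>\<tau>\<bar> \<le> (r + 1) * \<nu>" using near \<nu>pi r\<nu> by (simp add: algebra_simps)
    \<comment> \<open>The difference of squares is only of first order in \<open>\<nu>\<close>: a
      factor at most pi times a factor of size \<open>\<nu>\<close>.\<close>
    have \<tau>2: "\<bar>\<tau>\<^sup>2 - (r * \<nu>)\<^sup>2\<bar> \<le> pi * (2 * r + 1) * \<nu>"
    proof -
      have "\<tau>\<^sup>2 - (r * \<nu>)\<^sup>2 = (\<tau> - r * \<nu>) * (\<tau> + r * \<nu>)" by (simp add: power2_eq_square algebra_simps)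
      then have "\<bar>\<tau>\<^sup>2 - (r * \<nu>)\<^sup>2\<bar> = \<bar>\<tau> - r * \<nu>\<bar> * \<bar>\<tau> + r * \<nu>\<bar>" by (simp add: abs_mult)
      also have "\<dots> \<le> pi * ((2 * r + 1) * \<nu>)"
        using near \<tau> r\<nu> by (intro mult_mono) (auto simp: algebra_simps)
      finally show ?thesis by (simp add: mult.assoc)
    qed
    have trig: "sin \<nu> = 0" "cos \<nu> = 1" "sin (2 * \<nu>) = 0" "cos \<tau> = 1"
    proof -
      show "sin \<nu> = 0" "cos \<nu> = 1"
        using sin_2npi[of n] cos_2npi[of n] by (simp_all add: \<nu>_def mult_ac)
      then show "sin (2 * \<nu>) = 0" by (simp add: sin_double)
      show "cos \<tau> = 1" using cos_int_2pin unfolding \<tau>_def by blast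
    qed
    have aA: "\<bar>a\<bar> = A / \<nu>\<^sup>2" using \<nu>1 pos by (simp add: a_def A_def abs_mult)
    have a\<kappa>: "a * (\<kappa> * \<nu>\<^sup>2) = - k1" using \<kappa> \<nu>1 by (simp add: a_def)
    define p where "p x = sin (\<nu> * x) / \<nu>" for x :: real
    define p' where "p' x = cos (\<nu> * x)" for x :: real
    define p'' where "p'' x = - \<nu> * sin (\<nu> * x)" for x :: real
    define q where "q x = a * (cos (\<nu> * x) - cos (\<tau> * x))" for x :: real
    define q' where "q' x = a * (\<tau> * sin (\<tau> * x) - \<nu> * sin (\<nu> * x))" for x :: real
    define q'' where "q'' x = a * (\<tau>\<^sup>2 * cos (\<tau> * x) - \<nu>\<^sup>2 * cos (\<nu> * x))" for x :: real
    have dp: "C1_deriv p p'" "C1_deriv p' p''" and dq: "C1_deriv q q'" "C1_deriv q' q''"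
      using \<nu>1 unfolding C1_deriv_def has_real_derivative_iff_has_vector_derivative[symmetric]
        p_def p'_def p''_def q_def q'_def q''_def
      by (auto intro!: derivative_eq_intros continuous_intros simp: power2_eq_square algebra_simps)
    have bc: "p 0 = 0" "p 1 = 0" "q 0 = 0" "q 1 = 0"
      by (simp_all add: p_def q_def trig)
    have b0: "\<bar>q x\<bar> \<le> 2 * A / \<nu>" for x
    proof -
      have "\<bar>cos (\<nu> * x) - cos (\<tau> * x)\<bar> \<le> 2"
        using abs_cos_le_one[of "\<nu> * x"] abs_cos_le_one[of "\<tau> * x"] by linarith
      then have "\<bar>q x\<bar> \<le> A / \<nu>\<^sup>2 * 2"
        unfolding q_def abs_mult aA using A by (intro mult_left_mono) auto
      also have "\<dots> \<le> 2 * A / \<nu>"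
        using \<nu>1 A by (simp add: field_simps power2_eq_square)
      finally show ?thesis .
    qed
    have b1: "\<bar>q' x\<bar> \<le> A * (r + 2) / \<nu>" for x
    proof -
      have "\<bar>\<tau> * sin (\<tau> * x)\<bar> \<le> (r + 1) * \<nu> * 1" "\<bar>\<nu> * sin (\<nu> * x)\<bar> \<le> \<nu> * 1"
        unfolding abs_mult using \<tau> \<nu>1 by (intro mult_mono; simp)+
      then have "\<bar>\<tau> * sin (\<tau> * x) - \<nu> * sin (\<nu> * x)\<bar> \<le> (r + 2) * \<nu>" by (simp add: algebra_simps)
      then have "\<bar>q' x\<bar> \<le> A / \<nu>\<^sup>2 * ((r + 2) * \<nu>)"
        unfolding q'_def abs_mult[of a] aA using A by (intro mult_left_mono) auto
      also have "\<dots> = A * (r + 2) / \<nu>" using \<nu>1 by (simp add: power2_eq_square)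
      finally show ?thesis .
    qed
    \<comment> \<open>No decay in \<open>\<nu>\<close> here: two derivatives use up the amplitude,
      and \<open>ghat \<omega>\<close> must provide the missing factor.\<close>
    have b2: "\<bar>q'' x\<bar> \<le> A * (1 + (r + 1)\<^sup>2)" for x
    proof -
      have "\<tau>\<^sup>2 \<le> ((r + 1) * \<nu>)\<^sup>2" using \<tau> by (metis abs_ge_zero power2_abs power_mono)
      then have "\<bar>\<tau>\<^sup>2 * cos (\<tau> * x)\<bar> \<le> ((r + 1) * \<nu>)\<^sup>2 * 1" "\<bar>\<nu>\<^sup>2 * cos (\<nu> * x)\<bar> \<le> \<nu>\<^sup>2 * 1"
        unfolding abs_mult by (intro mult_mono; simp)+
      moreover have "(1 + (r + 1)\<^sup>2) * \<nu>\<^sup>2 = ((r + 1) * \<nu>)\<^sup>2 + \<nu>\<^sup>2"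
        by (subst power_mult_distrib, subst distrib_right) simp
      ultimately have "\<bar>\<tau>\<^sup>2 * cos (\<tau> * x) - \<nu>\<^sup>2 * cos (\<nu> * x)\<bar> \<le> (1 + (r + 1)\<^sup>2) * \<nu>\<^sup>2"
        by linarith
      then have "\<bar>q'' x\<bar> \<le> A / \<nu>\<^sup>2 * ((1 + (r + 1)\<^sup>2) * \<nu>\<^sup>2)"
        unfolding q''_def abs_mult[of a] aA using A by (intro mult_left_mono) auto
      also have "\<dots> = A * (1 + (r + 1)\<^sup>2)" using \<nu>1 by simp
      finally show ?thesis .
    qed
    have first: "\<rho>1 * \<omega>\<^sup>2 * p x + k1 * (p'' x + q' x) = k1 * q' x" for x
    proof -
      have "\<rho>1 * \<omega>\<^sup>2 = k1 * \<nu>\<^sup>2" using c pos by (simp add: \<omega>_def power_mult_distrib)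
      then show ?thesis using \<nu>1 by (simp add: p_def p''_def power2_eq_square algebra_simps)
    qed
    \<comment> \<open>By the choice of a the cos (\<open>\<nu>\<close> x) parts cancel against k1
      p'; what survives is the correcting mode, weighted by its distance from resonance.\<close>
    have second: "\<rho>2 * \<omega>\<^sup>2 * q x + k2 * q'' x - k1 * p' x = a * (k2 * (\<tau>\<^sup>2 - (r * \<nu>)\<^sup>2)) * cos (\<tau> * x)" for x
    proof -
      have w: "\<rho>2 * \<omega>\<^sup>2 = k2 * (r * \<nu>)\<^sup>2" using r by (simp add: \<omega>_def power_mult_distrib)
      have "k2 * (r * \<nu>)\<^sup>2 = k2 * r\<^sup>2 * \<nu>\<^sup>2" by (simp add: power_mult_distrib)
      also have "k2 * r\<^sup>2 = k2 - \<kappa>" unfolding r(2) c(2) by (simp add: \<kappa>_def)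
      finally have "k2 * (r * \<nu>)\<^sup>2 = (k2 - \<kappa>) * \<nu>\<^sup>2" .
      then have "k2 * (r * \<nu>)\<^sup>2 - k2 * \<nu>\<^sup>2 = - (\<kappa> * \<nu>\<^sup>2)" by (simp add: left_diff_distrib)
      then have "a * (k2 * (r * \<nu>)\<^sup>2 - k2 * \<nu>\<^sup>2) = k1" using a\<kappa> by simp
      then have "a * (k2 * (r * \<nu>)\<^sup>2 - k2 * \<nu>\<^sup>2) * cos (\<nu> * x) = k1 * cos (\<nu> * x)" by simp
      then show ?thesis unfolding w by (simp add: q_def q''_def p'_def algebra_simps)
    qed
    let ?p = "\<lambda>x. of_real (p x) :: complex" and ?p' = "\<lambda>x. of_real (p' x) :: complex" and ?p'' = "\<lambda>x. of_real (p'' x) :: complex"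
    let ?q = "\<lambda>x. of_real (q x) :: complex" and ?q' = "\<lambda>x. of_real (q' x) :: complex" and ?q'' = "\<lambda>x. of_real (q'' x) :: complex"
    note dc = C1_deriv_of_real[OF dp(1)] C1_deriv_of_real[OF dp(2)] C1_deriv_of_real[OF dq(1)] C1_deriv_of_real[OF dq(2)]
    let ?\<mu> = "\<i> * of_real \<omega>"
    let ?E = "\<lambda>s::real. 1 - exp (- (\<i> * of_real (\<omega> * s)))"
    let ?U = "(?p, ?q, \<lambda>x. ?\<mu> * ?p x, \<lambda>x. ?\<mu> * ?q x, \<lambda>x s. ?q x * ?E s)"
    let ?V = "(\<lambda>x. ?\<mu> * ?p x, \<lambda>x. ?\<mu> * ?q x, \<lambda>x. of_real (k1 / \<rho>1) * (?p'' x + ?q' x),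
      \<lambda>x. of_real (1 / \<rho>2) * ((of_real k2 - ghat \<omega>) * ?q'' x - of_real k1 * (?p' x + ?q x)),
      \<lambda>x s. ?\<mu> * (?q x * ?E s))"
    have UV: "?U \<in> energy_space g" "?V \<in> energy_space g" "?U \<in> domain_A1 k2 g"
      "N (?V - A1 \<rho>1 \<rho>2 k1 k2 g ?U) = 0"
      by (rule A1_separated[OF dc(1,2) _ _ dc(3,4)]; simp add: bc)+
    \<comment> \<open>The kinetic term of the first equation suffices: \<open>\<omega>\<close> = c
      \<open>\<nu>\<close> undoes the division by \<open>\<nu>\<close> in p, and the square of the
      sine has mean 1 / 2.\<close>
    have "k1 / 2 \<le> (N ?U)\<^sup>2"
    proof -
      have "C1_deriv (\<lambda>x. x / 2 - sin (2 * \<nu> * x) / (4 * \<nu>)) (\<lambda>x. (sin (\<nu> * x))\<^sup>2)"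
        unfolding C1_deriv_def has_real_derivative_iff_has_vector_derivative[symmetric]
      proof
        show "\<forall>x. ((\<lambda>x. x / 2 - sin (2 * \<nu> * x) / (4 * \<nu>)) has_real_derivative (sin (\<nu> * x))\<^sup>2) (at x)"
        proof
          fix x
          have "cos (2 * \<nu> * x) = 1 - 2 * (sin (\<nu> * x))\<^sup>2"
            using cos_double_sin[of "\<nu> * x"] by (simp add: mult.assoc)
          then show "((\<lambda>x. x / 2 - sin (2 * \<nu> * x) / (4 * \<nu>)) has_real_derivative (sin (\<nu> * x))\<^sup>2) (at x)"
            using \<nu>1 by (auto intro!: derivative_eq_intros simp: diff_divide_distrib)
        qed
      qed (intro continuous_intros)
      from integral_I01_FTC[OF this] have I: "(LINT x|lborel_on I01. (sin (\<nu> * x))\<^sup>2) = 1 / 2"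
        by (simp add: trig)
      have "(L2_norm (\<lambda>x. ?\<mu> * ?p x))\<^sup>2 = (LINT x|lborel_on I01. c\<^sup>2 * (sin (\<nu> * x))\<^sup>2)"
        unfolding L2_norm_power2 using \<nu>1 by (simp add: norm_mult p_def \<omega>_def power_mult_distrib power_divide)
      also have "\<dots> = c\<^sup>2 * (1 / 2)" using I by simp
      finally have "\<rho>1 * (L2_norm (\<lambda>x. ?\<mu> * ?p x))\<^sup>2 = k1 / 2" using c pos by simp
      then show ?thesis
        unfolding energy_norm_power2 using pos k_pos by simp
    qed
    moreover have "(N (scale_state ?\<mu> ?U - ?V))\<^sup>2 \<le> (\<rho>1 * C3\<^sup>2 + \<rho>2 * C4\<^sup>2) / (real n)\<^sup>2"
    proof -
      have "(N (scale_state ?\<mu> ?U - ?V))\<^sup>2 \<le> \<rho>1 * (C3 / \<nu>)\<^sup>2 + \<rho>2 * (C4 / \<nu>)\<^sup>2"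
      proof (rule resolvent_residual[OF dc])
        fix x
        have "cmod (of_real (\<rho>1 * \<omega>\<^sup>2) * ?p x + of_real k1 * (?p'' x + ?q' x)) = cmod (of_real (k1 * q' x))"
          unfolding first[of x, symmetric] by simp
        also have "\<dots> = k1 * \<bar>q' x\<bar>" by (simp only: norm_of_real abs_mult abs_of_pos[OF pos(3)])
        also have "\<dots> \<le> k1 * (A * (r + 2) / \<nu>)" using b1 pos by (intro mult_left_mono) auto
        also have "\<dots> = \<rho>1 * (C3 / \<nu>)" using pos by (simp add: C3_def)
        finally show "cmod (of_real (\<rho>1 * \<omega>\<^sup>2) * ?p x + of_real k1 * (?p'' x + ?q' x)) \<le> \<rho>1 * (C3 / \<nu>)" .
        have "of_real (\<rho>2 * \<omega>\<^sup>2) * ?q x + (of_real k2 - ghat \<omega>) * ?q'' x - of_real k1 * (?p' x + ?q x)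
          = of_real (\<rho>2 * \<omega>\<^sup>2 * q x + k2 * q'' x - k1 * p' x) - ghat \<omega> * ?q'' x - of_real (k1 * q x)"
          by (simp add: algebra_simps)
        also have "cmod \<dots> \<le> \<bar>\<rho>2 * \<omega>\<^sup>2 * q x + k2 * q'' x - k1 * p' x\<bar> + cmod (ghat \<omega>) * \<bar>q'' x\<bar> + k1 * \<bar>q x\<bar>"
          using pos by (intro order_trans[OF norm_triangle_ineq4] add_mono)
            (simp_all only: norm_mult norm_of_real abs_mult abs_of_pos order_refl)
        also have "\<dots> \<le> A / \<nu>\<^sup>2 * (k2 * (pi * (2 * r + 1) * \<nu>)) + L / \<omega> * (A * (1 + (r + 1)\<^sup>2)) + k1 * (2 * A / \<nu>)"
        proof (intro add_mono)
          have "\<bar>a * (k2 * (\<tau>\<^sup>2 - (r * \<nu>)\<^sup>2)) * cos (\<tau> * x)\<bar> \<le> \<bar>a\<bar> * (k2 * (pi * (2 * r + 1) * \<nu>)) * 1"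
            unfolding abs_mult abs_of_pos[OF pos(4)] using \<tau>2 pos r \<nu>1
            by (intro mult_mono) auto
          then show "\<bar>\<rho>2 * \<omega>\<^sup>2 * q x + k2 * q'' x - k1 * p' x\<bar> \<le> A / \<nu>\<^sup>2 * (k2 * (pi * (2 * r + 1) * \<nu>))"
            unfolding second aA by simp
          show "cmod (ghat \<omega>) * \<bar>q'' x\<bar> \<le> L / \<omega> * (A * (1 + (r + 1)\<^sup>2))"
            using L[OF \<omega>] b2[of x] order_trans[OF norm_ge_zero L[OF \<omega>]] by (intro mult_mono) auto
          show "k1 * \<bar>q x\<bar> \<le> k1 * (2 * A / \<nu>)" using b0[of x] pos by (intro mult_left_mono) auto
        qed
        also have "\<dots> = \<rho>2 * (C4 / \<nu>)"
        proof -
          have 1: "A / \<nu>\<^sup>2 * (k2 * (pi * (2 * r + 1) * \<nu>)) = A * (k2 * (pi * (2 * r + 1))) / \<nu>"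
            using \<nu>1 by (simp add: power2_eq_square)
          have 2: "L / \<omega> * (A * (1 + (r + 1)\<^sup>2)) = L / c * (A * (1 + (r + 1)\<^sup>2)) / \<nu>"
            by (simp add: \<omega>_def)
          have "\<rho>2 * (C4 / \<nu>) = (A * (k2 * (pi * (2 * r + 1))) + L / c * (A * (1 + (r + 1)\<^sup>2)) + k1 * (2 * A)) / \<nu>"
            using pos by (simp add: C4_def)
          then show ?thesis unfolding 1 2 by (simp add: add_divide_distrib)
        qed
        finally show "cmod (of_real (\<rho>2 * \<omega>\<^sup>2) * ?q x + (of_real k2 - ghat \<omega>) * ?q'' x - of_real k1 * (?p' x + ?q x)) \<le> \<rho>2 * (C4 / \<nu>)" .
      qed
      also have "\<dots> = (\<rho>1 * C3\<^sup>2 + \<rho>2 * C4\<^sup>2) / \<nu>\<^sup>2"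
        by (simp add: power_divide add_divide_distrib)
      also have "\<dots> \<le> (\<rho>1 * C3\<^sup>2 + \<rho>2 * C4\<^sup>2) / (real n)\<^sup>2"
        using \<nu>n n pos by (intro divide_left_mono power_mono) auto
      finally show ?thesis .
    qed
    ultimately show "\<exists>\<omega>::real. \<exists>U\<in>energy_space g. \<exists>V\<in>energy_space g.
      U \<in> domain_A1 k2 g \<and> N (V - A1 \<rho>1 \<rho>2 k1 k2 g U) = 0 \<and> k1 / 2 \<le> (N U)\<^sup>2 \<and>
      (N (scale_state (\<i> * of_real \<omega>) U - V))\<^sup>2 \<le> (\<rho>1 * C3\<^sup>2 + \<rho>2 * C4\<^sup>2) / (real n)\<^sup>2"
      using UV by (intro exI[of _ \<omega>] bexI[of _ ?U] bexI[of _ ?V] conjI)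
  qed
qed

end

section \<open>Contradiction between the resolvent bound and the quasimodes\<close>

theorem theorem2p17:
  fixes \<rho>1 \<rho>2 k1 k2 :: real and g :: "real \<Rightarrow> real" and T :: "real \<Rightarrow> state \<Rightarrow> state"
  assumes "\<rho>1 > 0" and "\<rho>2 > 0" and "k1 > 0" and "k2 > 0"
    and "hypothesis_H k2 g"
    and "hypothesis_H' \<rho>1 \<rho>2 k1 k2 g"
    and "generates_semigroup scale_state (energy_space g) (energy_norm \<rho>1 \<rho>2 k1 k2 g)
           (domain_A1 k2 g) (A1 \<rho>1 \<rho>2 k1 k2 g) T"
  shows "\<not> uniformly_stable (energy_space g) (energy_norm \<rho>1 \<rho>2 k1 k2 g) T"
proof
  assume stable: "uniformly_stable (energy_space g) (energy_norm \<rho>1 \<rho>2 k1 k2 g) T"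
  interpret timoshenko \<rho>1 \<rho>2 k1 k2 g by unfold_locales (fact assms)+
  obtain C where C: "\<And>\<omega> U V. U \<in> energy_space g \<Longrightarrow> V \<in> energy_space g \<Longrightarrow> U \<in> domain_A1 k2 g \<Longrightarrow>
      N (V - A1 \<rho>1 \<rho>2 k1 k2 g U) = 0 \<Longrightarrow> N U \<le> C * N (scale_state (\<i> * of_real \<omega>) U - V)"
    using uniformly_stable_resolvent_bound[OF vector_space_scale_state energy_space_add(1) energy_space_scale(1)
        energy_space_add(2) energy_space_scale(2) assms(7) stable] by blast
  have "\<rho>1 / k1 \<noteq> \<rho>2 / k2" using assms(6) by (simp add: hypothesis_H'_def)
  then obtain K where K: "\<And>n. n \<ge> (1::nat) \<Longrightarrow> \<exists>\<omega>::real. \<exists>U\<in>energy_space g. \<exists>V\<in>energy_space g.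
    U \<in> domain_A1 k2 g \<and> N (V - A1 \<rho>1 \<rho>2 k1 k2 g U) = 0 \<and> k1 / 2 \<le> (N U)\<^sup>2 \<and>
    (N (scale_state (\<i> * of_real \<omega>) U - V))\<^sup>2 \<le> K / (real n)\<^sup>2"
    by (rule quasimodes) blast
  \<comment> \<open>The fixed energy k1 / 2 is squeezed below C^2 K / n^2 for every n, with C and K
    independent of n. Passing to squares also avoids any discussion of the sign of C.\<close>
  have bound: "k1 / 2 * (real n)\<^sup>2 \<le> C\<^sup>2 * K" if n: "n \<ge> 1" for n :: nat
  proof -
    obtain \<omega> :: real and U V where UV: "U \<in> energy_space g" "V \<in> energy_space g" "U \<in> domain_A1 k2 g"
      "N (V - A1 \<rho>1 \<rho>2 k1 k2 g U) = 0" and lo: "k1 / 2 \<le> (N U)\<^sup>2"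
      and up: "(N (scale_state (\<i> * of_real \<omega>) U - V))\<^sup>2 \<le> K / (real n)\<^sup>2"
      using K[OF n] by blast
    have "(N U)\<^sup>2 \<le> (C * N (scale_state (\<i> * of_real \<omega>) U - V))\<^sup>2"
      by (intro power_mono C UV energy_norm_nonneg)
    also have "\<dots> \<le> C\<^sup>2 * (K / (real n)\<^sup>2)"
      unfolding power_mult_distrib using up by (intro mult_left_mono) auto
    finally have "k1 / 2 \<le> C\<^sup>2 * (K / (real n)\<^sup>2)" by (rule order_trans[OF lo])
    then show ?thesis using n by (simp add: pos_le_divide_eq)
  qed
  obtain m :: nat where m: "real m > C\<^sup>2 * K / (k1 / 2)" using reals_Archimedean2 by blast
  define n where "n = max 1 m"
  have "real n \<le> (real n)\<^sup>2" by (rule self_le_power) (auto simp: n_def)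
  moreover have "real m \<le> real n" by (simp add: n_def)
  ultimately have "C\<^sup>2 * K / (k1 / 2) < (real n)\<^sup>2" using m by linarith
  then have "C\<^sup>2 * K < k1 / 2 * (real n)\<^sup>2" using pos(3) by (simp add: field_simps)
  with bound[of n] show False by (simp add: n_def)
qed

end
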